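(* Let $p$ be a polynomial on $\mathbb{R}^2\cong\mathbb{C}$. For $\gamma>0$ the function $w\mapsto h_\gamma(z,w,u,v)$ is given by an everywhere convergent power series in the coordinates of $w$; put $P_\gamma(z,u,v):=[p(w),h_\gamma(z,w,u,v)]_0=\big(p(\partial_w)h_\gamma(z,w,u,v)\big)|_{w=0}$. (i) For $I_{2k}$, $k\ge1$, with multiplicity $(\alpha,\beta)$, $\alpha,\beta>0$: $$V_\kappa(p)(z)=\int_{-1}^1\int_{-1}^1\Big[(1+u)(1+v)-\frac{2}{\alpha+\beta}\big(\alpha u(1+v)+\beta v(1+u)\big)\Big]P_{\alpha+\beta}(z,u,v)\,d\nu^\alpha(u)\,d\nu^\beta(v).$$ (ii) For $I_k$, $k\ge3$ odd, with multiplicity $\alpha>0$: $$V_\kappa(p)(z)=\int_{-1}^1P_\alpha(z,u,1)(1-u)\,d\nu^\alpha(u).$$ Here $h_\gamma(z,w,u,v)=\Phi_2^{(k+1)}(\gamma,\dots,\gamma,1;k\gamma+1;a_0,\dots,a_{k-1},a_k)$ with $a_j=|zw|\cos\big(\frac{q_{u,v}(k\phi_1,k\phi_2)+2\pi j}{k}\big)$ ($0\le j\le k-1$), $a_k=\mathrm{Re}(z\bar w)$, $k$ being the parameter of the respective group.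
   Context: Identify $\mathbb{R}^2$ with $\mathbb{C}$, $\langle z,w\rangle=\mathrm{Re}(z\bar w)$, $z=|z|e^{i\phi_1}$, $w=|w|e^{i\phi_2}$. The dihedral group $I_{2k}$ (order $4k$) contains the reflections $z\mapsto\bar ze^{ij\pi/k}$, $j=0,\dots,2k-1$, forming two conjugacy classes ($j$ even, containing $z\mapsto\bar z$; $j$ odd); $\kappa=(\alpha,\beta)$ is $\alpha$ on the class with $j$ even and $\beta$ on the class with $j$ odd. For odd $k$, $I_k$ (order $2k$) has reflections $z\mapsto\bar ze^{2ij\pi/k}$, all conjugate, multiplicity $\alpha$. $V_\kappa$ is the Dunkl intertwining operator (unique degree-preserving linear isomorphism of polynomials with $V_\kappa1=1$, $T_jV_\kappa=V_\kappa\partial_j$ for the Dunkl operators). $p(\partial_w)$ replaces the coordinates of $w$ by partial derivatives. $d\nu^\alpha(u)=\frac{\Gamma(\alpha+1/2)}{\sqrt\pi\Gamma(\alpha)}(1-u^2)^{\alpha-1}du$ on $[-1,1]$. $\xi_{u,v}(\theta_1,\theta_2)=v\cos\theta_1\cos\theta_2+u\sin\theta_1\sin\theta_2$, $q_{u,v}=\arccos\xi_{u,v}\in[0,\pi]$. Humbert function $\Phi_2^{(m)}(\beta_1,\dots,\beta_m;\gamma;x_1,\dots,x_m)=\sum_{j_i\ge0}\frac{(\beta_1)_{j_1}\cdots(\beta_m)_{j_m}}{(\gamma)_{j_1+\cdots+j_m}}\prod_i\frac{x_i^{j_i}}{j_i!}$. *)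

theory Defs
  imports "HOL-Analysis.Analysis"
begin

text \<open>Points of R^2 are complex numbers; (real-valued) functions on R^2 are
  functions complex => real. First coordinate = Re, second coordinate = Im.\<close>

definition poly2 :: "(complex \<Rightarrow> real) \<Rightarrow> bool" where
  "poly2 p \<longleftrightarrow> (\<exists>(c::nat \<Rightarrow> nat \<Rightarrow> real) N.
      \<forall>z. p z = (\<Sum>i\<le>N. \<Sum>j\<le>N. c i j * Re z ^ i * Im z ^ j))"

definition hom_poly2 :: "nat \<Rightarrow> (complex \<Rightarrow> real) \<Rightarrow> bool" where
  "hom_poly2 m p \<longleftrightarrow> (\<exists>c::nat \<Rightarrow> real.
      \<forall>z. p z = (\<Sum>i\<le>m. c i * Re z ^ i * Im z ^ (m - i)))"

definition pd :: "complex \<Rightarrow> (complex \<Rightarrow> real) \<Rightarrow> complex \<Rightarrow> real" where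
  "pd xi f w = deriv (\<lambda>t::real. f (w + of_real t * xi)) 0"

text \<open>Dihedral group with n reflections z |-> conj z * exp(i 2 pi j / n), j < n,
  with root i*exp(i pi j / n) orthogonal to the mirror.  For I_{2k}: n = 2k
  (reflections conj z * exp(i j pi / k)); for I_k, k odd: n = k.\<close>
definition refl :: "nat \<Rightarrow> nat \<Rightarrow> complex \<Rightarrow> complex" where
  "refl n j z = cnj z * exp (\<i> * of_real (2 * pi * real j / real n))"

definition root :: "nat \<Rightarrow> nat \<Rightarrow> complex" where
  "root n j = \<i> * exp (\<i> * of_real (pi * real j / real n))"

definition inner2 :: "complex \<Rightarrow> complex \<Rightarrow> real" where
  "inner2 z w = Re (z * cnj w)"

definition dunkl :: "nat \<Rightarrow> (nat \<Rightarrow> real) \<Rightarrow> complex \<Rightarrow> (complex \<Rightarrow> real) \<Rightarrow> complex \<Rightarrow> real" where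
  "dunkl n kappa xi f z = pd xi f z +
     (\<Sum>j<n. kappa j * inner2 (root n j) xi * (f z - f (refl n j z)) / inner2 (root n j) z)"

text \<open>V is the Dunkl intertwining operator: degree-preserving linear isomorphism
  of the polynomial space, V 1 = 1, T_xi V = V d_xi (the identity of polynomials
  is required on the regular set, where the difference quotients are defined;
  both sides being polynomials this is equivalent to equality everywhere).\<close>
definition is_intertwiner :: "nat \<Rightarrow> (nat \<Rightarrow> real) \<Rightarrow>
    ((complex \<Rightarrow> real) \<Rightarrow> (complex \<Rightarrow> real)) \<Rightarrow> bool" where
  "is_intertwiner n kappa V \<longleftrightarrow>
     bij_betw V {p. poly2 p} {p. poly2 p} \<and>
     (\<forall>p q a b. poly2 p \<longrightarrow> poly2 q \<longrightarrow>
        V (\<lambda>z. a * p z + b * q z) = (\<lambda>z. a * V p z + b * V q z)) \<and>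
     (\<forall>m p. hom_poly2 m p \<longrightarrow> hom_poly2 m (V p)) \<and>
     V (\<lambda>_. 1) = (\<lambda>_. 1) \<and>
     (\<forall>p xi z. poly2 p \<longrightarrow> xi \<in> {1, \<i>} \<longrightarrow> (\<forall>j<n. inner2 (root n j) z \<noteq> 0) \<longrightarrow>
        dunkl n kappa xi (V p) z = V (pd xi p) z)"

definition humbert2 :: "nat \<Rightarrow> (nat \<Rightarrow> real) \<Rightarrow> real \<Rightarrow> (nat \<Rightarrow> real) \<Rightarrow> real" where
  "humbert2 m beta gam x = infsum (\<lambda>J::nat \<Rightarrow> nat.
      (\<Prod>i<m. pochhammer (beta i) (J i) * x i ^ J i / fact (J i))
        / pochhammer gam (\<Sum>i<m. J i)) {J. \<forall>i\<ge>m. J i = 0}"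

definition xi_uv :: "real \<Rightarrow> real \<Rightarrow> real \<Rightarrow> real \<Rightarrow> real" where
  "xi_uv u v t1 t2 = v * cos t1 * cos t2 + u * sin t1 * sin t2"

definition q_uv :: "real \<Rightarrow> real \<Rightarrow> real \<Rightarrow> real \<Rightarrow> real" where
  "q_uv u v t1 t2 = arccos (xi_uv u v t1 t2)"

definition hfun :: "nat \<Rightarrow> real \<Rightarrow> complex \<Rightarrow> complex \<Rightarrow> real \<Rightarrow> real \<Rightarrow> real" where
  "hfun k gam z w u v = humbert2 (k + 1) (\<lambda>i. if i < k then gam else 1) (real k * gam + 1)
     (\<lambda>i. if i < k then cmod (z * w) *
             cos ((q_uv u v (real k * Arg z) (real k * Arg w) + 2 * pi * real i) / real k)
          else Re (z * cnj w))"

text \<open>P_gamma(z,u,v) = (p(d_w) h_gamma(z,w,u,v))|_{w=0} for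
  p(w) = sum c i j * w_1^i * w_2^j.\<close>
definition Pfun :: "(nat \<Rightarrow> nat \<Rightarrow> real) \<Rightarrow> nat \<Rightarrow> nat \<Rightarrow> real \<Rightarrow> complex \<Rightarrow> real \<Rightarrow> real \<Rightarrow> real" where
  "Pfun c N k gam z u v = (\<Sum>i\<le>N. \<Sum>j\<le>N. c i j *
      ((pd 1 ^^ i) ((pd \<i> ^^ j) (\<lambda>w. hfun k gam z w u v))) 0)"

definition nu_dens :: "real \<Rightarrow> real \<Rightarrow> real" where
  "nu_dens a u = Gamma (a + 1/2) / (sqrt pi * Gamma a) * (1 - u^2) powr (a - 1)"

end

theory Submission
  imports Defs
begin

unbundle no vec_syntax
unbundle fps_syntax

text \<open>
  Let \<open>g\<close> denote the parameter gamma and \<open>K\<^sub>m(z, w)\<close> the weighted integral over \<open>u, v\<close> of the degree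
  \<open>m\<close> part of \<open>h\<^sub>g(z, \<cdot>, u, v)\<close>. Euler's identity for \<open>z\<^sub>1 T\<^sub>1 + z\<^sub>2 T\<^sub>2\<close> turns \<open>T\<^sub>j V = V \<partial>\<^sub>j\<close> into a recursion for
  \<open>V(\<langle>\<cdot>, w\<rangle>\<^sup>m / m!)\<close> that involves only reflections,

    \<open>(m + \<Sum>\<kappa>\<^sub>l) E\<^sub>m(z, w) - \<Sum> \<kappa>\<^sub>l E\<^sub>m(\<sigma>\<^sub>l z, w) = \<langle>z, w\<rangle> E\<^sub>m\<^sub>-\<^sub>1(z, w)\<close>,

  and a maximum principle on circles shows that it has at most one continuous solution. So it
  suffices that \<open>K\<^sub>m\<close> satisfies the same recursion.

  The degree \<open>m\<close> part of \<open>h\<^sub>g\<close> is the \<open>m\<close>-th coefficient of \<open>S\<^sup>-\<^sup>g / (1 - \<langle>z, w\<rangle> X)\<close> divided by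
  \<open>(k g + 1)\<^sub>m\<close>, where \<open>S\<close> is the product of the \<open>1 - a\<^sub>j X\<close>. By the product formula for Chebyshev
  polynomials \<open>S = A - (v x + u y) t\<close> with \<open>t = 2\<^sup>1\<^sup>-\<^sup>k X\<^sup>k\<close>, \<open>x = Re z\<^sup>k Re w\<^sup>k\<close>, \<open>y = Im z\<^sup>k Im w\<^sup>k\<close> and \<open>A\<close> depending
  on \<open>\<bar>z w\<bar>\<close> only. A reflection replaces \<open>u\<close> by \<open>-u\<close> or \<open>v\<close> by \<open>-v\<close>, and the products of the
  \<open>1 - \<langle>\<sigma>\<^sub>l z, w\<rangle> X\<close> over the two classes are \<open>A - (x - y) t\<close> and \<open>A + (x - y) t\<close>. Since \<open>k S - X S'\<close> does not
  depend on \<open>u, v\<close>, the recursion reduces to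

    \<open>g \<integral> W S\<^sup>-\<^sup>g\<^sup>-\<^sup>1 = \<alpha> / (A - (x - y) t) \<integral> W(-u, v) S\<^sup>-\<^sup>g + \<beta> / (A + (x - y) t) \<integral> W(u, -v) S\<^sup>-\<^sup>g\<close>,

  which is partial integration in \<open>u\<close> and \<open>v\<close>.
\<close>

section \<open>Negative powers of formal power series\<close>

text \<open>The binomial series of \<open>1 - X\<close> to the power \<open>-g\<close>.\<close>

definition pochhammer_fps :: "real \<Rightarrow> real fps" where
  "pochhammer_fps g = Abs_fps (\<lambda>n. pochhammer g n / fact n)"

text \<open>The formal power series \<open>(1 - d)\<close> to the power \<open>-g\<close>, meaningful only if \<open>d\<close> has no constant term.\<close>
definition fps_npow :: "real \<Rightarrow> real fps \<Rightarrow> real fps" where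
  "fps_npow g d = pochhammer_fps g oo d"

definition geom_fps :: "real \<Rightarrow> real fps" where
  "geom_fps c = Abs_fps (\<lambda>n. c ^ n)"

lemma pochhammer_fps_nth [simp]: "pochhammer_fps g $ n = pochhammer g n / fact n"
  by (simp add: pochhammer_fps_def)

lemma geom_fps_nth [simp]: "geom_fps c $ n = c ^ n"
  by (simp add: geom_fps_def)

lemma geom_fps_inverse: "(1 - fps_const c * fps_X) * geom_fps c = 1"
proof (rule fps_ext)
  fix n
  show "((1 - fps_const c * fps_X) * geom_fps c) $ n = 1 $ n"
    by (cases n) (simp_all add: algebra_simps mult.assoc)
qed

lemma pochhammer_fps_Suc_param: "pochhammer_fps g = (1 - fps_X) * pochhammer_fps (g + 1)"
proof (rule fps_ext)
  fix n
  show "pochhammer_fps g $ n = ((1 - fps_X) * pochhammer_fps (g + 1)) $ n"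
  proof (cases n)
    case (Suc m)
    have "pochhammer (g + 1) (Suc m) / fact (Suc m) - pochhammer (g + 1) m / fact m
        = pochhammer (g + 1) m * ((g + 1 + m) - (1 + m)) / fact (Suc m)"
      by (simp add: pochhammer_Suc field_simps del: of_nat_Suc)
    also have "\<dots> = pochhammer g (Suc m) / fact (Suc m)"
      by (simp add: pochhammer_rec)
    finally show ?thesis using Suc by (simp add: algebra_simps)
  qed simp
qed

text \<open>The Chu-Vandermonde convolution, divided by \<open>n!\<close>.\<close>

lemma pochhammer_fps_add: "pochhammer_fps (g + h) = pochhammer_fps g * pochhammer_fps h"
proof (rule fps_ext)
  fix n
  have "pochhammer (g + h) n / fact n = (\<Sum>i\<le>n. pochhammer g i / fact i * (pochhammer h (n - i) / fact (n - i)))"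
    unfolding pochhammer_binomial_sum sum_divide_distrib
    by (intro sum.cong refl) (simp add: binomial_fact field_simps)
  then show "pochhammer_fps (g + h) $ n = (pochhammer_fps g * pochhammer_fps h) $ n"
    by (simp add: fps_mult_nth atMost_atLeast0)
qed

lemma fps_deriv_pochhammer_fps: "fps_deriv (pochhammer_fps g) = fps_const g * pochhammer_fps (g + 1)"
  by (rule fps_ext) (simp add: pochhammer_rec)

lemma fps_npow_nth_0 [simp]: "fps_npow g d $ 0 = 1"
  by (simp add: fps_npow_def)

lemma fps_npow_nth: "fps_npow g d $ m = (\<Sum>n\<le>m. pochhammer g n / fact n * (d ^ n) $ m)"
  by (simp add: fps_npow_def fps_compose_nth atMost_atLeast0)

context
  fixes d :: "real fps"
  assumes d0: "d $ 0 = 0"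
begin

lemma fps_npow_Suc_param: "fps_npow g d = (1 - d) * fps_npow (g + 1) d"
proof -
  have "fps_npow g d = ((1 - fps_X) oo d) * fps_npow (g + 1) d"
    unfolding fps_npow_def by (subst pochhammer_fps_Suc_param) (simp add: fps_compose_mult_distrib d0)
  also have "(1 - fps_X) oo d = 1 - d"
    by (simp add: fps_compose_sub_distrib d0)
  finally show ?thesis .
qed

lemma fps_npow_add: "fps_npow (g + h) d = fps_npow g d * fps_npow h d"
  unfolding fps_npow_def by (simp add: pochhammer_fps_add fps_compose_mult_distrib d0)

lemma fps_deriv_npow: "fps_deriv (fps_npow g d) = fps_const g * fps_npow (g + 1) d * fps_deriv d"
  unfolding fps_npow_def
  by (simp add: fps_compose_deriv d0 fps_deriv_pochhammer_fps fps_compose_mult_distrib)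

lemma fps_npow_0_param: "fps_npow 0 d = 1"
proof -
  have "pochhammer_fps 0 = 1"
    by (rule fps_ext) (simp add: pochhammer_0_left)
  then show ?thesis by (simp add: fps_npow_def)
qed

lemma fps_npow_ODE: "(1 - d) * fps_deriv (fps_npow g d) = fps_const g * fps_deriv d * fps_npow g d"
  by (subst (2) fps_npow_Suc_param) (simp add: fps_deriv_npow algebra_simps)

text \<open>The product of \<open>H\<close> with the solution for \<open>-g\<close> has derivative
  zero, hence equals its constant term 1; multiplying by the solution for \<open>g\<close> recovers
  \<open>H\<close>.\<close>

lemma fps_npow_unique:
  assumes ode: "(1 - d) * fps_deriv H = fps_const g * fps_deriv d * H" and H0: "H $ 0 = 1"
  shows "H = fps_npow g d"
proof -
  let ?N = "fps_npow (-g) d"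
  have "(1 - d) * fps_deriv (H * ?N) = ((1 - d) * fps_deriv H) * ?N + H * ((1 - d) * fps_deriv ?N)"
    by (simp add: algebra_simps)
  also have "\<dots> = 0"
    unfolding ode fps_npow_ODE by (simp add: algebra_simps flip: fps_const_neg)
  \<comment> \<open>The factor \<open>1 - d\<close> has constant term 1, so it is nonzero and can be
    cancelled.\<close>
  finally have "fps_deriv (H * ?N) = 0"
    using d0 by (metis diff_zero fps_one_nth fps_sub_nth fps_zero_nth mult_eq_0_iff zero_neq_one)
  then have "H * ?N = fps_const ((H * ?N) $ 0)"
    using fps_deriv_eq_0_iff by blast
  then have HN: "H * ?N = 1" using H0 by simp
  have NN: "fps_npow g d * ?N = 1"
    using fps_npow_add[of g "-g"] fps_npow_0_param by simp
  have "H = H * (fps_npow g d * ?N)" by (simp add: NN)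
  also have "\<dots> = fps_npow g d" using HN by (simp add: algebra_simps)
  finally show ?thesis .
qed

end

text \<open>By the product rule the left side solves the differential equation belonging to
  \<open>(1 - d) * (1 - e)\<close>, so \<open>fps_npow_unique\<close> identifies it.\<close>

lemma fps_npow_mult:
  assumes "d $ 0 = 0" "e $ 0 = 0"
  shows "fps_npow g d * fps_npow g e = fps_npow g (1 - (1 - d) * (1 - e))"
proof (rule fps_npow_unique)
  have "(1 - (1 - (1 - d) * (1 - e))) * fps_deriv (fps_npow g d * fps_npow g e)
     = (1 - e) * fps_npow g e * ((1 - d) * fps_deriv (fps_npow g d))
       + (1 - d) * fps_npow g d * ((1 - e) * fps_deriv (fps_npow g e))"
    by (simp add: algebra_simps)
  also have "\<dots> = fps_const g * fps_deriv (1 - (1 - d) * (1 - e)) * (fps_npow g d * fps_npow g e)"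
    unfolding fps_npow_ODE[OF assms(1)] fps_npow_ODE[OF assms(2)] by (simp add: algebra_simps)
  finally show "(1 - (1 - (1 - d) * (1 - e))) * fps_deriv (fps_npow g d * fps_npow g e)
    = fps_const g * fps_deriv (1 - (1 - d) * (1 - e)) * (fps_npow g d * fps_npow g e)" .
qed (use assms in simp_all)

lemma fps_npow_linear: "fps_npow g (fps_const c * fps_X) = Abs_fps (\<lambda>n. pochhammer g n * c ^ n / fact n)"
  unfolding fps_npow_def fps_compose_linear by (simp add: mult.commute)

lemma fps_npow_prod:
  assumes "finite J"
  shows "(\<Prod>j\<in>J. fps_npow g (fps_const (c j) * fps_X)) = fps_npow g (1 - (\<Prod>j\<in>J. 1 - fps_const (c j) * fps_X))
    \<and> (\<Prod>j\<in>J. 1 - fps_const (c j) * fps_X) $ 0 = 1"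
  using assms
proof (induction J rule: finite_induct)
  case empty
  have "fps_npow g 0 = 1" by (simp add: fps_npow_def)
  then show ?case by simp
next
  case (insert j J)
  then show ?case by (simp add: fps_npow_mult)
qed

text \<open>A logarithmic derivative: a factor \<open>l = 1 - c X\<close> satisfies
  \<open>1 / l = 1 - X l' / l\<close>. Summing over the factors and multiplying by their product
  avoids quotients.\<close>

lemma sum_geom_fps_times_prod:
  assumes "finite J"
  shows "(\<Sum>j\<in>J. geom_fps (c j)) * (\<Prod>j\<in>J. 1 - fps_const (c j) * fps_X)
    = fps_const (real (card J)) * (\<Prod>j\<in>J. 1 - fps_const (c j) * fps_X)
      - fps_X * fps_deriv (\<Prod>j\<in>J. 1 - fps_const (c j) * fps_X)"
  using assms
proof (induction J rule: finite_induct)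
  case (insert j J)
  let ?P = "\<Prod>j\<in>J. 1 - fps_const (c j) * fps_X" and ?l = "1 - fps_const (c j) * fps_X"
  have "(geom_fps (c j) + (\<Sum>j\<in>J. geom_fps (c j))) * (?l * ?P)
      = (?l * geom_fps (c j)) * ?P + ?l * ((\<Sum>j\<in>J. geom_fps (c j)) * ?P)"
    by (simp add: algebra_simps)
  also have "\<dots> = ?P + ?l * (fps_const (real (card J)) * ?P - fps_X * fps_deriv ?P)"
    by (simp add: geom_fps_inverse insert.IH)
  also have "\<dots> = fps_const (real (card J) + 1) * (?l * ?P) - fps_X * fps_deriv (?l * ?P)"
    by (simp add: algebra_simps flip: fps_const_add)
  finally show ?case using insert.hyps by (simp add: add.commute)
qed simp

section \<open>The product of the factors as a Chebyshev polynomial\<close>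

text \<open>Both sides are polynomials in \<open>x\<close> of degree at most \<open>k\<close>. They
  agree at 0 and at the inverses of the \<open>k\<close> distinct \<open>k\<close>-th roots of
  \<open>cis q\<close>, which makes \<open>k + 1\<close> points.\<close>

lemma prod_one_minus_cis:
  assumes "k \<ge> 1"
  shows "(\<Prod>j<k. 1 - x * cis ((q + 2 * pi * real j) / real k)) = 1 - x ^ k * cis q"
proof -
  define c where "c j = cis ((q + 2 * pi * real j) / real k)" for j
  have c_eq: "c j = cis (q / real k) * cis (2 * pi * real j / real k)" for j
    by (simp add: c_def cis_mult add_divide_distrib)
  have c_pow: "c j ^ k = cis q" for j
  proof -
    have "c j ^ k = cis (q + 2 * pi * real j)"
      unfolding c_def Complex.DeMoivre using assms by (intro arg_cong[where f = cis]) simp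
    also have "\<dots> = cis q" using cis_multiple_2pi[of "real j"] by (simp flip: cis_mult)
    finally show ?thesis .
  qed
  have c_nz: "c j \<noteq> 0" for j by (simp add: c_def)
  have inj: "inj_on c {..<k}"
  proof -
    have "inj_on (\<lambda>j. cis (2 * pi * real j / real k)) {..<k}"
      using Complex.bij_betw_roots_unity[of k] assms by (auto simp: bij_betw_def)
    then show ?thesis by (auto simp: inj_on_def c_eq)
  qed
  define P where "P = (\<Prod>j<k. [:1, - c j:])"
  define Q where "Q = [:1:] - monom (cis q) k"
  have "P = Q"
  proof (rule poly_eqI_degree)
    let ?A = "insert 0 ((\<lambda>j. inverse (c j)) ` {..<k})"
    fix x assume "x \<in> ?A"
    then show "poly P x = poly Q x"
    proof (rule insertE)
      assume "x = 0"
      then show ?thesis using assms by (simp add: P_def Q_def poly_prod poly_monom)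
    next
      assume "x \<in> (\<lambda>j. inverse (c j)) ` {..<k}"
      then obtain j where j: "j < k" "x = inverse (c j)" by auto
      have "poly P x = 0"
        unfolding P_def poly_prod using j c_nz[of j] by (auto intro!: prod_zero bexI[of _ j])
      moreover have "poly Q x = 0"
        unfolding Q_def using j c_pow[of j] by (simp add: poly_monom power_inverse cis_mult)
      ultimately show ?thesis by simp
    qed
  next
    have "inj_on (\<lambda>j. inverse (c j)) {..<k}"
      using inj by (auto simp: inj_on_def)
    then have card: "card (insert 0 ((\<lambda>j. inverse (c j)) ` {..<k})) = Suc k"
      using c_nz by (subst card_insert_disjoint) (auto simp: card_image)
    have "degree P \<le> (\<Sum>j<k. degree [:1, - c j:])"
      unfolding P_def using degree_prod_sum_le[of "{..<k}" "\<lambda>j. [:1, - c j:]"] by simp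
    also have "\<dots> \<le> (\<Sum>j<k. 1)" by (intro sum_mono) simp
    finally show "card (insert 0 ((\<lambda>j. inverse (c j)) ` {..<k})) > degree P" using card by simp
    have "degree Q \<le> k"
      unfolding Q_def by (intro degree_diff_le) (simp_all add: degree_monom_le)
    then show "card (insert 0 ((\<lambda>j. inverse (c j)) ` {..<k})) > degree Q" using card by simp
  qed
  then have "poly P x = poly Q x" by simp
  then show ?thesis by (simp add: P_def Q_def poly_prod poly_monom c_def mult.commute)
qed

text \<open>For real \<open>x\<close> the squared modulus of \<open>1 - x cis t\<close> is
  \<open>1 + x^2 - 2 x cos t\<close>, so this is the squared modulus of the preceding
  product.\<close>

lemma prod_one_minus_cos_square:
  assumes "k \<ge> 1"
  shows "(\<Prod>j<k. 1 + x\<^sup>2 - 2 * x * cos ((q + 2 * pi * real j) / real k)) = 1 - 2 * x ^ k * cos q + x ^ (2 * k)"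
proof -
  have sq: "(cmod (1 - complex_of_real y * cis t))\<^sup>2 = 1 + y\<^sup>2 - 2 * y * cos t" for y t
  proof -
    have "(cmod (1 - complex_of_real y * cis t))\<^sup>2 = 1 - 2 * y * cos t + y\<^sup>2 * ((cos t)\<^sup>2 + (sin t)\<^sup>2)"
      unfolding cmod_power2 by (simp del: sin_cos_squared_add sin_cos_squared_add2) algebra
    then show ?thesis by simp
  qed
  have "(\<Prod>j<k. 1 + x\<^sup>2 - 2 * x * cos ((q + 2 * pi * real j) / real k))
      = (cmod (\<Prod>j<k. 1 - complex_of_real x * cis ((q + 2 * pi * real j) / real k)))\<^sup>2"
    by (simp add: sq prod_power_distrib flip: prod_norm)
  also have "\<dots> = (cmod (1 - complex_of_real (x ^ k) * cis q))\<^sup>2"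
    by (simp add: prod_one_minus_cis[OF assms])
  also have "\<dots> = 1 + (x ^ k)\<^sup>2 - 2 * x ^ k * cos q" by (rule sq)
  finally show ?thesis by (simp add: power_mult mult.commute)
qed

text \<open>Up to scaling, the reversed polynomial of \<open>T\<^sub>k - cos q\<close> for the Chebyshev polynomial \<open>T\<^sub>k\<close>.\<close>
definition cheb_poly :: "nat \<Rightarrow> real \<Rightarrow> real poly" where
  "cheb_poly k q = (\<Prod>j<k. [:1, - cos ((q + 2 * pi * real j) / real k):])"

lemma real_poly_eqI_unit_interval:
  fixes p q :: "real poly"
  assumes "\<And>y. 0 \<le> y \<Longrightarrow> y \<le> 1 \<Longrightarrow> poly p y = poly q y"
  shows "p = q"
proof (rule ccontr)
  assume "p \<noteq> q"
  then have "finite {y. poly (p - q) y = 0}" by (intro poly_roots_finite) simp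
  moreover have "{0..1::real} \<subseteq> {y. poly (p - q) y = 0}" using assms by auto
  ultimately have "finite {0..1::real}" by (rule rev_finite_subset)
  then show False using infinite_Icc[of 0 "1::real"] by simp
qed

lemma mult_two_divide_square: "0 < (s::real) \<Longrightarrow> y * (2 * s / s\<^sup>2) = 2 * (y / s)"
  by (simp add: field_simps power2_eq_square)

text \<open>The witness \<open>y / (1 + sqrt (1 - y^2))\<close> is the tangent of half the angle
  with sine \<open>y\<close>. It turns \<open>1 - y cos t\<close> into a multiple of
  \<open>1 + x^2 - 2 x cos t\<close>.\<close>

lemma half_angle_parameter:
  fixes y :: real
  assumes "0 \<le> y" "y \<le> 1"
  obtains x where "y * (1 + x\<^sup>2) = 2 * x"
proof
  let ?s = "sqrt (1 - y\<^sup>2)"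
  have "y\<^sup>2 \<le> 1" using assms by (simp add: power_le_one)
  then have s2: "?s\<^sup>2 = 1 - y\<^sup>2" by simp
  have pos: "1 + ?s > 0" using \<open>y\<^sup>2 \<le> 1\<close> by (simp add: add_pos_nonneg)
  have e: "(1 + ?s)\<^sup>2 + y\<^sup>2 = 2 * (1 + ?s)"
    using s2 by (simp add: power2_eq_square algebra_simps)
  have "y * (1 + (y / (1 + ?s))\<^sup>2) = y * (((1 + ?s)\<^sup>2 + y\<^sup>2) / (1 + ?s)\<^sup>2)"
    using pos by (simp add: power_divide add_divide_distrib)
  also have "\<dots> = 2 * (y / (1 + ?s))" unfolding e using pos by (rule mult_two_divide_square)
  finally show "y * (1 + (y / (1 + ?s))\<^sup>2) = 2 * (y / (1 + ?s))" .
qed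

lemma poly_cheb_poly_half_angle:
  assumes "k \<ge> 1" and y: "y * (1 + x\<^sup>2) = 2 * x"
  shows "poly (cheb_poly k q) y * (1 + x\<^sup>2) ^ k = 1 - 2 * x ^ k * cos q + x ^ (2 * k)"
proof -
  have "poly (cheb_poly k q) y * (1 + x\<^sup>2) ^ k
      = (\<Prod>j<k. (1 - y * cos ((q + 2 * pi * real j) / real k)) * (1 + x\<^sup>2))"
    by (simp add: cheb_poly_def poly_prod prod.distrib)
  also have "\<dots> = (\<Prod>j<k. 1 + x\<^sup>2 - 2 * x * cos ((q + 2 * pi * real j) / real k))"
  proof (intro prod.cong refl)
    fix j
    have "(1 - y * c) * (1 + x\<^sup>2) = 1 + x\<^sup>2 - (y * (1 + x\<^sup>2)) * c" for c by (simp add: algebra_simps)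
    then show "(1 - y * cos ((q + 2 * pi * real j) / real k)) * (1 + x\<^sup>2)
      = 1 + x\<^sup>2 - 2 * x * cos ((q + 2 * pi * real j) / real k)" by (simp only: y)
  qed
  finally show ?thesis using prod_one_minus_cos_square[OF assms(1)] by simp
qed

lemma one_plus_square_pos: "0 < 1 + (x::real)\<^sup>2"
  by (simp add: add_pos_nonneg)

text \<open>In the half-angle parameter \<open>q\<close> enters only through
  \<open>2 x^k cos q\<close>, and \<open>x^k\<close> is \<open>y^k (1 + x^2)^k / 2^k\<close>. So
  \<open>q\<close> affects only the coefficient of \<open>y^k\<close>; the reference value
  \<open>pi / 2\<close> is chosen because its cosine vanishes.\<close>

lemma cheb_poly_eq:
  assumes k: "k \<ge> 1"
  shows "cheb_poly k q = cheb_poly k (pi / 2) - monom (2 / 2 ^ k * cos q) k"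
proof (rule real_poly_eqI_unit_interval)
  fix y :: real assume "0 \<le> y" "y \<le> 1"
  then obtain x where x: "y * (1 + x\<^sup>2) = 2 * x" by (rule half_angle_parameter)
  have "y ^ k * (1 + x\<^sup>2) ^ k = 2 ^ k * x ^ k" by (metis power_mult_distrib x)
  then have "poly (cheb_poly k q) y * (1 + x\<^sup>2) ^ k
      = poly (cheb_poly k (pi / 2) - monom (2 / 2 ^ k * cos q) k) y * (1 + x\<^sup>2) ^ k"
    by (simp add: poly_monom left_diff_distrib poly_cheb_poly_half_angle[OF k x] mult.assoc)
  then show "poly (cheb_poly k q) y = poly (cheb_poly k (pi / 2) - monom (2 / 2 ^ k * cos q) k) y"
    using one_plus_square_pos[of x] by simp
qed

text \<open>At \<open>q = pi / 2\<close> only \<open>x^(2 k)\<close> remains in the half-angle form,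
  so the polynomial is even. Hence only even powers of \<open>cmod (z * w)\<close> occur in the
  product, and these are polynomials in the coordinates of \<open>w\<close>.\<close>

lemma coeff_cheb_poly_odd:
  assumes k: "k \<ge> 1" and "odd l"
  shows "poly.coeff (cheb_poly k (pi / 2)) l = 0"
proof -
  let ?p = "cheb_poly k (pi / 2)"
  have "?p \<circ>\<^sub>p [:0, -1:] = ?p"
  proof (rule real_poly_eqI_unit_interval)
    fix y :: real assume "0 \<le> y" "y \<le> 1"
    then obtain x where x: "y * (1 + x\<^sup>2) = 2 * x" by (rule half_angle_parameter)
    then have x': "(- y) * (1 + (- x)\<^sup>2) = 2 * (- x)" by simp
    have "poly ?p y * (1 + x\<^sup>2) ^ k = poly ?p (- y) * (1 + x\<^sup>2) ^ k"
      using poly_cheb_poly_half_angle[OF k x, of "pi/2"] poly_cheb_poly_half_angle[OF k x', of "pi/2"]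
      by simp
    then show "poly (?p \<circ>\<^sub>p [:0, -1:]) y = poly ?p y"
      using one_plus_square_pos[of x] by (simp add: poly_pcompose)
  qed
  then have "poly.coeff (?p \<circ>\<^sub>p [:0, -1:]) l = poly.coeff ?p l" by simp
  then show ?thesis using \<open>odd l\<close> by (simp add: coeff_pcompose_linear)
qed

text \<open>With \<open>r = cmod (z * w)\<close> this is the \<open>A\<close> of the overview: the
  product of the \<open>1 - a_j X\<close> in the case \<open>cos q = 0\<close>.\<close>

definition cheb_fps :: "nat \<Rightarrow> real \<Rightarrow> real fps" where
  "cheb_fps k r = Abs_fps (\<lambda>l. poly.coeff (cheb_poly k (pi / 2)) l * r ^ l)"

lemma fps_of_poly_pcompose_linear:
  "fps_of_poly (p \<circ>\<^sub>p [:0, r:]) = Abs_fps (\<lambda>l. poly.coeff p l * (r::real) ^ l)"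
  by (rule fps_ext) (simp add: coeff_pcompose_linear)

lemma prod_linear_fps_eq_cheb:
  assumes k: "k \<ge> 1"
  shows "(\<Prod>j<k. 1 - fps_const (r * cos ((q + 2 * pi * real j) / real k)) * fps_X)
    = cheb_fps k r - fps_const (2 / 2 ^ k * (r ^ k * cos q)) * fps_X ^ k"
proof -
  have lin: "1 - fps_const (r * c) * fps_X = fps_of_poly ([:1, - c:] \<circ>\<^sub>p [:0, r:])" for c
    by (simp add: fps_of_poly_pCons pcompose_pCons algebra_simps flip: fps_const_neg)
  have "(\<Prod>j<k. 1 - fps_const (r * cos ((q + 2 * pi * real j) / real k)) * fps_X)
      = fps_of_poly (cheb_poly k q \<circ>\<^sub>p [:0, r:])"
    by (simp only: lin cheb_poly_def pcompose_prod fps_of_poly_prod)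
  also have "\<dots> = cheb_fps k r - fps_const (2 / 2 ^ k * (r ^ k * cos q)) * fps_X ^ k"
    unfolding fps_of_poly_pcompose_linear
    by (subst cheb_poly_eq[OF k]) (rule fps_ext, simp add: cheb_fps_def fps_X_power_nth algebra_simps)
  finally show ?thesis .
qed

lemma cheb_fps_nth_0 [simp]: "cheb_fps k r $ 0 = 1"
  by (simp add: cheb_fps_def cheb_poly_def poly_prod flip: poly_0_coeff_0)

section \<open>Homogeneous parts and their coefficients\<close>

text \<open>Continuity in the parameter \<open>z\<close> is carried along because the integrals must
  be continuous in \<open>z\<close> for the maximum principle. Generation by monomials lets facts
  about linear functionals be proved by rule induction.\<close>

inductive uv_poly :: "(complex \<Rightarrow> real \<Rightarrow> real \<Rightarrow> real) \<Rightarrow> bool" where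
  mono: "continuous_on UNIV c \<Longrightarrow> uv_poly (\<lambda>z u v. c z * u ^ p * v ^ q)"
| add: "uv_poly e \<Longrightarrow> uv_poly f \<Longrightarrow> uv_poly (\<lambda>z u v. e z u v + f z u v)"

text \<open>\<open>hpoly m B f\<close>: \<open>f z w u v\<close> is homogeneous of degree \<open>m\<close> in \<open>w\<close>, with coefficients
  polynomial in \<open>u, v\<close> and continuous in \<open>z\<close>; for \<open>u, v\<close> in \<open>[-1, 1]\<close> the sum of the absolute
  values of these coefficients is at most \<open>B z\<close>.\<close>
inductive hpoly :: "nat \<Rightarrow> (complex \<Rightarrow> real) \<Rightarrow> (complex \<Rightarrow> complex \<Rightarrow> real \<Rightarrow> real \<Rightarrow> real) \<Rightarrow> bool" where
  mono: "continuous_on UNIV c \<Longrightarrow> i + j = m \<Longrightarrow>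
    hpoly m (\<lambda>z. \<bar>c z\<bar>) (\<lambda>z w u v. c z * u ^ p * v ^ q * (Re w ^ i * Im w ^ j))"
| add: "hpoly m B f \<Longrightarrow> hpoly m C g \<Longrightarrow> hpoly m (\<lambda>z. B z + C z) (\<lambda>z w u v. f z w u v + g z w u v)"

lemma uv_poly_continuous: "continuous_on UNIV c \<Longrightarrow> uv_poly (\<lambda>z u v. c z)"
  using uv_poly.mono[of c 0 0] by simp

lemma uv_poly_mult:
  assumes "uv_poly e" "uv_poly f"
  shows "uv_poly (\<lambda>z u v. e z u v * f z u v)"
  using assms(1)
proof induction
  case (mono c p q)
  show ?case using assms(2)
  proof induction
    case (mono d p' q')
    have "uv_poly (\<lambda>z u v. (c z * d z) * u ^ (p + p') * v ^ (q + q'))"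
      using \<open>continuous_on UNIV c\<close> mono by (intro uv_poly.mono continuous_intros)
    then show ?case by (simp add: power_add mult_ac)
  next
    case (add e' f')
    from uv_poly.add[OF add.IH] show ?case by (simp add: algebra_simps)
  qed
next
  case (add e' f')
  from uv_poly.add[OF add.IH] show ?case by (simp add: algebra_simps)
qed

lemma uv_poly_sum: "finite S \<Longrightarrow> (\<And>s. s \<in> S \<Longrightarrow> uv_poly (e s)) \<Longrightarrow> uv_poly (\<lambda>z u v. \<Sum>s\<in>S. e s z u v)"
proof (induction S rule: finite_induct)
  case empty
  show ?case using uv_poly_continuous[of "\<lambda>_. 0"] by simp
next
  case (insert x F)
  then show ?case by (simp add: uv_poly.add)
qed

lemma uv_poly_freeze: "uv_poly e \<Longrightarrow> uv_poly (\<lambda>_. e z)"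
  by (induction rule: uv_poly.induct) (auto intro!: uv_poly.add uv_poly.mono)

lemma hpoly_zero: "hpoly m (\<lambda>z. 0) (\<lambda>z w u v. 0)"
  using hpoly.mono[of "\<lambda>_. 0" 0 m m] by simp

lemma hpoly_nonneg: "hpoly m B f \<Longrightarrow> 0 \<le> B z"
  by (induction rule: hpoly.induct) auto

lemma hpoly_mult:
  assumes "hpoly m B f" "hpoly n C g"
  shows "hpoly (m + n) (\<lambda>z. B z * C z) (\<lambda>z w u v. f z w u v * g z w u v)"
  using assms(1)
proof induction
  case (mono c i j m p q)
  show ?case using assms(2)
  proof induction
    case (mono d i' j' n p' q')
    have "hpoly (m + n) (\<lambda>z. \<bar>c z * d z\<bar>)
      (\<lambda>z w u v. (c z * d z) * u ^ (p + p') * v ^ (q + q') * (Re w ^ (i + i') * Im w ^ (j + j')))"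
      using \<open>continuous_on UNIV c\<close> \<open>i + j = m\<close> mono by (intro hpoly.mono continuous_intros) auto
    then show ?case by (simp add: power_add mult_ac abs_mult)
  next
    case (add n' B' f' C' g')
    from hpoly.add[OF add.IH] show ?case by (simp add: algebra_simps)
  qed
next
  case (add m' B' f' C' g')
  from hpoly.add[OF add.IH] show ?case by (simp add: algebra_simps)
qed

lemma hpoly_const: "hpoly 0 (\<lambda>z. \<bar>a\<bar>) (\<lambda>z w u v. a)"
  using hpoly.mono[of "\<lambda>_. a" 0 0 0 0 0] by simp

lemma hpoly_scale: "hpoly m B f \<Longrightarrow> hpoly m (\<lambda>z. \<bar>a\<bar> * B z) (\<lambda>z w u v. a * f z w u v)"
  using hpoly_mult[OF hpoly_const[of a]] by simp

lemma hpoly_sum: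
  "finite S \<Longrightarrow> (\<And>s. s \<in> S \<Longrightarrow> hpoly m (B s) (f s)) \<Longrightarrow>
    hpoly m (\<lambda>z. \<Sum>s\<in>S. B s z) (\<lambda>z w u v. \<Sum>s\<in>S. f s z w u v)"
proof (induction S rule: finite_induct)
  case empty
  show ?case by (simp add: hpoly_zero)
next
  case (insert x F)
  then show ?case by (simp add: hpoly.add)
qed

lemma hpoly_power: "hpoly m B f \<Longrightarrow> hpoly (m * n) (\<lambda>z. B z ^ n) (\<lambda>z w u v. f z w u v ^ n)"
proof (induction n)
  case 0
  show ?case using hpoly_const[of 1] by simp
next
  case (Suc n)
  then show ?case using hpoly_mult[of m B f "m * n"] by simp
qed

text \<open>Monomials with equal exponents in \<open>w\<close> are collected; the triangle
  inequality preserves the bound \<open>B\<close>.\<close>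

lemma hpoly_coeffs:
  assumes "hpoly m B f"
  shows "\<exists>e. (\<forall>i. uv_poly (e i)) \<and> (\<forall>z w u v. f z w u v = (\<Sum>i\<le>m. e i z u v * (Re w ^ i * Im w ^ (m - i))))
    \<and> (\<forall>z u v. \<bar>u\<bar> \<le> 1 \<longrightarrow> \<bar>v\<bar> \<le> 1 \<longrightarrow> (\<Sum>i\<le>m. \<bar>e i z u v\<bar>) \<le> B z)"
  using assms
proof induction
  case (mono c i j m p q)
  let ?e = "\<lambda>i' z u v. if i' = i then c z * u ^ p * v ^ q else 0"
  have im: "i \<le> m" "m - i = j" using mono by auto
  have 1: "uv_poly (?e i')" for i'
    using uv_poly.mono[OF mono(1)] uv_poly_continuous[of "\<lambda>_. 0"] by (cases "i' = i") auto
  have 2: "c z * u ^ p * v ^ q * (Re w ^ i * Im w ^ j) = (\<Sum>i'\<le>m. ?e i' z u v * (Re w ^ i' * Im w ^ (m - i')))"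
    for z w u v
    using im by (simp add: if_distrib[of "\<lambda>x. x * _"] cong: if_cong)
  have 3: "(\<Sum>i'\<le>m. \<bar>?e i' z u v\<bar>) \<le> \<bar>c z\<bar>" if "\<bar>u\<bar> \<le> 1" "\<bar>v\<bar> \<le> 1" for z u v
  proof -
    have "(\<Sum>i'\<le>m. \<bar>?e i' z u v\<bar>) = \<bar>c z\<bar> * (\<bar>u\<bar> ^ p * \<bar>v\<bar> ^ q)"
      using im by (simp add: if_distrib[of abs] abs_mult power_abs cong: if_cong)
    also have "\<dots> \<le> \<bar>c z\<bar> * 1"
      using that by (intro mult_left_mono mult_le_one power_le_one) auto
    finally show ?thesis by simp
  qed
  show ?case using 1 2 3 by (intro exI[of _ ?e]) blast
next
  case (add m B f C g)
  from add.IH(1) obtain e where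
    e: "\<forall>i. uv_poly (e i)" "\<forall>z w u v. f z w u v = (\<Sum>i\<le>m. e i z u v * (Re w ^ i * Im w ^ (m - i)))"
       "\<forall>z u v. \<bar>u\<bar> \<le> 1 \<longrightarrow> \<bar>v\<bar> \<le> 1 \<longrightarrow> (\<Sum>i\<le>m. \<bar>e i z u v\<bar>) \<le> B z"
    by (elim exE conjE)
  from add.IH(2) obtain e' where
    e': "\<forall>i. uv_poly (e' i)" "\<forall>z w u v. g z w u v = (\<Sum>i\<le>m. e' i z u v * (Re w ^ i * Im w ^ (m - i)))"
       "\<forall>z u v. \<bar>u\<bar> \<le> 1 \<longrightarrow> \<bar>v\<bar> \<le> 1 \<longrightarrow> (\<Sum>i\<le>m. \<bar>e' i z u v\<bar>) \<le> C z"
    by (elim exE conjE)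
  have "(\<Sum>i\<le>m. \<bar>e i z u v + e' i z u v\<bar>) \<le> B z + C z" if "\<bar>u\<bar> \<le> 1" "\<bar>v\<bar> \<le> 1" for z u v
  proof -
    have "(\<Sum>i\<le>m. \<bar>e i z u v + e' i z u v\<bar>) \<le> (\<Sum>i\<le>m. \<bar>e i z u v\<bar>) + (\<Sum>i\<le>m. \<bar>e' i z u v\<bar>)"
      unfolding sum.distrib[symmetric] by (intro sum_mono abs_triangle_ineq)
    also have "\<dots> \<le> B z + C z" using e(3) e'(3) that by (intro add_mono) auto
    finally show ?thesis .
  qed
  then show ?case
    by (intro exI[of _ "\<lambda>i z u v. e i z u v + e' i z u v"])
       (auto simp: e(2) e'(2) sum.distrib algebra_simps intro!: uv_poly.add e(1)[rule_format] e'(1)[rule_format])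
qed

section \<open>Formal power series with homogeneous coefficients and their majorant series\<close>

definition hfps :: "(complex \<Rightarrow> complex \<Rightarrow> real \<Rightarrow> real \<Rightarrow> real fps) \<Rightarrow> (complex \<Rightarrow> real fps) \<Rightarrow> bool" where
  "hfps F B \<longleftrightarrow> (\<forall>m. hpoly m (\<lambda>z. B z $ m) (\<lambda>z w u v. F z w u v $ m))"

lemma hfps_mult:
  assumes "hfps F B" "hfps G C"
  shows "hfps (\<lambda>z w u v. F z w u v * G z w u v) (\<lambda>z. B z * C z)"
  unfolding hfps_def fps_mult_nth
proof (intro allI hpoly_sum)
  fix m s :: nat assume "s \<in> {0..m}"
  then show "hpoly m (\<lambda>z. B z $ s * C z $ (m - s)) (\<lambda>z w u v. F z w u v $ s * G z w u v $ (m - s))"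
    using assms hpoly_mult[of s _ _ "m - s"] unfolding hfps_def by fastforce
qed simp

lemma hfps_1: "hfps (\<lambda>z w u v. 1) (\<lambda>z. 1)"
  unfolding hfps_def using hpoly_const[of 1] hpoly_zero by (auto simp: fps_one_nth)

lemma hfps_power: "hfps F B \<Longrightarrow> hfps (\<lambda>z w u v. F z w u v ^ n) (\<lambda>z. B z ^ n)"
  by (induction n) (auto simp: hfps_1 intro!: hfps_mult)

text \<open>For \<open>g > 0\<close> the binomial series has positive coefficients, so the same
  series formed with the majorant \<open>B\<close> is again a majorant.\<close>

lemma hfps_npow:
  assumes "hfps F B" "g > 0"
  shows "hfps (\<lambda>z w u v. fps_npow g (F z w u v)) (\<lambda>z. fps_npow g (B z))"
  unfolding hfps_def fps_npow_nth
proof (intro allI hpoly_sum)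
  fix m s :: nat
  have "hpoly m (\<lambda>z. (B z ^ s) $ m) (\<lambda>z w u v. (F z w u v ^ s) $ m)"
    using hfps_power[OF assms(1), of s] by (simp add: hfps_def)
  from hpoly_scale[OF this, of "pochhammer g s / fact s"]
  show "hpoly m (\<lambda>z. pochhammer g s / fact s * (B z ^ s) $ m) (\<lambda>z w u v. pochhammer g s / fact s * (F z w u v ^ s) $ m)"
    using pochhammer_pos[OF assms(2), of s] by simp
qed simp

lemma hfps_geom: "hpoly 1 B f \<Longrightarrow> hfps (\<lambda>z w u v. geom_fps (f z w u v)) (\<lambda>z. geom_fps (B z))"
  unfolding hfps_def using hpoly_power[of 1 B f] by simp

text \<open>\<open>1 - dih_fps k z w u v\<close> is the product of the \<open>1 - a\<^sub>j X\<close> for \<open>j < k\<close>.\<close>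
definition dih_fps :: "nat \<Rightarrow> complex \<Rightarrow> complex \<Rightarrow> real \<Rightarrow> real \<Rightarrow> real fps" where
  "dih_fps k z w u v = 1 - cheb_fps k (cmod (z * w))
     + fps_const (2 / 2 ^ k * (v * (Re (z ^ k) * Re (w ^ k)) + u * (Im (z ^ k) * Im (w ^ k)))) * fps_X ^ k"

text \<open>The part of \<open>h_g\<close> of degree \<open>n\<close> in \<open>w\<close>: the
  parameters \<open>g\<close> of the Humbert function produce the power \<open>-g\<close>, and its
  last parameter 1 the geometric series.\<close>

definition hom_part :: "nat \<Rightarrow> real \<Rightarrow> nat \<Rightarrow> complex \<Rightarrow> complex \<Rightarrow> real \<Rightarrow> real \<Rightarrow> real" where
  "hom_part k g n z w u v = (fps_npow g (dih_fps k z w u v) * geom_fps (inner2 z w)) $ n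
     / pochhammer (real k * g + 1) n"

lemma hpoly_Re_Im:
  shows "hpoly 1 (\<lambda>z. 1) (\<lambda>z w u v. Re w)" "hpoly 1 (\<lambda>z. 1) (\<lambda>z w u v. Im w)"
  using hpoly.mono[of "\<lambda>_. 1" 1 0 1 0 0] hpoly.mono[of "\<lambda>_. 1" 0 1 1 0 0] by simp_all

lemma hpoly_Re_Im_power:
  "(\<exists>B. hpoly k B (\<lambda>z w u v. Re (w ^ k))) \<and> (\<exists>B. hpoly k B (\<lambda>z w u v. Im (w ^ k)))"
proof (induction k)
  case 0
  show ?case using hpoly_const[of 1] hpoly_const[of 0] by auto
next
  case (Suc k)
  then obtain B C where BC: "hpoly k B (\<lambda>z w u v. Re (w ^ k))" "hpoly k C (\<lambda>z w u v. Im (w ^ k))"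
    by blast
  have "hpoly (Suc k) (\<lambda>z. B z + \<bar>-1\<bar> * C z) (\<lambda>z w u v. Re w * Re (w ^ k) + (-1) * (Im w * Im (w ^ k)))"
    using hpoly.add[OF hpoly_mult[OF hpoly_Re_Im(1) BC(1)] hpoly_scale[OF hpoly_mult[OF hpoly_Re_Im(2) BC(2)], of "-1"]]
    by simp
  moreover have "hpoly (Suc k) (\<lambda>z. C z + B z) (\<lambda>z w u v. Re w * Im (w ^ k) + Im w * Re (w ^ k))"
    using hpoly.add[OF hpoly_mult[OF hpoly_Re_Im(1) BC(2)] hpoly_mult[OF hpoly_Re_Im(2) BC(1)]]
    by simp
  ultimately show ?case by auto
qed

lemma hpoly_mult_continuous:
  assumes "hpoly m B f" "continuous_on UNIV c"
  shows "hpoly m (\<lambda>z. \<bar>c z\<bar> * B z) (\<lambda>z w u v. c z * u ^ p * v ^ q * f z w u v)"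
  using hpoly_mult[OF hpoly.mono[OF assms(2), of 0 0 0 p q] assms(1)] by simp

lemma hpoly_inner2: "\<exists>B. hpoly 1 B (\<lambda>z w u v. inner2 z w)"
proof -
  have "hpoly 1 (\<lambda>z. \<bar>Re z\<bar> * 1 + \<bar>Im z\<bar> * 1) (\<lambda>z w u v. Re z * u ^ 0 * v ^ 0 * Re w + Im z * u ^ 0 * v ^ 0 * Im w)"
    by (intro hpoly.add hpoly_mult_continuous hpoly_Re_Im continuous_intros)
  then show ?thesis by (auto simp: inner2_def)
qed

text \<open>Even powers of \<open>cmod w\<close> are powers of \<open>Re w ^ 2 + Im w ^ 2\<close>;
  odd powers have coefficient zero. Taking the zero majorant at \<open>l = 0\<close> and beyond
  \<open>k\<close> makes the majorant series a polynomial without constant term, on which the growth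
  bound relies.\<close>

lemma hpoly_dih_fps_nth:
  assumes k: "k \<ge> 1"
  shows "\<exists>B. (l = 0 \<or> l > k \<longrightarrow> B = (\<lambda>_. 0)) \<and> hpoly l B (\<lambda>z w u v. dih_fps k z w u v $ l)"
proof (cases "l = 0 \<or> l > k")
  case True
  have "dih_fps k z w u v $ l = 0" for z w u v
  proof (cases "l = 0")
    case True
    then show ?thesis using k by (simp add: dih_fps_def)
  next
    case False
    then have "l > k" using True by simp
    have "degree (cheb_poly k (pi / 2)) \<le> (\<Sum>j<k. 1)"
      unfolding cheb_poly_def
      by (rule order.trans[OF degree_prod_sum_le]) (simp, unfold comp_def, intro sum_mono, simp)
    then have "poly.coeff (cheb_poly k (pi / 2)) l = 0"
      using \<open>l > k\<close> by (intro coeff_eq_0) simp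
    then show ?thesis using \<open>l > k\<close> False by (simp add: dih_fps_def cheb_fps_def fps_X_power_nth)
  qed
  then show ?thesis using hpoly_zero[of l] by auto
next
  case False
  let ?a = "- poly.coeff (cheb_poly k (pi / 2)) l"
  have norm_part: "\<exists>B. hpoly l B (\<lambda>z w u v. ?a * cmod (z * w) ^ l)"
  proof (cases "even l")
    case False
    then show ?thesis using coeff_cheb_poly_odd[OF k False] hpoly_zero[of l] by auto
  next
    case True
    then obtain n where n: "l = 2 * n" by blast
    have "hpoly (2 * n) (\<lambda>z. (1 ^ 2 + 1 ^ 2) ^ n) (\<lambda>z w u v. (Re w ^ 2 + Im w ^ 2) ^ n)"
      using hpoly_power[OF hpoly.add[OF hpoly_power[OF hpoly_Re_Im(1), of 2] hpoly_power[OF hpoly_Re_Im(2), of 2]], of n]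
      by simp
    then have "hpoly l (\<lambda>z. \<bar>?a * cmod z ^ l\<bar> * (1 ^ 2 + 1 ^ 2) ^ n)
      (\<lambda>z w u v. (?a * cmod z ^ l) * u ^ 0 * v ^ 0 * (Re w ^ 2 + Im w ^ 2) ^ n)"
      unfolding n by (intro hpoly_mult_continuous continuous_intros)
    moreover have "(\<lambda>z w u v. (?a * cmod z ^ l) * u ^ 0 * v ^ 0 * (Re w ^ 2 + Im w ^ 2) ^ n)
        = (\<lambda>z w u v::real. ?a * cmod (z * w) ^ l)"
      by (intro ext) (simp add: n norm_mult power_mult_distrib power_mult flip: cmod_power2)
    ultimately show ?thesis by (metis (lifting))
  qed
  show ?thesis
  proof (cases "l = k")
    case False
    then have "dih_fps k z w u v $ l = ?a * cmod (z * w) ^ l" for z w u v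
      using \<open>\<not> (l = 0 \<or> l > k)\<close> by (simp add: dih_fps_def cheb_fps_def fps_X_power_nth)
    then show ?thesis using norm_part \<open>\<not> (l = 0 \<or> l > k)\<close> by simp
  next
    case True
    obtain B C D where B: "hpoly l B (\<lambda>z w u v. ?a * cmod (z * w) ^ l)"
      and CD: "hpoly l C (\<lambda>z w u v. Re (w ^ k))" "hpoly l D (\<lambda>z w u v. Im (w ^ k))"
      using norm_part hpoly_Re_Im_power[of k] unfolding True by (elim conjE exE)
    have "hpoly l (\<lambda>z. B z + (\<bar>2 / 2 ^ k * Re (z ^ k)\<bar> * C z + \<bar>2 / 2 ^ k * Im (z ^ k)\<bar> * D z))
      (\<lambda>z w u v. ?a * cmod (z * w) ^ l + ((2 / 2 ^ k * Re (z ^ k)) * u ^ 0 * v ^ 1 * Re (w ^ k)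
         + (2 / 2 ^ k * Im (z ^ k)) * u ^ 1 * v ^ 0 * Im (w ^ k)))"
      by (intro hpoly.add hpoly_mult_continuous B CD continuous_intros)
    moreover have "(\<lambda>z w u v. ?a * cmod (z * w) ^ l + ((2 / 2 ^ k * Re (z ^ k)) * u ^ 0 * v ^ 1 * Re (w ^ k)
         + (2 / 2 ^ k * Im (z ^ k)) * u ^ 1 * v ^ 0 * Im (w ^ k))) = (\<lambda>z w u v. dih_fps k z w u v $ l)"
      using \<open>\<not> (l = 0 \<or> l > k)\<close> True
      by (intro ext) (simp add: dih_fps_def cheb_fps_def fps_X_power_nth distrib_left mult_ac)
    ultimately show ?thesis using \<open>\<not> (l = 0 \<or> l > k)\<close> by (simp only:) blast
  qed
qed

lemma dih_fps_nth_0 [simp]: "k \<ge> 1 \<Longrightarrow> dih_fps k z w u v $ 0 = 0"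
  by (simp add: dih_fps_def)

lemma hfps_dih_fps:
  assumes "k \<ge> 1"
  obtains D where "hfps (dih_fps k) D" "\<And>z l. l = 0 \<or> l > k \<Longrightarrow> D z $ l = 0" "\<And>z l. D z $ l \<ge> 0"
proof -
  have "\<forall>l. \<exists>B. (l = 0 \<or> l > k \<longrightarrow> B = (\<lambda>_. 0)) \<and> hpoly l B (\<lambda>z w u v. dih_fps k z w u v $ l)"
    using hpoly_dih_fps_nth[OF assms] by blast
  then obtain B where B': "\<forall>l. (l = 0 \<or> l > k \<longrightarrow> B l = (\<lambda>_. 0)) \<and> hpoly l (B l) (\<lambda>z w u v. dih_fps k z w u v $ l)"
    by (rule choice[THEN exE])
  have B: "l = 0 \<or> l > k \<Longrightarrow> B l = (\<lambda>_. 0)" "hpoly l (B l) (\<lambda>z w u v. dih_fps k z w u v $ l)" for l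
    using B'[rule_format, of l] by blast+
  show ?thesis
  proof (rule that[of "\<lambda>z. Abs_fps (\<lambda>l. B l z)"])
    show "hfps (dih_fps k) (\<lambda>z. Abs_fps (\<lambda>l. B l z))" using B(2) by (simp add: hfps_def)
    show "Abs_fps (\<lambda>l. B l z) $ l = 0" if "l = 0 \<or> l > k" for z l using B(1)[OF that] by simp
    show "Abs_fps (\<lambda>l. B l z) $ l \<ge> 0" for z l using hpoly_nonneg[OF B(2)] by simp
  qed
qed

section \<open>Growth of the coefficients of the majorants\<close>

lemma sum_pochhammer_over_fact: "(\<Sum>j\<le>n. pochhammer g j / fact j) = pochhammer (g + 1) n / fact (n::nat)" for g :: real
proof (induction n)
  case (Suc n)
  have "pochhammer_fps g $ Suc n = ((1 - fps_X) * pochhammer_fps (g + 1)) $ Suc n"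
    by (subst pochhammer_fps_Suc_param) simp
  then show ?case using Suc by (simp add: left_diff_distrib)
qed simp

text \<open>If the value of \<open>D\<close> at \<open>r\<close> is at most 1, then so is that of
  its powers, and hence each of their nonnegative terms. The induction bounds single terms, so
  partial sums suffice and no convergence is involved.\<close>

lemma fps_power_nth_bound:
  fixes D :: "real fps"
  assumes nonneg: "\<And>l. D $ l \<ge> 0" and r: "r \<ge> 0" and bound: "\<And>n. (\<Sum>l\<le>n. D $ l * r ^ l) \<le> 1"
  shows "(D ^ j) $ n * r ^ n \<le> 1"
proof (induction j arbitrary: n)
  case 0
  show ?case by (simp add: fps_one_nth)
next
  case (Suc j)
  have "(D ^ Suc j) $ n * r ^ n = (\<Sum>l\<le>n. D $ l * (D ^ j) $ (n - l)) * r ^ n"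
    by (simp add: fps_mult_nth atMost_atLeast0)
  also have "\<dots> = (\<Sum>l\<le>n. (D $ l * r ^ l) * ((D ^ j) $ (n - l) * r ^ (n - l)))"
    unfolding sum_distrib_right
  proof (intro sum.cong refl)
    fix l assume "l \<in> {..n}"
    then have "r ^ n = r ^ l * r ^ (n - l)" by (simp flip: power_add)
    then show "D $ l * (D ^ j) $ (n - l) * r ^ n = (D $ l * r ^ l) * ((D ^ j) $ (n - l) * r ^ (n - l))"
      by simp
  qed
  also have "\<dots> \<le> (\<Sum>l\<le>n. (D $ l * r ^ l) * 1)"
    using nonneg r Suc by (intro sum_mono mult_left_mono) auto
  also have "\<dots> \<le> 1" using bound by simp
  finally show ?case .
qed

text \<open>With the powers of \<open>D\<close> bounded by 1 the binomial coefficients are merely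
  summed, which raises the parameter by 1; the geometric series sums once more, whence
  \<open>g + 2\<close>.\<close>

lemma fps_npow_times_geom_bound:
  fixes D :: "real fps"
  assumes nonneg: "\<And>l. D $ l \<ge> 0" and r: "r \<ge> 0" and bound: "\<And>n. (\<Sum>l\<le>n. D $ l * r ^ l) \<le> 1"
    and c: "0 \<le> c" "c * r \<le> 1" and g: "g > 0"
  shows "(fps_npow g D * geom_fps c) $ n * r ^ n \<le> pochhammer (g + 2) n / fact n"
proof -
  have npow: "fps_npow g D $ m * r ^ m \<le> pochhammer (g + 1) m / fact m" for m
  proof -
    have "fps_npow g D $ m * r ^ m = (\<Sum>j\<le>m. pochhammer g j / fact j * ((D ^ j) $ m * r ^ m))"
      by (simp add: fps_npow_nth sum_distrib_right mult.assoc)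
    also have "\<dots> \<le> (\<Sum>j\<le>m. pochhammer g j / fact j * 1)"
      using g pochhammer_pos[OF g]
      by (intro sum_mono mult_left_mono fps_power_nth_bound[OF nonneg r bound]) (auto simp: less_imp_le)
    finally show ?thesis by (simp add: sum_pochhammer_over_fact)
  qed
  have "(fps_npow g D * geom_fps c) $ n * r ^ n = (\<Sum>l\<le>n. fps_npow g D $ l * c ^ (n - l)) * r ^ n"
    by (simp add: fps_mult_nth atMost_atLeast0)
  also have "\<dots> = (\<Sum>l\<le>n. (fps_npow g D $ l * r ^ l) * (c * r) ^ (n - l))"
    unfolding sum_distrib_right
  proof (intro sum.cong refl)
    fix l assume "l \<in> {..n}"
    then have "r ^ n = r ^ l * r ^ (n - l)" by (simp flip: power_add)
    then show "fps_npow g D $ l * c ^ (n - l) * r ^ n = (fps_npow g D $ l * r ^ l) * (c * r) ^ (n - l)"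
      by (simp add: power_mult_distrib)
  qed
  also have "\<dots> \<le> (\<Sum>l\<le>n. pochhammer (g + 1) l / fact l * 1)"
    using npow c r g by (intro sum_mono mult_mono power_le_one) (auto intro!: divide_nonneg_nonneg pochhammer_nonneg)
  also have "\<dots> = pochhammer (g + 2) n / fact n"
    using sum_pochhammer_over_fact[where g = "g + 1"] by (simp add: add.assoc)
  finally show ?thesis .
qed

lemma pochhammer_mono:
  fixes a b :: real
  assumes "0 \<le> a" "a \<le> b"
  shows "pochhammer a n \<le> pochhammer b n"
  unfolding pochhammer_prod using assms by (intro prod_mono) auto

text \<open>As \<open>k g\<close> is at least \<open>g\<close>, the denominator may be lowered to
  parameter \<open>g + 1\<close>; then the quotient telescopes to
  \<open>(g + 1 + n) / (g + 1)\<close>.\<close>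

lemma pochhammer_quotient_bound:
  fixes g :: real
  assumes g: "g > 0" and k: "k \<ge> (1::nat)"
  shows "pochhammer (g + 2) n / pochhammer (real k * g + 1) n \<le> real n + 1"
proof -
  have p: "pochhammer (g + 1) n > 0" using g by (intro pochhammer_pos) simp
  have "1 * g \<le> real k * g" using g k by (intro mult_right_mono) auto
  then have "pochhammer (g + 1) n \<le> pochhammer (real k * g + 1) n"
    using g by (intro pochhammer_mono) auto
  then have "pochhammer (g + 2) n / pochhammer (real k * g + 1) n \<le> pochhammer (g + 2) n / pochhammer (g + 1) n"
    using g p by (intro divide_left_mono pochhammer_nonneg) auto
  also have "\<dots> = (g + 1 + n) / (g + 1)"
    using g p pochhammer_rec[of "g + 1" n] pochhammer_rec'[of "g + 1" n]
    by (simp add: field_simps add.assoc)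
  also have "\<dots> = 1 + n / (g + 1)" using g by (simp add: field_simps)
  also have "\<dots> \<le> 1 + n / 1" using g by (intro add_left_mono divide_left_mono) auto
  finally show ?thesis by simp
qed

text \<open>The factor \<open>1 / n!\<close> in the last bound gives absolute convergence for all
  \<open>w\<close>. The radius \<open>R\<close> depends on \<open>z\<close> alone, uniformly in
  \<open>u, v\<close>.\<close>

lemma hom_part_coeffs:
  assumes k: "k \<ge> 1" and g: "g > 0"
  obtains e where "\<And>i j. uv_poly (e i j)"
    "\<And>n z w u v. hom_part k g n z w u v = (\<Sum>i\<le>n. e i (n - i) z u v * (Re w ^ i * Im w ^ (n - i)))"
    "\<And>z. \<exists>R\<ge>0. \<forall>n u v. \<bar>u\<bar> \<le> 1 \<longrightarrow> \<bar>v\<bar> \<le> 1 \<longrightarrow>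
       (\<Sum>i\<le>n. \<bar>e i (n - i) z u v\<bar>) \<le> (real n + 1) * R ^ n / fact n"
proof -
  obtain D where D: "hfps (dih_fps k) D" "\<And>z l. l = 0 \<or> l > k \<Longrightarrow> D z $ l = 0" "\<And>z l. D z $ l \<ge> 0"
    using hfps_dih_fps[OF k] by metis
  obtain C where C: "hpoly 1 C (\<lambda>z w u v. inner2 z w)" using hpoly_inner2 by blast
  define q where "q n = pochhammer (real k * g + 1) n" for n
  have q: "q n > 0" for n using g unfolding q_def by (intro pochhammer_pos) (simp add: add_nonneg_pos)
  have "hfps (\<lambda>z w u v. fps_npow g (dih_fps k z w u v) * geom_fps (inner2 z w)) (\<lambda>z. fps_npow g (D z) * geom_fps (C z))"
    by (intro hfps_mult hfps_npow hfps_geom D C g)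
  then have hp0: "hpoly n (\<lambda>z. \<bar>1 / q n\<bar> * (fps_npow g (D z) * geom_fps (C z)) $ n)
      (\<lambda>z w u v. 1 / q n * (fps_npow g (dih_fps k z w u v) * geom_fps (inner2 z w)) $ n)" for n
    unfolding hfps_def by (intro hpoly_scale) blast
  have hp: "hpoly n (\<lambda>z. (fps_npow g (D z) * geom_fps (C z)) $ n / q n) (hom_part k g n)" for n
    using hp0[of n] q[of n] unfolding hom_part_def[abs_def] q_def[symmetric] by simp
  have "\<forall>n. \<exists>e. (\<forall>i. uv_poly (e i)) \<and>
      (\<forall>z w u v. hom_part k g n z w u v = (\<Sum>i\<le>n. e i z u v * (Re w ^ i * Im w ^ (n - i)))) \<and>
      (\<forall>z u v. \<bar>u\<bar> \<le> 1 \<longrightarrow> \<bar>v\<bar> \<le> 1 \<longrightarrow>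
         (\<Sum>i\<le>n. \<bar>e i z u v\<bar>) \<le> (fps_npow g (D z) * geom_fps (C z)) $ n / q n)"
    by (intro allI hpoly_coeffs hp)
  then obtain E where E': "\<forall>n. (\<forall>i. uv_poly (E n i)) \<and>
      (\<forall>z w u v. hom_part k g n z w u v = (\<Sum>i\<le>n. E n i z u v * (Re w ^ i * Im w ^ (n - i)))) \<and>
      (\<forall>z u v. \<bar>u\<bar> \<le> 1 \<longrightarrow> \<bar>v\<bar> \<le> 1 \<longrightarrow>
         (\<Sum>i\<le>n. \<bar>E n i z u v\<bar>) \<le> (fps_npow g (D z) * geom_fps (C z)) $ n / q n)"
    by (rule choice[THEN exE])
  have E: "uv_poly (E n i)"
    "hom_part k g n z w u v = (\<Sum>i\<le>n. E n i z u v * (Re w ^ i * Im w ^ (n - i)))"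
    "\<bar>u\<bar> \<le> 1 \<Longrightarrow> \<bar>v\<bar> \<le> 1 \<Longrightarrow>
       (\<Sum>i\<le>n. \<bar>E n i z u v\<bar>) \<le> (fps_npow g (D z) * geom_fps (C z)) $ n / q n" for n i z w u v
    using E'[rule_format, of n] by blast+
  show ?thesis
  \<comment> \<open>Coefficients are re-indexed by the exponents of \<open>Re w\<close> and
    \<open>Im w\<close>; their sum is the degree.\<close>
  proof (rule that[of "\<lambda>i j. E (i + j) i"])
    show "uv_poly (E (i + j) i)" for i j by (rule E)
    show "hom_part k g n z w u v = (\<Sum>i\<le>n. E (i + (n - i)) i z u v * (Re w ^ i * Im w ^ (n - i)))" for n z w u v
      unfolding E(2) by (intro sum.cong refl) simp
    fix z
    \<comment> \<open>The series \<open>D z\<close> is a polynomial without constant term, so at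
      \<open>1 / s\<close> it is at most the sum of its coefficients divided by \<open>s\<close>,
      hence at most 1. The summand \<open>C z\<close> gives \<open>C z / s <= 1\<close>.\<close>
    define s where "s = 1 + (\<Sum>l\<le>k. D z $ l) + C z"
    have Cz: "C z \<ge> 0" using hpoly_nonneg[OF C] .
    have S: "(\<Sum>l\<le>k. D z $ l) \<ge> 0" using D(3) by (intro sum_nonneg)
    have s: "s \<ge> 1" using Cz S by (simp add: s_def)
    have sum_le: "(\<Sum>l\<le>n. D z $ l * (1 / s) ^ l) \<le> 1" for n
    proof -
      have "(\<Sum>l\<le>n. D z $ l * (1 / s) ^ l) \<le> (\<Sum>l\<le>n. D z $ l * (1 / s))"
      proof (intro sum_mono)
        fix l
        show "D z $ l * (1 / s) ^ l \<le> D z $ l * (1 / s)"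
        proof (cases l)
          case 0
          then show ?thesis using D(2)[of 0] by simp
        next
          case (Suc m)
          have "(1 / s) ^ l \<le> (1 / s) ^ 1" using s Suc by (intro power_decreasing) auto
          then show ?thesis using D(3) by (intro mult_left_mono) auto
        qed
      qed
      also have "\<dots> = (\<Sum>l\<le>n. D z $ l) / s" by (simp add: sum_divide_distrib)
      also have "(\<Sum>l\<le>n. D z $ l) \<le> (\<Sum>l\<le>n + k. D z $ l)"
        using D(3) by (intro sum_mono2) auto
      also have "(\<Sum>l\<le>n + k. D z $ l) = (\<Sum>l\<le>k. D z $ l)"
        using D(2) by (intro sum.mono_neutral_right) auto
      finally have "(\<Sum>l\<le>n. D z $ l * (1 / s) ^ l) \<le> (\<Sum>l\<le>k. D z $ l) / s"
        using s by (simp add: divide_right_mono)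
      also have "\<dots> \<le> 1" using s Cz by (simp add: s_def)
      finally show ?thesis .
    qed
    have cs: "C z * (1 / s) \<le> 1" using s S by (simp add: s_def)
    have "(\<Sum>i\<le>n. \<bar>E (i + (n - i)) i z u v\<bar>) \<le> (real n + 1) * s ^ n / fact n" if "\<bar>u\<bar> \<le> 1" "\<bar>v\<bar> \<le> 1" for n u v
    proof -
      have "(fps_npow g (D z) * geom_fps (C z)) $ n * (1 / s) ^ n \<le> pochhammer (g + 2) n / fact n"
        using s sum_le cs Cz D(3) g by (intro fps_npow_times_geom_bound) auto
      then have b: "(fps_npow g (D z) * geom_fps (C z)) $ n \<le> pochhammer (g + 2) n / fact n * s ^ n"
        using s by (simp add: power_divide field_simps)
      have "(\<Sum>i\<le>n. \<bar>E (i + (n - i)) i z u v\<bar>) = (\<Sum>i\<le>n. \<bar>E n i z u v\<bar>)"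
        by (intro sum.cong refl) simp
      also have "\<dots> \<le> (fps_npow g (D z) * geom_fps (C z)) $ n / q n" using E(3) that by blast
      also have "\<dots> \<le> pochhammer (g + 2) n / fact n * s ^ n / q n"
        using b q[of n] by (intro divide_right_mono) auto
      also have "\<dots> = (pochhammer (g + 2) n / q n) * (s ^ n / fact n)" by simp
      also have "\<dots> \<le> (real n + 1) * (s ^ n / fact n)"
        unfolding q_def using s by (intro mult_right_mono pochhammer_quotient_bound g k) auto
      finally show ?thesis by simp
    qed
    then show "\<exists>R\<ge>0. \<forall>n u v. \<bar>u\<bar> \<le> 1 \<longrightarrow> \<bar>v\<bar> \<le> 1 \<longrightarrow>
       (\<Sum>i\<le>n. \<bar>E (i + (n - i)) i z u v\<bar>) \<le> (real n + 1) * R ^ n / fact n"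
      using s by (intro exI[of _ s]) auto
  qed
qed

section \<open>The Humbert series as a sum of homogeneous parts\<close>

text \<open>Multi-indices are functions vanishing from \<open>m\<close> on, to match the index set
  of \<open>humbert2\<close>.\<close>

definition compositions :: "nat \<Rightarrow> nat \<Rightarrow> (nat \<Rightarrow> nat) set" where
  "compositions m n = {J. (\<forall>i\<ge>m. J i = 0) \<and> (\<Sum>i<m. J i) = n}"

lemma compositions_0: "compositions 0 n = (if n = 0 then {\<lambda>_. 0} else {})"
  by (auto simp: compositions_def)

lemma finite_compositions: "finite (compositions m n)"
proof (rule finite_subset)
  show "compositions m n \<subseteq> {J. \<forall>i. (i \<in> {..<m} \<longrightarrow> J i \<in> {..n}) \<and> (i \<notin> {..<m} \<longrightarrow> J i = 0)}"
  proof
    fix J assume J: "J \<in> compositions m n"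
    have "J i \<le> n" if "i < m" for i
    proof -
      have "J i \<le> (\<Sum>i<m. J i)" using that by (intro member_le_sum) auto
      then show ?thesis using J by (simp add: compositions_def)
    qed
    then show "J \<in> {J. \<forall>i. (i \<in> {..<m} \<longrightarrow> J i \<in> {..n}) \<and> (i \<notin> {..<m} \<longrightarrow> J i = 0)}"
      using J by (auto simp: compositions_def)
  qed
qed (intro finite_set_of_finite_funs; simp)

lemma sum_compositions_Suc:
  "(\<Sum>J\<in>compositions (Suc m) n. F J) = (\<Sum>l\<le>n. \<Sum>J\<in>compositions m l. F (J(m := n - l)))" for F :: "_ \<Rightarrow> real"
proof -
  have "(\<Sum>l\<le>n. \<Sum>J\<in>compositions m l. F (J(m := n - l))) = (\<Sum>(l, J)\<in>Sigma {..n} (compositions m). F (J(m := n - l)))"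
    by (simp add: sum.Sigma finite_compositions)
  also have "\<dots> = (\<Sum>J\<in>compositions (Suc m) n. F J)"
  proof (rule sum.reindex_bij_witness[where i = "\<lambda>J. (n - J m, J(m := 0))" and j = "\<lambda>(l, J). J(m := n - l)"]; clarsimp)
    fix J assume "J \<in> compositions (Suc m) n"
    then have J: "\<And>i. i \<ge> Suc m \<Longrightarrow> J i = 0" "(\<Sum>i<m. J i) + J m = n" by (auto simp: compositions_def)
    show "J(m := n - (n - J m)) = J" using J(2) by auto
    show "J(m := 0) \<in> compositions m (n - J m)"
      using J unfolding compositions_def by (auto simp: Suc_le_eq)
  next
    fix l J assume "l \<le> n" "J \<in> compositions m l"
    then have J: "\<And>i. i \<ge> m \<Longrightarrow> J i = 0" "(\<Sum>i<m. J i) = l" by (auto simp: compositions_def)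
    show "J(m := 0) = J" using J(1) by auto
    show "J(m := n - l) \<in> compositions (Suc m) n" using J \<open>l \<le> n\<close> by (auto simp: compositions_def)
  qed
  finally show ?thesis ..
qed

lemma sum_prod_compositions:
  fixes f :: "nat \<Rightarrow> nat \<Rightarrow> real"
  shows "(\<Sum>J\<in>compositions m n. \<Prod>i<m. f i (J i)) = (\<Prod>i<m. Abs_fps (f i)) $ n"
proof (induction m arbitrary: n)
  case 0
  show ?case by (simp add: compositions_0 fps_one_nth)
next
  case (Suc m)
  have "(\<Sum>J\<in>compositions (Suc m) n. \<Prod>i<Suc m. f i (J i))
      = (\<Sum>l\<le>n. \<Sum>J\<in>compositions m l. (\<Prod>i<m. f i (J i)) * f m (n - l))"
    unfolding sum_compositions_Suc by (intro sum.cong refl) simp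
  also have "\<dots> = (\<Sum>l\<le>n. (\<Prod>i<m. Abs_fps (f i)) $ l * f m (n - l))"
    by (simp add: Suc.IH flip: sum_distrib_right)
  also have "\<dots> = (\<Prod>i<Suc m. Abs_fps (f i)) $ n"
    by (simp add: fps_mult_nth atMost_atLeast0)
  finally show ?case .
qed

lemma prod_fps_npow_same:
  "d $ 0 = 0 \<Longrightarrow> finite S \<Longrightarrow> (\<Prod>i\<in>S. fps_npow (beta i) d) = fps_npow (\<Sum>i\<in>S. beta i) d"
  by (induction S rule: infinite_finite_induct) (simp_all add: fps_npow_0_param fps_npow_add)

lemma summable_power_over_fact: "(\<lambda>n. (x::real) ^ n / fact n) summable_on UNIV"
proof -
  have "summable (\<lambda>n. norm (x ^ n / fact n))"
    using summable_norm_exp[of x] by (simp add: scaleR_conv_of_real divide_inverse mult.commute)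
  then show ?thesis by (rule norm_summable_imp_summable_on)
qed

text \<open>Terms of total degree \<open>n\<close> add up to a coefficient of a product of negative
  powers. Absolute convergence justifies this grouping.\<close>

theorem humbert2_has_sum:
  assumes beta: "\<And>i. i < m \<Longrightarrow> beta i > 0" and gam: "gam = (\<Sum>i<m. beta i)" and m: "m > 0"
  shows "((\<lambda>n. (\<Prod>i<m. fps_npow (beta i) (fps_const (x i) * fps_X)) $ n / pochhammer gam n)
           has_sum humbert2 m beta gam x) UNIV"
proof -
  define T where "T J = (\<Prod>i<m. pochhammer (beta i) (J i) * x i ^ J i / fact (J i)) / pochhammer gam (\<Sum>i<m. J i)" for J
  have gam_pos: "gam > 0" unfolding gam using beta m by (intro sum_pos) auto
  define R where "R = (\<Sum>i<m. \<bar>x i\<bar>)"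
  have xR: "\<bar>x i\<bar> \<le> R" if "i < m" for i
    unfolding R_def using that by (intro member_le_sum) auto
  have fibre: "(\<Sum>J\<in>compositions m n. T J) = (\<Prod>i<m. fps_npow (beta i) (fps_const (x i) * fps_X)) $ n / pochhammer gam n" for n
  proof -
    have "(\<Sum>J\<in>compositions m n. T J)
        = (\<Sum>J\<in>compositions m n. \<Prod>i<m. pochhammer (beta i) (J i) * x i ^ J i / fact (J i)) / pochhammer gam n"
      unfolding sum_divide_distrib by (intro sum.cong refl) (simp add: T_def compositions_def)
    then show ?thesis
      by (simp add: fps_npow_linear sum_prod_compositions[of "\<lambda>i j. pochhammer (beta i) j * x i ^ j / fact j"])
  qed
  have fibre_abs: "(\<Sum>J\<in>compositions m n. \<bar>T J\<bar>) \<le> R ^ n / fact n" for n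
  proof -
    have "(\<Sum>J\<in>compositions m n. \<bar>T J\<bar>)
        = (\<Sum>J\<in>compositions m n. \<Prod>i<m. pochhammer (beta i) (J i) * \<bar>x i\<bar> ^ J i / fact (J i)) / pochhammer gam n"
      unfolding sum_divide_distrib
    proof (intro sum.cong refl)
      fix J assume "J \<in> compositions m n"
      then show "\<bar>T J\<bar> = (\<Prod>i<m. pochhammer (beta i) (J i) * \<bar>x i\<bar> ^ J i / fact (J i)) / pochhammer gam n"
        using pochhammer_pos[OF gam_pos, of n] pochhammer_pos[OF beta]
        by (auto simp: T_def compositions_def abs_mult power_abs abs_prod abs_of_pos intro!: prod.cong)
    qed
    also have "\<dots> \<le> (\<Sum>J\<in>compositions m n. \<Prod>i<m. pochhammer (beta i) (J i) * R ^ J i / fact (J i)) / pochhammer gam n"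
      using pochhammer_pos[OF gam_pos, of n] xR pochhammer_pos[OF beta]
      by (intro divide_right_mono sum_mono prod_mono conjI mult_left_mono power_mono)
         (auto intro!: divide_nonneg_nonneg mult_nonneg_nonneg simp: less_imp_le)
    also have "\<dots> = (\<Prod>i<m. fps_npow (beta i) (fps_const R * fps_X)) $ n / pochhammer gam n"
      by (simp add: fps_npow_linear sum_prod_compositions[of "\<lambda>i j. pochhammer (beta i) j * R ^ j / fact j"])
    \<comment> \<open>With all arguments equal the powers combine to \<open>1 - R X\<close> to the
      power \<open>-gam\<close>; its coefficient contains \<open>pochhammer gam n\<close>, which
      cancels the denominator.\<close>
    also have "\<dots> = R ^ n / fact n"
      using pochhammer_pos[OF gam_pos, of n]
      by (subst prod_fps_npow_same) (simp_all only: finite_lessThan fps_npow_linear gam[symmetric], simp_all)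
    finally show ?thesis .
  qed
  have summable: "(\<lambda>(n, J). T J) summable_on Sigma UNIV (compositions m)"
  proof -
    have "(\<lambda>n. \<Sum>J\<in>compositions m n. \<bar>T J\<bar>) summable_on UNIV"
    proof (rule summable_on_comparison_test[OF summable_power_over_fact[of R]])
      show "(\<Sum>J\<in>compositions m n. \<bar>T J\<bar>) \<le> R ^ n / fact n" for n by (rule fibre_abs)
    qed (auto intro: sum_nonneg)
    then have "(\<lambda>p. norm ((\<lambda>(n, J). T J) p)) summable_on Sigma UNIV (compositions m)"
      unfolding Infinite_Sum.abs_summable_on_Sigma_iff by (simp add: finite_compositions sum_nonneg summable_on_finite)
    then show ?thesis by (rule abs_summable_summable)
  qed
  have bij: "bij_betw snd (Sigma UNIV (compositions m)) {J. \<forall>i\<ge>m. J i = 0}"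
    by (rule bij_betw_byWitness[where f' = "\<lambda>J. (\<Sum>i<m. J i, J)"]) (auto simp: compositions_def)
  have eq: "(\<lambda>(n, J). T J) = (\<lambda>p. T (snd p))" by auto
  have "(T has_sum infsum T {J. \<forall>i\<ge>m. J i = 0}) {J. \<forall>i\<ge>m. J i = 0}"
    using summable unfolding eq summable_on_reindex_bij_betw[OF bij] by simp
  then have "((\<lambda>(n, J). T J) has_sum humbert2 m beta gam x) (Sigma UNIV (compositions m))"
    unfolding eq has_sum_reindex_bij_betw[OF bij] by (simp add: humbert2_def T_def[abs_def])
  then show ?thesis
    by (rule has_sum_SigmaD) (simp add: fibre[symmetric] has_sum_finite finite_compositions)
qed

section \<open>The Humbert function with the arguments of \<open>h_g\<close>\<close>

lemma abs_xi_uv_le_1: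
  assumes "\<bar>u\<bar> \<le> 1" "\<bar>v\<bar> \<le> 1"
  shows "\<bar>xi_uv u v s t\<bar> \<le> 1"
proof -
  have "\<bar>xi_uv u v s t\<bar> \<le> \<bar>v\<bar> * \<bar>cos s * cos t\<bar> + \<bar>u\<bar> * \<bar>sin s * sin t\<bar>"
    unfolding xi_uv_def using abs_triangle_ineq[of "v * cos s * cos t" "u * sin s * sin t"] by (simp add: abs_mult mult.assoc)
  also have "\<dots> \<le> 1 * \<bar>cos s * cos t\<bar> + 1 * \<bar>sin s * sin t\<bar>"
    using assms by (intro add_mono mult_right_mono) auto
  also have "\<dots> \<le> 1"
    using cos_add[of s t] cos_diff[of s t] cos_le_one[of "s + t"] cos_ge_minus_one[of "s + t"]
      cos_le_one[of "s - t"] cos_ge_minus_one[of "s - t"]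
    by (auto simp: abs_if)
  finally show ?thesis .
qed

lemma power_polar:
  shows "Re (z ^ k) = cmod z ^ k * cos (real k * Arg z)" "Im (z ^ k) = cmod z ^ k * sin (real k * Arg z)"
proof -
  have "z ^ k = rcis (cmod z ^ k) (real k * Arg z)"
    by (metis DeMoivre2 rcis_cmod_Arg)
  then show "Re (z ^ k) = cmod z ^ k * cos (real k * Arg z)" "Im (z ^ k) = cmod z ^ k * sin (real k * Arg z)"
    by simp_all
qed

lemma fps_npow_1: "fps_npow 1 (fps_const c * fps_X) = geom_fps c"
  unfolding fps_npow_linear by (rule fps_ext) (simp add: pochhammer_fact[symmetric])

text \<open>The upper parameters \<open>g, ..., g, 1\<close> add up to the lower one,
  \<open>k g + 1\<close>, so \<open>humbert2_has_sum\<close> applies; the Chebyshev product formula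
  evaluates the first \<open>k\<close> factors.\<close>

theorem hfun_has_sum:
  assumes k: "k \<ge> 1" and g: "g > 0" and uv: "\<bar>u\<bar> \<le> 1" "\<bar>v\<bar> \<le> 1"
  shows "((\<lambda>n. hom_part k g n z w u v) has_sum hfun k g z w u v) UNIV"
proof -
  let ?q = "q_uv u v (real k * Arg z) (real k * Arg w)"
  let ?x = "\<lambda>i. if i < k then cmod (z * w) * cos ((?q + 2 * pi * real i) / real k) else Re (z * cnj w)"
  let ?b = "\<lambda>i. if i < k then g else 1"
  \<comment> \<open>On the square the argument of \<open>arccos\<close> lies in
    \<open>[-1, 1]\<close>, so the cosine undoes it.\<close>
  have cosq: "cos ?q = xi_uv u v (real k * Arg z) (real k * Arg w)"
    unfolding q_uv_def using abs_xi_uv_le_1[OF uv] by (intro cos_arccos_abs)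
  have rq: "cmod (z * w) ^ k * cos ?q = v * (Re (z ^ k) * Re (w ^ k)) + u * (Im (z ^ k) * Im (w ^ k))"
    unfolding cosq xi_uv_def power_polar by (simp add: norm_mult power_mult_distrib algebra_simps)
  have "(\<Prod>i<k + 1. fps_npow (?b i) (fps_const (?x i) * fps_X))
      = (\<Prod>i<k. fps_npow g (fps_const (cmod (z * w) * cos ((?q + 2 * pi * real i) / real k)) * fps_X))
        * geom_fps (inner2 z w)"
    by (simp add: fps_npow_1 inner2_def del: fps_const_mult)
  also have "(\<Prod>i<k. fps_npow g (fps_const (cmod (z * w) * cos ((?q + 2 * pi * real i) / real k)) * fps_X))
      = fps_npow g (1 - (cheb_fps k (cmod (z * w)) - fps_const (2 / 2 ^ k * (cmod (z * w) ^ k * cos ?q)) * fps_X ^ k))"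
    by (subst fps_npow_prod[THEN conjunct1]) (simp_all only: finite_lessThan prod_linear_fps_eq_cheb[OF k])
  also have "1 - (cheb_fps k (cmod (z * w)) - fps_const (2 / 2 ^ k * (cmod (z * w) ^ k * cos ?q)) * fps_X ^ k)
      = dih_fps k z w u v"
    unfolding rq dih_fps_def by simp
  finally have prod: "(\<Prod>i<k + 1. fps_npow (?b i) (fps_const (?x i) * fps_X))
      = fps_npow g (dih_fps k z w u v) * geom_fps (inner2 z w)" .
  have "((\<lambda>n. (\<Prod>i<k + 1. fps_npow (?b i) (fps_const (?x i) * fps_X)) $ n / pochhammer (real k * g + 1) n)
      has_sum humbert2 (k + 1) ?b (real k * g + 1) ?x) UNIV"
    using g by (intro humbert2_has_sum) auto
  then show ?thesis unfolding prod hfun_def hom_part_def .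
qed

lemma summable_Suc_times_power_over_fact:
  assumes "x \<ge> 0"
  shows "(\<lambda>n. (real n + 1) * x ^ n / fact n) summable_on UNIV"
proof (rule summable_on_comparison_test[OF summable_power_over_fact[of "2 * x"]])
  fix n
  have "real n + 1 \<le> 2 ^ n" by (induction n) auto
  then have "(real n + 1) * x ^ n \<le> 2 ^ n * x ^ n"
    using assms by (intro mult_right_mono) auto
  then show "(real n + 1) * x ^ n / fact n \<le> (2 * x) ^ n / fact n"
    by (simp add: power_mult_distrib divide_right_mono)
qed (use assms in auto)

text \<open>The bound makes the double family absolutely summable, so summation by degree may be
  replaced by unordered summation over pairs of exponents.\<close>

lemma power_series_from_homogeneous:
  fixes e :: "nat \<Rightarrow> nat \<Rightarrow> real"
  assumes sum: "((\<lambda>n. \<Sum>i\<le>n. e i (n - i) * (x ^ i * y ^ (n - i))) has_sum S) UNIV"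
    and R: "R \<ge> 0" and bound: "\<And>n. (\<Sum>i\<le>n. \<bar>e i (n - i)\<bar>) \<le> (real n + 1) * R ^ n / fact n"
  shows "((\<lambda>(i, j). e i j * x ^ i * y ^ j) has_sum S) UNIV"
proof -
  let ?f = "\<lambda>(n, i). e i (n - i) * x ^ i * y ^ (n - i)"
  define r where "r = max \<bar>x\<bar> \<bar>y\<bar>"
  have r: "r \<ge> 0" "\<bar>x\<bar> \<le> r" "\<bar>y\<bar> \<le> r" by (auto simp: r_def)
  have "(\<lambda>n. \<Sum>i\<le>n. \<bar>e i (n - i) * x ^ i * y ^ (n - i)\<bar>) summable_on UNIV"
  proof (rule summable_on_comparison_test[OF summable_Suc_times_power_over_fact[of "R * r"]])
    fix n
    have "(\<Sum>i\<le>n. \<bar>e i (n - i) * x ^ i * y ^ (n - i)\<bar>) \<le> (\<Sum>i\<le>n. \<bar>e i (n - i)\<bar> * r ^ n)"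
    proof (intro sum_mono)
      fix i assume i: "i \<in> {..n}"
      have "\<bar>e i (n - i) * x ^ i * y ^ (n - i)\<bar> = \<bar>e i (n - i)\<bar> * (\<bar>x\<bar> ^ i * \<bar>y\<bar> ^ (n - i))"
        by (simp add: abs_mult power_abs)
      also have "\<dots> \<le> \<bar>e i (n - i)\<bar> * (r ^ i * r ^ (n - i))"
        using r by (intro mult_left_mono mult_mono power_mono) auto
      also have "r ^ i * r ^ (n - i) = r ^ n" using i by (simp flip: power_add)
      finally show "\<bar>e i (n - i) * x ^ i * y ^ (n - i)\<bar> \<le> \<bar>e i (n - i)\<bar> * r ^ n" .
    qed
    also have "\<dots> \<le> (real n + 1) * R ^ n / fact n * r ^ n"
      unfolding sum_distrib_right[symmetric] using bound r by (intro mult_right_mono) auto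
    finally show "(\<Sum>i\<le>n. \<bar>e i (n - i) * x ^ i * y ^ (n - i)\<bar>) \<le> (real n + 1) * (R * r) ^ n / fact n"
      by (simp add: power_mult_distrib mult_ac)
  qed (use R r in \<open>auto intro: sum_nonneg\<close>)
  then have "(\<lambda>p. norm (?f p)) summable_on Sigma UNIV (\<lambda>n. {..n})"
    unfolding Infinite_Sum.abs_summable_on_Sigma_iff by (simp add: sum_nonneg summable_on_finite)
  then have "?f summable_on Sigma UNIV (\<lambda>n. {..n})" by (rule abs_summable_summable)
  then have "(?f has_sum S) (Sigma UNIV (\<lambda>n. {..n}))"
    using sum by (intro has_sum_SigmaI[where g = "\<lambda>n. \<Sum>i\<le>n. e i (n - i) * (x ^ i * y ^ (n - i))"])
                 (auto intro!: has_sum_finiteI sum.cong)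
  moreover have bij: "bij_betw (\<lambda>(n, i). (i, n - i)) (Sigma UNIV (\<lambda>n. {..n})) (UNIV :: (nat \<times> nat) set)"
    by (rule bij_betw_byWitness[where f' = "\<lambda>(i, j). (i + j, i)"]) auto
  ultimately show ?thesis
    by (subst has_sum_reindex_bij_betw[OF bij, symmetric]) (simp add: case_prod_unfold)
qed

section \<open>Derivatives of power series in two variables\<close>

definition power_series2 :: "(nat \<Rightarrow> nat \<Rightarrow> real) \<Rightarrow> (complex \<Rightarrow> real) \<Rightarrow> bool" where
  "power_series2 b h \<longleftrightarrow> (\<forall>w. ((\<lambda>(i, j). b i j * Re w ^ i * Im w ^ j) has_sum h w) UNIV)"

text \<open>Absorbs the factor created by differentiation into a larger base.\<close>

lemma Suc_times_power_le:
  fixes x :: real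
  assumes "x \<ge> 0"
  shows "real (Suc n) * x ^ n \<le> (x + 1) ^ Suc n"
proof (induction n)
  case (Suc n)
  have "real (Suc (Suc n)) * x ^ Suc n = x * (real (Suc n) * x ^ n) + x ^ Suc n"
    by (simp add: algebra_simps)
  also have "\<dots> \<le> x * (x + 1) ^ Suc n + (x + 1) ^ Suc n"
    using Suc assms by (intro add_mono mult_left_mono power_mono) auto
  finally show ?case by (simp add: algebra_simps)
qed (use assms in simp)

text \<open>For fixed second coordinate \<open>h\<close> is an everywhere convergent power series in
  the first one, with coefficients \<open>c i\<close>, and can be differentiated termwise.\<close>

lemma power_series2_pd_1:
  assumes h: "power_series2 b h"
  shows "power_series2 (\<lambda>i j. real (Suc i) * b (Suc i) j) (pd 1 h)"
  unfolding power_series2_def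
proof
  fix w :: complex
  define x y where "x = Re w" and "y = Im w"
  have H: "((\<lambda>(i, j). b i j * s ^ i * y ^ j) has_sum h (Complex s y)) (Sigma UNIV (\<lambda>_. UNIV))" for s
    using h[unfolded power_series2_def, rule_format, of "Complex s y"] by simp
  define c where "c i = infsum (\<lambda>j. b i j * y ^ j) UNIV" for i
  have inner: "((\<lambda>j. b i j * y ^ j) has_sum c i) UNIV" for i
  proof -
    have "(\<lambda>(i, j). b i j * y ^ j) summable_on Sigma UNIV (\<lambda>_. UNIV)"
      using H[of 1] by (auto simp: summable_on_def)
    then have "(\<lambda>j. b i j * y ^ j) summable_on UNIV" by (rule summable_on_SigmaD1) simp
    then show ?thesis by (simp add: c_def)
  qed
  have cs: "(\<lambda>i. c i * s ^ i) sums h (Complex s y)" for s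
  proof (intro has_sum_imp_sums has_sum_SigmaD[OF H[of s]])
    show "((\<lambda>j. case (i, j) of (i, j) \<Rightarrow> b i j * s ^ i * y ^ j) has_sum c i * s ^ i) UNIV" for i
      using has_sum_cmult_left[OF inner[of i], of "s ^ i"] by (simp add: mult_ac)
  qed
  have "((\<lambda>s. \<Sum>i. c i * s ^ i) has_field_derivative (\<Sum>i. diffs c i * x ^ i)) (at x)"
    using cs by (intro termdiffs_strong_converges_everywhere) (auto simp: sums_iff)
  then have der: "((\<lambda>s. h (Complex s y)) has_field_derivative (\<Sum>i. diffs c i * x ^ i)) (at x)"
    using cs by (simp add: sums_iff)
  have "((\<lambda>t. h (Complex (x + t) y)) has_field_derivative (\<Sum>i. diffs c i * x ^ i)) (at 0)"
    using der DERIV_shift[of "\<lambda>s. h (Complex s y)" _ 0 x] by (simp add: add.commute)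
  moreover have "w + complex_of_real t * 1 = Complex (x + t) y" for t
    by (simp add: complex_eq_iff x_def y_def)
  ultimately have pd: "pd 1 h w = (\<Sum>i. diffs c i * x ^ i)"
    unfolding pd_def by (simp add: DERIV_imp_deriv)
  define F where "F = (\<lambda>(i, j). real (Suc i) * b (Suc i) j * x ^ i * y ^ j)"
  \<comment> \<open>The differentiated double series is dominated by the shifted terms of the
    original series at first coordinate \<open>abs x + 1\<close>.\<close>
  have "F summable_on UNIV"
  proof (rule abs_summable_summable, rule summable_on_comparison_test)
    have "(\<lambda>(i, j). b i j * (\<bar>x\<bar> + 1) ^ i * y ^ j) summable_on UNIV"
      using H[of "\<bar>x\<bar> + 1"] by (auto simp: summable_on_def)
    then have "(\<lambda>(i, j). \<bar>b i j * (\<bar>x\<bar> + 1) ^ i * y ^ j\<bar>) summable_on UNIV"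
      by (subst (asm) summable_on_iff_abs_summable_on_real) (simp add: case_prod_unfold)
    then have "(\<lambda>(i, j). \<bar>b i j * (\<bar>x\<bar> + 1) ^ i * y ^ j\<bar>) summable_on range (\<lambda>(i, j). (Suc i, j))"
      by (rule summable_on_subset) simp
    moreover have "inj (\<lambda>(i, j :: nat). (Suc i, j))" by (auto simp: inj_def)
    ultimately show "(\<lambda>(i, j). \<bar>b (Suc i) j * (\<bar>x\<bar> + 1) ^ Suc i * y ^ j\<bar>) summable_on UNIV"
      by (subst (asm) summable_on_reindex) (auto simp: comp_def case_prod_unfold)
    fix p :: "nat \<times> nat"
    obtain i j where p: "p = (i, j)" by force
    have "norm (F p) = (real (Suc i) * \<bar>x\<bar> ^ i) * (\<bar>b (Suc i) j\<bar> * \<bar>y\<bar> ^ j)"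
      unfolding p F_def by (simp add: abs_mult power_abs mult_ac)
    also have "\<dots> \<le> (\<bar>x\<bar> + 1) ^ Suc i * (\<bar>b (Suc i) j\<bar> * \<bar>y\<bar> ^ j)"
      by (intro mult_right_mono Suc_times_power_le) auto
    also have "\<dots> = (case p of (i, j) \<Rightarrow> \<bar>b (Suc i) j * (\<bar>x\<bar> + 1) ^ Suc i * y ^ j\<bar>)"
      unfolding p by (simp add: abs_mult power_abs mult_ac)
    finally show "norm (F p) \<le> (case p of (i, j) \<Rightarrow> \<bar>b (Suc i) j * (\<bar>x\<bar> + 1) ^ Suc i * y ^ j\<bar>)" .
  qed simp
  then have FS: "(F has_sum infsum F UNIV) (Sigma UNIV (\<lambda>_. UNIV))" by simp
  have "(\<lambda>i. diffs c i * x ^ i) sums infsum F UNIV"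
  proof (intro has_sum_imp_sums has_sum_SigmaD[OF FS])
    show "((\<lambda>j. F (i, j)) has_sum diffs c i * x ^ i) UNIV" for i
      using has_sum_cmult_left[OF inner[of "Suc i"], of "real (Suc i) * x ^ i"]
      by (simp add: F_def diffs_def mult_ac)
  qed
  then show "((\<lambda>(i, j). real (Suc i) * b (Suc i) j * Re w ^ i * Im w ^ j) has_sum pd 1 h w) UNIV"
    using FS unfolding pd F_def x_def y_def by (simp add: sums_iff)
qed

lemma power_series2_swap:
  assumes "power_series2 b h"
  shows "power_series2 (\<lambda>i j. b j i) (\<lambda>w. h (Complex (Im w) (Re w)))"
  unfolding power_series2_def
proof
  fix w
  have bij: "bij_betw prod.swap (UNIV :: (nat \<times> nat) set) UNIV" by simp
  show "((\<lambda>(i, j). b j i * Re w ^ i * Im w ^ j) has_sum h (Complex (Im w) (Re w))) UNIV"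
    using assms[unfolded power_series2_def, rule_format, of "Complex (Im w) (Re w)"]
    by (subst has_sum_reindex_bij_betw[OF bij, symmetric]) (simp add: case_prod_unfold mult_ac)
qed

lemma power_series2_pd_ii:
  assumes h: "power_series2 b h"
  shows "power_series2 (\<lambda>i j. real (Suc j) * b i (Suc j)) (pd \<i> h)"
proof -
  have "pd \<i> h = (\<lambda>w. pd 1 (\<lambda>w. h (Complex (Im w) (Re w))) (Complex (Im w) (Re w)))"
  proof
    fix w
    have "w + complex_of_real t * \<i> = Complex (Re w) (Im w + t)" for t by (simp add: complex_eq_iff)
    then show "pd \<i> h w = pd 1 (\<lambda>w. h (Complex (Im w) (Re w))) (Complex (Im w) (Re w))"
      unfolding pd_def by simp
  qed
  then show ?thesis
    using power_series2_swap[OF power_series2_pd_1[OF power_series2_swap[OF h]]] by simp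
qed

lemma power_series2_iterated_pd_ii:
  assumes "power_series2 b h"
  shows "power_series2 (\<lambda>p q. fact (q + j) / fact q * b p (q + j)) ((pd \<i> ^^ j) h)"
proof (induction j)
  case (Suc j)
  have "(\<lambda>p q. real (Suc q) * (fact (Suc q + j) / fact (Suc q) * b p (Suc q + j)))
      = (\<lambda>p q. fact (q + Suc j) / fact q * b p (q + Suc j))"
    by (intro ext) (simp add: field_simps del: of_nat_Suc)
  with power_series2_pd_ii[OF Suc] show ?case by simp
qed (use assms in simp)

lemma power_series2_iterated_pd_1:
  assumes "power_series2 b h"
  shows "power_series2 (\<lambda>p q. fact (p + i) / fact p * b (p + i) q) ((pd 1 ^^ i) h)"
proof (induction i)
  case (Suc i)
  have "(\<lambda>p q. real (Suc p) * (fact (Suc p + i) / fact (Suc p) * b (Suc p + i) q))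
      = (\<lambda>p q. fact (p + Suc i) / fact p * b (p + Suc i) q)"
    by (intro ext) (simp add: field_simps del: of_nat_Suc)
  with power_series2_pd_1[OF Suc] show ?case by simp
qed (use assms in simp)

text \<open>At 0 only the constant term of the differentiated series survives, with
  \<open>0 ^ 0 = 1\<close>.\<close>

lemma iterated_pd_at_0:
  assumes "power_series2 b h"
  shows "((pd 1 ^^ i) ((pd \<i> ^^ j) h)) 0 = fact i * fact j * b i j"
proof -
  let ?b = "\<lambda>p q. fact (p + i) / fact p * (fact (q + j) / fact q * b (p + i) (q + j))"
  have "((\<lambda>(p, q). ?b p q * 0 ^ p * 0 ^ q) has_sum ((pd 1 ^^ i) ((pd \<i> ^^ j) h)) 0) UNIV"
    using power_series2_iterated_pd_1[OF power_series2_iterated_pd_ii[OF assms], of i j, unfolded power_series2_def, rule_format, of 0] by simp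
  moreover have "((\<lambda>(p, q). ?b p q * 0 ^ p * 0 ^ q) has_sum ?b 0 0) UNIV"
  proof -
    have "((\<lambda>(p, q). ?b p q * 0 ^ p * 0 ^ q) has_sum ?b 0 0) {(0, 0)}"
      by (rule has_sum_finiteI) auto
    then show ?thesis by (rule has_sum_cong_neutral[THEN iffD1, rotated -1]) (auto simp: power_0_left split: if_splits)
  qed
  ultimately have "((pd 1 ^^ i) ((pd \<i> ^^ j) h)) 0 = ?b 0 0" by (rule has_sum_unique)
  then show ?thesis by simp
qed

theorem hfun_power_series:
  assumes k: "k \<ge> 1" and g: "g > 0"
  obtains e where "\<And>i j. uv_poly (e i j)"
    "\<And>n z w u v. hom_part k g n z w u v = (\<Sum>i\<le>n. e i (n - i) z u v * (Re w ^ i * Im w ^ (n - i)))"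
    "\<And>z u v. \<bar>u\<bar> \<le> 1 \<Longrightarrow> \<bar>v\<bar> \<le> 1 \<Longrightarrow> power_series2 (\<lambda>i j. e i j z u v) (\<lambda>w. hfun k g z w u v)"
proof (rule hom_part_coeffs[OF k g])
  fix e
  assume e: "\<And>i j. uv_poly (e i j)"
    "\<And>n z w u v. hom_part k g n z w u v = (\<Sum>i\<le>n. e i (n - i) z u v * (Re w ^ i * Im w ^ (n - i)))"
    "\<And>z. \<exists>R\<ge>0. \<forall>n u v. \<bar>u\<bar> \<le> 1 \<longrightarrow> \<bar>v\<bar> \<le> 1 \<longrightarrow>
       (\<Sum>i\<le>n. \<bar>e i (n - i) z u v\<bar>) \<le> (real n + 1) * R ^ n / fact n"
  show ?thesis
  proof (rule that[of e])
    fix u v :: real and z :: complex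
    assume uv: "\<bar>u\<bar> \<le> 1" "\<bar>v\<bar> \<le> 1"
    from e(3)[of z] obtain R where R: "R \<ge> 0"
      "\<forall>n u v. \<bar>u\<bar> \<le> 1 \<longrightarrow> \<bar>v\<bar> \<le> 1 \<longrightarrow> (\<Sum>i\<le>n. \<bar>e i (n - i) z u v\<bar>) \<le> (real n + 1) * R ^ n / fact n"
      by (elim exE conjE)
    show "power_series2 (\<lambda>i j. e i j z u v) (\<lambda>w. hfun k g z w u v)"
      unfolding power_series2_def
      by (intro allI power_series_from_homogeneous[OF _ R(1)])
         (use hfun_has_sum[OF k g uv] R(2) uv in \<open>auto simp: e(2)[symmetric]\<close>)
  qed (fact e)+
qed

lemma Pfun_eq:
  assumes "power_series2 b (\<lambda>w. hfun k g z w u v)"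
  shows "Pfun c N k g z u v = (\<Sum>i\<le>N. \<Sum>j\<le>N. c i j * (fact i * fact j * b i j))"
  unfolding Pfun_def iterated_pd_at_0[OF assms] ..

section \<open>Integration against the ultraspherical measure\<close>

definition nu_int :: "real \<Rightarrow> (real \<Rightarrow> real) \<Rightarrow> real" where
  "nu_int a f = (LBINT u:{-1..1}. f u * nu_dens a u)"

lemma Gamma_duplication_real:
  assumes "a > (0::real)"
  shows "Gamma a * Gamma (a + 1/2) = 2 powr (1 - 2 * a) * sqrt pi * Gamma (2 * a)"
proof -
  have "complex_of_real a \<notin> \<int>\<^sub>\<le>\<^sub>0" "complex_of_real a + 1 / 2 \<notin> \<int>\<^sub>\<le>\<^sub>0"
    using assms by (auto elim!: nonpos_Ints_cases simp: complex_eq_iff)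
  from Gamma_legendre_duplication[OF this]
  have "complex_of_real (Gamma a * Gamma (a + 1/2)) = complex_of_real (exp ((1 - 2 * a) * ln 2) * sqrt pi * Gamma (2 * a))"
    by (simp flip: Gamma_complex_of_real exp_of_real)
  then show ?thesis unfolding of_real_eq_iff by (simp add: powr_def)
qed

text \<open>The substitution \<open>t = (1 + u) / 2\<close> in the Beta integral, where
  \<open>4 t (1 - t) = 1 - u^2\<close>.\<close>

lemma has_integral_one_minus_square_powr:
  assumes a: "a > (0::real)"
  shows "((\<lambda>u. (1 - u\<^sup>2) powr (a - 1)) has_integral (2 * 4 powr (a - 1) * Beta a a)) {-1..1}"
proof -
  let ?g = "\<lambda>t::real. t powr (a - 1) * (1 - t) powr (a - 1)"
  have "(?g has_integral Beta a a) (cbox 0 1)"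
    using has_integral_Beta_real[OF a a] by simp
  from has_integral_affinity[OF this, of "1/2" "1/2"]
  have "((\<lambda>u. ?g (1 / 2 * u + 1 / 2)) has_integral 2 * Beta a a) ((\<lambda>x. 2 * x - 1) ` {0..1})"
    by simp
  moreover have "(\<lambda>x. 2 * x - 1) ` {0..1} = {-1..1::real}"
    using image_affinity_atLeastAtMost_diff[of 2 1 0 "1::real"] by simp
  ultimately have "((\<lambda>u. 4 powr (a - 1) * ?g (1 / 2 * u + 1 / 2)) has_integral 4 powr (a - 1) * (2 * Beta a a)) {-1..1}"
    by (intro has_integral_mult_right) simp
  moreover have "4 powr (a - 1) * ?g (1 / 2 * u + 1 / 2) = (1 - u\<^sup>2) powr (a - 1)" if "u \<in> {-1..1}" for u
  proof -
    have "4 powr (a - 1) * ?g (1 / 2 * u + 1 / 2) = (4 * ((1 / 2 * u + 1 / 2) * (1 - (1 / 2 * u + 1 / 2)))) powr (a - 1)"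
      using that by (simp add: powr_mult)
    also have "4 * ((1 / 2 * u + 1 / 2) * (1 - (1 / 2 * u + 1 / 2))) = 1 - u\<^sup>2"
      by (simp add: power2_eq_square field_simps)
    finally show ?thesis .
  qed
  ultimately have "((\<lambda>u. (1 - u\<^sup>2) powr (a - 1)) has_integral 4 powr (a - 1) * (2 * Beta a a)) {-1..1}"
    by (rule has_integral_eq[rotated])
  then show ?thesis by (simp add: mult_ac)
qed

text \<open>By Legendre duplication the constant of the density is the reciprocal of the Beta
  integral.\<close>

lemma nu_dens_has_integral:
  assumes a: "a > 0"
  shows "(nu_dens a has_integral 1) {-1..1}"
proof -
  let ?c = "Gamma (a + 1/2) / (sqrt pi * Gamma a)"
  have pos: "Gamma a > 0" "Gamma (2 * a) > 0" using a by (auto intro: Gamma_real_pos)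
  have "?c * (2 * 4 powr (a - 1) * Beta a a)
      = (Gamma a * Gamma (a + 1/2)) * (2 * 4 powr (a - 1)) / (sqrt pi * Gamma (2 * a))"
    using pos by (simp add: Beta_def field_simps)
  also have "\<dots> = 2 powr (1 - 2 * a) * (2 * 4 powr (a - 1))"
    unfolding Gamma_duplication_real[OF a] using pos by simp
  also have "\<dots> = 1"
  proof -
    have "(4::real) powr (a - 1) = 2 powr (2 * (a - 1))"
      using powr_powr[of 2 2 "a - 1"] by simp
    then have "2 powr (1 - 2 * a) * (2 * 4 powr (a - 1)) = 2 powr (1 - 2 * a) * (2 powr 1 * 2 powr (2 * (a - 1)))"
      by simp
    also have "\<dots> = 2 powr ((1 - 2 * a) + (1 + 2 * (a - 1)))" by (simp only: powr_add)
    also have "\<dots> = 1" by simp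
    finally show ?thesis .
  qed
  finally have "?c * (2 * 4 powr (a - 1) * Beta a a) = 1" .
  with has_integral_mult_right[OF has_integral_one_minus_square_powr[OF a], of ?c]
  show ?thesis unfolding nu_dens_def[abs_def] by (simp only:)
qed

lemma nu_dens_nonneg: "a > 0 \<Longrightarrow> nu_dens a u \<ge> 0"
  unfolding nu_dens_def by (intro mult_nonneg_nonneg divide_nonneg_nonneg) (auto intro: Gamma_real_nonneg)

lemma nu_dens_measurable [measurable]: "nu_dens a \<in> borel_measurable borel"
  unfolding nu_dens_def[abs_def] by measurable

lemma nu_dens_set_integrable:
  assumes a: "a > 0"
  shows "set_integrable lborel {-1..1} (nu_dens a)"
proof -
  have "nu_dens a absolutely_integrable_on {-1..1}"
    using nu_dens_has_integral[OF a] nu_dens_nonneg[OF a]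
    by (intro nonnegative_absolutely_integrable_1) auto
  then show ?thesis
    unfolding set_integrable_def by (subst (asm) integrable_completion) auto
qed

lemma nu_set_integrable:
  assumes a: "a > 0" and f: "continuous_on UNIV f"
  shows "set_integrable lborel {-1..1} (\<lambda>u. f u * nu_dens a u)"
proof -
  have [measurable]: "f \<in> borel_measurable borel" using f by (rule borel_measurable_continuous_onI)
  have "bounded (f ` {-1..1})"
    using continuous_on_subset[OF f] by (intro compact_imp_bounded compact_continuous_image) simp_all
  then obtain K where K: "\<forall>u\<in>{-1..1}. \<bar>f u\<bar> \<le> K" by (auto simp: bounded_iff)
  show ?thesis
  proof (rule set_integrable_bound)
    show "set_integrable lborel {-1..1} (\<lambda>u. K * nu_dens a u)"
      using nu_dens_set_integrable[OF a] by simp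
    show "set_borel_measurable lborel {-1..1} (\<lambda>u. f u * nu_dens a u)"
      unfolding set_borel_measurable_def by measurable
    show "AE u in lborel. u \<in> {-1..1} \<longrightarrow> norm (f u * nu_dens a u) \<le> norm (K * nu_dens a u)"
    proof (intro AE_I2 impI)
      fix u :: real assume "u \<in> {-1..1}"
      then have "\<bar>f u\<bar> \<le> \<bar>K\<bar>" using K by force
      then show "norm (f u * nu_dens a u) \<le> norm (K * nu_dens a u)"
        by (simp add: abs_mult mult_right_mono)
    qed
  qed
qed

lemma nu_int_eq_integral:
  assumes "a > 0" "continuous_on UNIV f"
  shows "nu_int a f = integral {-1..1} (\<lambda>u. f u * nu_dens a u)"
    and "(\<lambda>u. f u * nu_dens a u) integrable_on {-1..1}"
  unfolding nu_int_def using set_borel_integral_eq_integral[OF nu_set_integrable[OF assms]] by auto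

lemma nu_int_one: "a > 0 \<Longrightarrow> nu_int a (\<lambda>_. 1) = 1"
  using nu_int_eq_integral(1)[of a "\<lambda>_. 1"] nu_dens_has_integral[of a] by (simp add: integral_unique)

lemma nu_int_add:
  assumes "a > 0" "continuous_on UNIV f" "continuous_on UNIV g"
  shows "nu_int a (\<lambda>u. f u + g u) = nu_int a f + nu_int a g"
  unfolding nu_int_def distrib_right
  using nu_set_integrable[OF assms(1,2)] nu_set_integrable[OF assms(1,3)] by (rule set_integral_add)

lemma nu_int_cmult: "nu_int a (\<lambda>u. c * f u) = c * nu_int a f"
  unfolding nu_int_def mult.assoc by simp

lemma nu_int_reflect:
  assumes "a > 0" "continuous_on UNIV f"
  shows "nu_int a (\<lambda>u. f (- u)) = nu_int a f"
proof -
  have cont: "continuous_on UNIV (\<lambda>u. f (- u))"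
    by (rule continuous_on_compose2[OF assms(2)]) (simp_all add: continuous_on_minus)
  have "nu_dens a u = nu_dens a (- u)" for u by (simp add: nu_dens_def)
  then have "nu_int a (\<lambda>u. f (- u)) = integral {-1..1} (\<lambda>u. f (- u) * nu_dens a (- u))"
    unfolding nu_int_eq_integral(1)[OF assms(1) cont] by simp
  also have "\<dots> = integral {-1..1} (\<lambda>u. f u * nu_dens a u)"
    using Henstock_Kurzweil_Integration.integral_reflect_real[of 1 "-1" "\<lambda>u. f u * nu_dens a u"] by simp
  finally show ?thesis unfolding nu_int_eq_integral(1)[OF assms] .
qed

text \<open>Up to the constant of the density, the integrand is the derivative of
  \<open>(1 - u^2)^a f\<close>, which vanishes at both end points as \<open>a > 0\<close>. For
  \<open>a < 1\<close> the power is not differentiable there, so the fundamental theorem is applied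
  with interior derivatives.\<close>

lemma nu_int_by_parts:
  assumes a: "a > 0" and f: "\<And>u. (f has_real_derivative f' u) (at u)" and f': "continuous_on UNIV f'"
  shows "nu_int a (\<lambda>u. (1 - u\<^sup>2) * f' u - 2 * a * u * f u) = 0"
proof -
  let ?c = "Gamma (a + 1/2) / (sqrt pi * Gamma a)"
  let ?g = "\<lambda>u. (1 - u\<^sup>2) * f' u - 2 * a * u * f u"
  let ?F = "\<lambda>u. ?c * ((1 - u\<^sup>2) powr a * f u)"
  have f_cont: "continuous_on A f" for A
    by (intro continuous_at_imp_continuous_on ballI DERIV_isCont[OF f])
  have g_cont: "continuous_on UNIV ?g"
    by (intro continuous_intros f' f_cont)
  have "((\<lambda>u. ?g u * nu_dens a u) has_integral (?F 1 - ?F (-1))) {-1..1}"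
  proof (rule fundamental_theorem_of_calculus_interior)
    have "continuous_on {-1..1} (\<lambda>u::real. (1 - u\<^sup>2) powr a)"
    proof (rule continuous_on_powr')
      show "\<forall>u\<in>{-1..1::real}. 0 \<le> 1 - u\<^sup>2 \<and> (1 - u\<^sup>2 = 0 \<longrightarrow> 0 < a)"
        using a by (simp add: abs_square_le_1 abs_le_iff)
    qed (intro continuous_intros)+
    then show "continuous_on {-1..1} ?F" by (intro continuous_on_mult continuous_on_const f_cont)
    fix u :: real assume u: "u \<in> {-1<..<1}"
    then have pos: "1 - u\<^sup>2 > 0" by (simp add: abs_square_less_1 abs_less_iff)
    then have eq: "(1 - u\<^sup>2) powr a = (1 - u\<^sup>2) powr (a - 1) * (1 - u\<^sup>2)"
      using powr_mult_base[of "1 - u\<^sup>2" "a - 1"] by (simp add: mult.commute)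
    have "((\<lambda>u. (1 - u\<^sup>2) powr a) has_real_derivative (a * (1 - u\<^sup>2) powr (a - 1) * (- 2 * u))) (at u)"
      using pos by (auto intro!: derivative_eq_intros simp: powr_diff field_simps)
    then have "(?F has_real_derivative ?c * ((a * (1 - u\<^sup>2) powr (a - 1) * (- 2 * u)) * f u + f' u * (1 - u\<^sup>2) powr a)) (at u)"
      by (intro DERIV_cmult DERIV_mult f)
    also have "?c * ((a * (1 - u\<^sup>2) powr (a - 1) * (- 2 * u)) * f u + f' u * (1 - u\<^sup>2) powr a) = ?g u * nu_dens a u"
    proof -
      have "c * (a * p * (- 2 * u) * F + F' * (p * (1 - u\<^sup>2))) = ((1 - u\<^sup>2) * F' - 2 * a * u * F) * (c * p)"
        for c p F F' :: real by (simp add: algebra_simps)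
      then show ?thesis unfolding eq nu_dens_def .
    qed
    finally show "(?F has_vector_derivative ?g u * nu_dens a u) (at u)"
      by (simp add: has_real_derivative_iff_has_vector_derivative)
  qed simp
  then show ?thesis
    unfolding nu_int_eq_integral(1)[OF a g_cont] using a by (simp add: integral_unique)
qed

section \<open>Polynomial integrands in \<open>u, v\<close> and iterated integrals\<close>

abbreviation uv_fun :: "(real \<Rightarrow> real \<Rightarrow> real) \<Rightarrow> bool" where
  "uv_fun f \<equiv> uv_poly (\<lambda>_. f)"

lemma uv_fun_continuous:
  assumes "uv_fun f"
  shows "continuous_on UNIV (\<lambda>u. f u v)" "continuous_on UNIV (\<lambda>v. f u v)"
proof -
  have "continuous_on UNIV (\<lambda>u. e z u v) \<and> continuous_on UNIV (\<lambda>v. e z u v)" if "uv_poly e" for e z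
    using that
  proof induction
    case (mono c p q)
    show ?case by (intro conjI continuous_intros)
  next
    case (add e f)
    then show ?case by (intro conjI continuous_on_add) simp_all
  qed
  then show "continuous_on UNIV (\<lambda>u. f u v)" "continuous_on UNIV (\<lambda>v. f u v)"
    using assms by blast+
qed

text \<open>The rules of \<open>uv_poly\<close> concern families in \<open>z\<close>; proving the
  property for every member \<open>e z\<close> gives an induction rule for single functions.\<close>

lemma uv_poly_induct_fun [consumes 1, case_names mono add]:
  assumes "uv_fun f"
    and "\<And>c p q. P (\<lambda>u v. c * u ^ p * v ^ q)"
    and "\<And>f g. uv_fun f \<Longrightarrow> uv_fun g \<Longrightarrow> P f \<Longrightarrow> P g \<Longrightarrow> P (\<lambda>u v. f u v + g u v)"
  shows "P f"
proof -
  have "P (e z)" if "uv_poly e" for e and z :: complex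
    using that
  proof induction
    case (mono c p q)
    show ?case using assms(2)[of "c z"] by simp
  next
    case (add e f)
    show ?case using assms(3)[OF uv_poly_freeze[OF add.hyps(1)] uv_poly_freeze[OF add.hyps(2)] add.IH] by simp
  qed
  from this[OF assms(1)] show ?thesis .
qed

definition nu_int2 :: "real \<Rightarrow> real \<Rightarrow> (real \<Rightarrow> real \<Rightarrow> real) \<Rightarrow> real" where
  "nu_int2 a b f = nu_int b (\<lambda>v. nu_int a (\<lambda>u. f u v))"

context
  fixes a b :: real
  assumes ab: "a > 0" "b > 0"
begin

text \<open>Provides the continuity of the outer integrand that the rules for \<open>nu_int\<close>
  require.\<close>

lemma nu_int_partial_continuous:
  "uv_fun f \<Longrightarrow> continuous_on UNIV (\<lambda>v. nu_int a (\<lambda>u. f u v))"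
proof (induction rule: uv_poly_induct_fun)
  case (mono c p q)
  have "(\<lambda>v. nu_int a (\<lambda>u. c * u ^ p * v ^ q)) = (\<lambda>v. c * v ^ q * nu_int a (\<lambda>u. u ^ p))"
    by (rule ext) (simp flip: nu_int_cmult add: mult_ac)
  then show ?case by (simp only:) (intro continuous_intros)
next
  case (add f g)
  then show ?case
    by (simp only: nu_int_add[OF ab(1)] uv_fun_continuous(1)) (intro continuous_intros)
qed

lemma nu_int2_add: "uv_fun f \<Longrightarrow> uv_fun g \<Longrightarrow> nu_int2 a b (\<lambda>u v. f u v + g u v) = nu_int2 a b f + nu_int2 a b g"
  unfolding nu_int2_def
  by (simp only: nu_int_add[OF ab(1)] nu_int_add[OF ab(2)] uv_fun_continuous(1) nu_int_partial_continuous)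

lemma nu_int2_cmult: "nu_int2 a b (\<lambda>u v. c * f u v) = c * nu_int2 a b f"
  unfolding nu_int2_def nu_int_cmult ..

lemma nu_int2_one: "nu_int2 a b (\<lambda>u v. 1) = 1"
  unfolding nu_int2_def by (simp add: nu_int_one ab)

lemma nu_int2_by_parts_u:
  assumes f': "uv_fun f'" and der: "\<And>u v. ((\<lambda>u. f u v) has_real_derivative f' u v) (at u)"
  shows "nu_int2 a b (\<lambda>u v. (1 - u\<^sup>2) * f' u v - 2 * a * u * f u v) = 0"
proof -
  have "nu_int a (\<lambda>u. (1 - u\<^sup>2) * f' u v - 2 * a * u * f u v) = 0" for v
    by (intro nu_int_by_parts ab der uv_fun_continuous f')
  then show ?thesis using nu_int_cmult[of b 0 "\<lambda>_. 0"] unfolding nu_int2_def by simp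
qed

lemma nu_int2_reflect:
  assumes "uv_fun f"
  shows "nu_int2 a b (\<lambda>u v. f (- u) v) = nu_int2 a b f" "nu_int2 a b (\<lambda>u v. f u (- v)) = nu_int2 a b f"
  unfolding nu_int2_def
  using nu_int_reflect[OF ab(1) uv_fun_continuous(1)[OF assms]]
    nu_int_reflect[OF ab(2) nu_int_partial_continuous[OF assms]] by simp_all

end

lemma uv_fun_swap: "uv_fun f \<Longrightarrow> uv_fun (\<lambda>u v. f v u)"
proof (induction rule: uv_poly_induct_fun)
  case (mono c p q)
  show ?case using uv_poly.mono[of "\<lambda>_. c" q p] by (simp add: mult_ac)
next
  case (add f g)
  then show ?case by (intro uv_poly.add)
qed

text \<open>Fubini for polynomials: both sides are additive, and on monomials the double integral
  factors.\<close>

lemma nu_int2_swap: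
  assumes ab: "a > 0" "b > 0" and "uv_fun f"
  shows "nu_int2 a b f = nu_int2 b a (\<lambda>u v. f v u)"
  using assms(3)
proof (induction rule: uv_poly_induct_fun)
  case (mono c p q)
  have "nu_int2 a b (\<lambda>u v. c * u ^ p * v ^ q) = c * (nu_int a (\<lambda>u. u ^ p) * nu_int b (\<lambda>v. v ^ q))" for a b p q
  proof -
    have "nu_int2 a b (\<lambda>u v. c * u ^ p * v ^ q) = nu_int b (\<lambda>v. (c * nu_int a (\<lambda>u. u ^ p)) * v ^ q)"
      unfolding nu_int2_def
    proof (rule arg_cong[where f = "nu_int b"], rule ext)
      fix v
      show "nu_int a (\<lambda>u. c * u ^ p * v ^ q) = c * nu_int a (\<lambda>u. u ^ p) * v ^ q"
        using nu_int_cmult[of a "c * v ^ q" "\<lambda>u. u ^ p"] by (simp add: mult_ac)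
    qed
    then show ?thesis by (simp only: nu_int_cmult mult.assoc)
  qed
  note this[of a b p q] this[of b a q p]
  then show ?case by (simp add: mult_ac)
next
  case (add f g)
  then show ?case
    by (simp add: nu_int2_add ab uv_fun_swap)
qed

lemma nu_int2_by_parts_v:
  assumes ab: "a > 0" "b > 0" and f: "uv_fun f" "uv_fun f'"
    and der: "\<And>u v. ((\<lambda>v. f u v) has_real_derivative f' u v) (at v)"
  shows "nu_int2 a b (\<lambda>u v. (1 - v\<^sup>2) * f' u v - 2 * b * v * f u v) = 0"
proof -
  have v: "uv_fun (\<lambda>u v. v)" "uv_fun (\<lambda>u v. c)" for c :: real
    using uv_poly.mono[of "\<lambda>_. 1" 0 1] uv_poly.mono[of "\<lambda>_. c" 0 0] by simp_all
  have "uv_fun (\<lambda>u v. (1 + (-1) * (v * v)) * f' u v + (- 2 * b) * (v * f u v))"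
    by (intro uv_poly.add uv_poly_mult v f)
  then have "uv_fun (\<lambda>u v. (1 - v\<^sup>2) * f' u v - 2 * b * v * f u v)"
    by (simp add: power2_eq_square mult_ac)
  from nu_int2_swap[OF ab this] show ?thesis
    using nu_int2_by_parts_u[OF ab(2,1) uv_fun_swap[OF f(2)], of "\<lambda>u v. f v u"] der by simp
qed

section \<open>Integrating formal power series in a parameter\<close>

definition fps_has_deriv :: "(real \<Rightarrow> real fps) \<Rightarrow> real fps \<Rightarrow> real \<Rightarrow> bool" where
  "fps_has_deriv F F' x \<longleftrightarrow> (\<forall>m. ((\<lambda>u. F u $ m) has_real_derivative F' $ m) (at x))"

lemma fps_has_deriv_const: "fps_has_deriv (\<lambda>_. C) 0 x"
  by (simp add: fps_has_deriv_def)

lemma fps_has_deriv_mult: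
  assumes "fps_has_deriv F F' x" "fps_has_deriv G G' x"
  shows "fps_has_deriv (\<lambda>u. F u * G u) (F' * G x + F x * G') x"
  unfolding fps_has_deriv_def
proof
  fix m
  have "((\<lambda>u. \<Sum>i=0..m. F u $ i * G u $ (m - i)) has_real_derivative
      (\<Sum>i=0..m. F' $ i * G x $ (m - i) + G' $ (m - i) * F x $ i)) (at x)"
    using assms unfolding fps_has_deriv_def by (intro DERIV_sum DERIV_mult) auto
  then show "((\<lambda>u. (F u * G u) $ m) has_real_derivative (F' * G x + F x * G') $ m) (at x)"
    by (simp add: fps_mult_nth sum.distrib mult.commute[of "G' $ _"])
qed

lemma fps_has_deriv_power:
  assumes "fps_has_deriv F F' x"
  shows "fps_has_deriv (\<lambda>u. F u ^ n) (of_nat n * F x ^ (n - 1) * F') x"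
proof (induction n)
  case 0
  show ?case by (simp add: fps_has_deriv_const)
next
  case (Suc n)
  have "F' * F x ^ n + F x * (of_nat n * F x ^ (n - 1) * F') = of_nat (Suc n) * F x ^ n * F'"
    by (cases n) (simp_all add: algebra_simps)
  then show ?case using fps_has_deriv_mult[OF assms Suc] by simp
qed

text \<open>Since \<open>d^n\<close> starts at \<open>X^n\<close>, one truncation at
  \<open>n = m\<close> serves all coefficients up to \<open>m\<close>.\<close>

lemma fps_npow_times_nth:
  assumes "d $ 0 = 0"
  shows "(fps_npow g d * e) $ m = (\<Sum>n\<le>m. pochhammer g n / fact n * (d ^ n * e) $ m)"
proof -
  have npow: "fps_npow g d $ i = (\<Sum>n\<le>m. pochhammer g n / fact n * (d ^ n) $ i)" if "i \<le> m" for i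
    unfolding fps_npow_nth using that assms
    by (intro sum.mono_neutral_left) (auto simp: startsby_zero_power_prefix)
  have "(fps_npow g d * e) $ m = (\<Sum>i\<le>m. \<Sum>n\<le>m. pochhammer g n / fact n * ((d ^ n) $ i * e $ (m - i)))"
    by (simp add: fps_mult_nth atMost_atLeast0[symmetric] npow sum_distrib_right mult.assoc)
  also have "\<dots> = (\<Sum>n\<le>m. pochhammer g n / fact n * (d ^ n * e) $ m)"
    by (subst sum.swap) (simp add: fps_mult_nth atMost_atLeast0[symmetric] sum_distrib_left)
  finally show ?thesis .
qed

text \<open>The chain rule, by differentiating each coefficient as a finite sum; shifting
  \<open>n\<close> moves one factor \<open>g\<close> out of the Pochhammer symbol and raises its
  parameter.\<close>

lemma fps_has_deriv_npow:
  assumes der: "fps_has_deriv d d' x" and d0: "d x $ 0 = 0" and d'0: "d' $ 0 = 0"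
  shows "fps_has_deriv (\<lambda>u. fps_npow g (d u)) (fps_const g * fps_npow (g + 1) (d x) * d') x"
  unfolding fps_has_deriv_def
proof
  fix m
  have pow: "((\<lambda>u. (d u ^ n) $ m) has_real_derivative (of_nat n * d x ^ (n - 1) * d') $ m) (at x)" for n
    using fps_has_deriv_power[OF der, of n] by (simp add: fps_has_deriv_def)
  have "((\<lambda>u. fps_npow g (d u) $ m) has_real_derivative
      (\<Sum>n\<le>m. pochhammer g n / fact n * (of_nat n * d x ^ (n - 1) * d') $ m)) (at x)"
    unfolding fps_npow_nth by (intro DERIV_sum DERIV_cmult pow)
  also have "(\<Sum>n\<le>m. pochhammer g n / fact n * (of_nat n * d x ^ (n - 1) * d') $ m)
      = g * (fps_npow (g + 1) (d x) * d') $ m"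
  proof (cases m)
    case 0
    then show ?thesis using d'0 by simp
  next
    case (Suc m')
    have "(\<Sum>n\<le>m. pochhammer g n / fact n * (of_nat n * d x ^ (n - 1) * d') $ m)
        = (\<Sum>n\<le>m'. pochhammer g (Suc n) / fact (Suc n) * (of_nat (Suc n) * d x ^ n * d') $ m)"
      unfolding Suc by (subst sum.atMost_Suc_shift) simp
    also have "\<dots> = (\<Sum>n\<le>m'. g * (pochhammer (g + 1) n / fact n * (d x ^ n * d') $ m))"
    proof (intro sum.cong refl)
      fix n
      have "of_nat (Suc n) * d x ^ n * d' = fps_const (real (Suc n)) * (d x ^ n * d')"
        by (simp only: fps_of_nat mult.assoc)
      then have "(of_nat (Suc n) * d x ^ n * d') $ m = real (Suc n) * (d x ^ n * d') $ m"
        by (simp only: fps_mult_left_const_nth)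
      then show "pochhammer g (Suc n) / fact (Suc n) * (of_nat (Suc n) * d x ^ n * d') $ m
          = g * (pochhammer (g + 1) n / fact n * (d x ^ n * d') $ m)"
        by (simp add: pochhammer_rec del: of_nat_Suc)
    qed
    \<comment> \<open>The term \<open>n = m\<close> can be added because \<open>d^m d'\<close>
      starts beyond \<open>X^m\<close>.\<close>
    also have "\<dots> = (\<Sum>n\<le>m. g * (pochhammer (g + 1) n / fact n * (d x ^ n * d') $ m))"
    proof -
      have "(d x ^ m * d') $ m = 0"
        using startsby_zero_power_prefix[OF d0, of m] d'0
        by (auto simp: fps_mult_nth intro!: sum.neutral) (metis diff_self_eq_0 le_neq_implies_less)
      then show ?thesis by (simp add: Suc)
    qed
    finally show ?thesis by (simp add: fps_npow_times_nth[OF d0] sum_distrib_left)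
  qed
  finally show "((\<lambda>u. fps_npow g (d u) $ m) has_real_derivative (fps_const g * fps_npow (g + 1) (d x) * d') $ m) (at x)"
    by (simp add: mult.assoc)
qed

definition uv_fps :: "(real \<Rightarrow> real \<Rightarrow> real fps) \<Rightarrow> bool" where
  "uv_fps F \<longleftrightarrow> (\<forall>m. uv_fun (\<lambda>u v. F u v $ m))"

lemma uv_fun_const: "uv_fun (\<lambda>u v. c)"
  by (intro uv_poly_continuous continuous_on_const)

lemma uv_fun_u: "uv_fun (\<lambda>u v. u)" and uv_fun_v: "uv_fun (\<lambda>u v. v)"
  using uv_poly.mono[of "\<lambda>_. 1" 1 0] uv_poly.mono[of "\<lambda>_. 1" 0 1] by simp_all

lemma uv_fun_diff: "uv_fun f \<Longrightarrow> uv_fun g \<Longrightarrow> uv_fun (\<lambda>u v. f u v - g u v)"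
  using uv_poly.add[of "\<lambda>_. f" "\<lambda>_ u v. (-1) * g u v"] uv_poly_mult[OF uv_fun_const[of "-1"]] by simp

lemma uv_fun_minus: "uv_fun f \<Longrightarrow> uv_fun (\<lambda>u v. - f u v)"
  using uv_fun_diff[OF uv_fun_const[of 0]] by simp

lemmas uv_fun_intros = uv_fun_const uv_fun_u uv_fun_v uv_fun_diff uv_poly.add uv_poly_mult

lemma uv_fps_const: "uv_fps (\<lambda>u v. C)"
  by (simp add: uv_fps_def uv_fun_const)

lemma uv_fps_scalar: "uv_fun f \<Longrightarrow> uv_fps (\<lambda>u v. fps_const (f u v))"
  unfolding uv_fps_def
proof
  fix m assume "uv_fun f"
  then show "uv_fun (\<lambda>u v. fps_const (f u v) $ m)" using uv_fun_const[of 0] by (cases "m = 0") simp_all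
qed

lemma uv_fps_add: "uv_fps F \<Longrightarrow> uv_fps G \<Longrightarrow> uv_fps (\<lambda>u v. F u v + G u v)"
  by (simp add: uv_fps_def uv_poly.add)

lemma uv_fps_diff: "uv_fps F \<Longrightarrow> uv_fps G \<Longrightarrow> uv_fps (\<lambda>u v. F u v - G u v)"
  by (simp add: uv_fps_def uv_fun_diff)

lemma uv_fps_mult: "uv_fps F \<Longrightarrow> uv_fps G \<Longrightarrow> uv_fps (\<lambda>u v. F u v * G u v)"
  unfolding uv_fps_def fps_mult_nth by (intro allI uv_poly_sum uv_poly_mult) auto

lemma uv_fps_power: "uv_fps F \<Longrightarrow> uv_fps (\<lambda>u v. F u v ^ n)"
  by (induction n) (simp_all add: uv_fps_const uv_fps_mult)

lemma uv_fps_npow: "uv_fps F \<Longrightarrow> uv_fps (\<lambda>u v. fps_npow g (F u v))"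
  using uv_fps_power[of F] unfolding uv_fps_def fps_npow_nth
  by (intro allI uv_poly_sum uv_poly_mult uv_fun_const) auto

lemma uv_fps_dih: "uv_fps (dih_fps k z w)"
  unfolding dih_fps_def[abs_def]
  by (intro uv_fps_add uv_fps_mult uv_fps_const uv_fps_scalar uv_fun_intros)

lemmas uv_fps_intros = uv_fps_const uv_fps_scalar uv_fps_add uv_fps_diff uv_fps_mult uv_fps_npow
  uv_fps_dih uv_fun_intros

text \<open>Common frame for the double integral over \<open>u, v\<close> and for the single
  integral over \<open>u\<close> at \<open>v = 1\<close>, so that the recursion and the final
  argument are carried out once for both groups.\<close>

locale uv_functional =
  fixes I :: "(real \<Rightarrow> real \<Rightarrow> real) \<Rightarrow> real"
  assumes I_add: "uv_fun f \<Longrightarrow> uv_fun g \<Longrightarrow> I (\<lambda>u v. f u v + g u v) = I f + I g"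
    and I_cmult: "uv_fun f \<Longrightarrow> I (\<lambda>u v. c * f u v) = c * I f"
begin

lemma I_zero: "I (\<lambda>u v. 0) = 0"
  using I_cmult[OF uv_fun_const[of 0], of 0] by simp

lemma I_diff: "uv_fun f \<Longrightarrow> uv_fun g \<Longrightarrow> I (\<lambda>u v. f u v - g u v) = I f - I g"
  using I_add[of f "\<lambda>u v. (-1) * g u v"] I_cmult[of g "-1"] uv_poly_mult[OF uv_fun_const[of "-1"], of "\<lambda>_. g"]
  by simp

lemma I_sum: "finite S \<Longrightarrow> (\<And>s. s \<in> S \<Longrightarrow> uv_fun (f s)) \<Longrightarrow> I (\<lambda>u v. \<Sum>s\<in>S. f s u v) = (\<Sum>s\<in>S. I (f s))"
  by (induction S rule: finite_induct) (simp_all add: I_zero I_add uv_poly_sum)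

definition II :: "(real \<Rightarrow> real \<Rightarrow> real fps) \<Rightarrow> real fps" where
  "II F = Abs_fps (\<lambda>m. I (\<lambda>u v. F u v $ m))"

lemma II_nth [simp]: "II F $ m = I (\<lambda>u v. F u v $ m)"
  by (simp add: II_def)

lemma II_add: "uv_fps F \<Longrightarrow> uv_fps G \<Longrightarrow> II (\<lambda>u v. F u v + G u v) = II F + II G"
  by (rule fps_ext) (simp add: uv_fps_def I_add)

lemma II_diff: "uv_fps F \<Longrightarrow> uv_fps G \<Longrightarrow> II (\<lambda>u v. F u v - G u v) = II F - II G"
  by (rule fps_ext) (simp add: uv_fps_def I_diff)

text \<open>The factor \<open>C\<close> is a whole series free of \<open>u, v\<close>; each
  coefficient of the product is a finite sum, so linearity suffices.\<close>

lemma II_cmult: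
  assumes "uv_fps F"
  shows "II (\<lambda>u v. C * F u v) = C * II F"
proof (rule fps_ext)
  fix m
  have F: "uv_fun (\<lambda>u v. F u v $ i)" for i using assms by (simp add: uv_fps_def)
  have "I (\<lambda>u v. \<Sum>i=0..m. C $ i * F u v $ (m - i)) = (\<Sum>i=0..m. I (\<lambda>u v. C $ i * F u v $ (m - i)))"
    by (intro I_sum uv_poly_mult uv_fun_const F) simp
  then show "II (\<lambda>u v. C * F u v) $ m = (C * II F) $ m"
    by (simp add: fps_mult_nth I_cmult[OF F])
qed

end

section \<open>The key identity by partial integration\<close>

context uv_functional
begin

lemma II_by_parts_u:
  assumes ibp: "\<And>f f'. uv_fun f \<Longrightarrow> uv_fun f' \<Longrightarrow> (\<And>u v. ((\<lambda>u. f u v) has_real_derivative f' u v) (at u)) \<Longrightarrow>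
      I (\<lambda>u v. (1 - u\<^sup>2) * f' u v - 2 * a * u * f u v) = 0"
    and F: "uv_fps F" "uv_fps F'" "\<And>u v. fps_has_deriv (\<lambda>u. F u v) (F' u v) u"
  shows "II (\<lambda>u v. fps_const (1 - u\<^sup>2) * F' u v - fps_const (2 * a * u) * F u v) = 0"
proof (rule fps_ext)
  fix m
  show "II (\<lambda>u v. fps_const (1 - u\<^sup>2) * F' u v - fps_const (2 * a * u) * F u v) $ m = 0 $ m"
    using ibp[of "\<lambda>u v. F u v $ m" "\<lambda>u v. F' u v $ m"] F by (simp add: uv_fps_def fps_has_deriv_def)
qed

lemma II_by_parts_v:
  assumes ibp: "\<And>f f'. uv_fun f \<Longrightarrow> uv_fun f' \<Longrightarrow> (\<And>u v. ((\<lambda>v. f u v) has_real_derivative f' u v) (at v)) \<Longrightarrow>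
      I (\<lambda>u v. (1 - v\<^sup>2) * f' u v - 2 * a * v * f u v) = 0"
    and F: "uv_fps F" "uv_fps F'" "\<And>u v. fps_has_deriv (\<lambda>v. F u v) (F' u v) v"
  shows "II (\<lambda>u v. fps_const (1 - v\<^sup>2) * F' u v - fps_const (2 * a * v) * F u v) = 0"
proof (rule fps_ext)
  fix m
  show "II (\<lambda>u v. fps_const (1 - v\<^sup>2) * F' u v - fps_const (2 * a * v) * F u v) $ m = 0 $ m"
    using ibp[of "\<lambda>u v. F u v $ m" "\<lambda>u v. F' u v $ m"] F by (simp add: uv_fps_def fps_has_deriv_def)
qed

end

text \<open>This is \<open>1 - S\<close> for the \<open>S\<close> of the overview, with
  \<open>A, t, x, y\<close> as free parameters.\<close>

definition pencil :: "real fps \<Rightarrow> real fps \<Rightarrow> real \<Rightarrow> real \<Rightarrow> real \<Rightarrow> real \<Rightarrow> real fps" where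
  "pencil A t x y u v = 1 - A + fps_const (v * x + u * y) * t"

lemma uv_fps_pencil: "uv_fps (pencil A t x y)"
  unfolding pencil_def[abs_def] by (intro uv_fps_intros)

lemma pencil_nth_0: "A $ 0 = 1 \<Longrightarrow> t $ 0 = 0 \<Longrightarrow> pencil A t x y u v $ 0 = 0"
  by (simp add: pencil_def)

lemma pencil_deriv:
  shows "fps_has_deriv (\<lambda>u. pencil A t x y u v) (fps_const y * t) u"
    and "fps_has_deriv (\<lambda>v. pencil A t x y u v) (fps_const x * t) v"
  unfolding fps_has_deriv_def pencil_def
  by (auto intro!: derivative_eq_intros simp: algebra_simps)

lemma npow_pencil_deriv:
  assumes "A $ 0 = 1" "t $ 0 = 0"
  shows "fps_has_deriv (\<lambda>u. C * fps_npow g (pencil A t x y u v))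
      (C * (fps_const g * fps_npow (g + 1) (pencil A t x y u v) * (fps_const y * t))) u"
    and "fps_has_deriv (\<lambda>v. C * fps_npow g (pencil A t x y u v))
      (C * (fps_const g * fps_npow (g + 1) (pencil A t x y u v) * (fps_const x * t))) v"
proof -
  have *: "fps_has_deriv (\<lambda>u. fps_npow g (pencil A t x y u v))
      (fps_const g * fps_npow (g + 1) (pencil A t x y u v) * (fps_const y * t)) u"
    "fps_has_deriv (\<lambda>v. fps_npow g (pencil A t x y u v))
      (fps_const g * fps_npow (g + 1) (pencil A t x y u v) * (fps_const x * t)) v"
    using assms by (intro fps_has_deriv_npow pencil_deriv; simp add: pencil_nth_0)+
  show "fps_has_deriv (\<lambda>u. C * fps_npow g (pencil A t x y u v))
      (C * (fps_const g * fps_npow (g + 1) (pencil A t x y u v) * (fps_const y * t))) u"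
    "fps_has_deriv (\<lambda>v. C * fps_npow g (pencil A t x y u v))
      (C * (fps_const g * fps_npow (g + 1) (pencil A t x y u v) * (fps_const x * t))) v"
    using fps_has_deriv_mult[OF fps_has_deriv_const[of C] *(1)]
      fps_has_deriv_mult[OF fps_has_deriv_const[of C] *(2)] by simp_all
qed

definition dih_weight :: "real \<Rightarrow> real \<Rightarrow> real \<Rightarrow> real" where
  "dih_weight e u v = 1 - u * v + e * (u - v)"

text \<open>The integrand of the key identity is an exact divergence: the right hand side collects the
  integrands of the partial integrations in \<open>u\<close> and \<open>v\<close> with the linear multipliers
  \<open>(t D - A e) + (A - t D e) v\<close> and \<open>(A e - t D) + (A - t D e) u\<close>, where \<open>D = x - y\<close>.\<close>
lemma divergence_identity:
  fixes A t x y u v e g :: "'a :: comm_ring_1"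
  defines "S \<equiv> A - (v * x + u * y) * t" and "D \<equiv> x - y"
  shows "2 * g * (A - D * t) * (A + D * t) * (1 - u * v + e * (u - v))
      - g * (1 - e) * (A + D * t) * (1 + u * v - e * (u + v)) * S
      - g * (1 + e) * (A - D * t) * (1 + u * v + e * (u + v)) * S
    = 2 * (D * t - A * e) * ((1 - u\<^sup>2) * (g * (y * t)) - g * (1 - e) * u * S)
      + 2 * (A - D * t * e) * ((1 - u\<^sup>2) * (v * (g * (y * t))) - g * (1 - e) * u * (v * S))
      + 2 * (A * e - D * t) * ((1 - v\<^sup>2) * (g * (x * t)) - g * (1 + e) * v * S)
      + 2 * (A - D * t * e) * ((1 - v\<^sup>2) * (u * (g * (x * t))) - g * (1 + e) * v * (u * S))"
  unfolding S_def D_def by (simp add: algebra_simps power2_eq_square)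

lemma uv_functional_nu_int2: "a > 0 \<Longrightarrow> b > 0 \<Longrightarrow> uv_functional (nu_int2 a b)"
  by unfold_locales (simp_all add: nu_int2_add nu_int2_cmult)

text \<open>The denominators in the overview are multiplied out, with \<open>D = (x - y) t\<close>.
  By \<open>divergence_identity\<close>, multiplied by the power \<open>-g-1\<close> of
  \<open>S\<close>, the integrands differ by a combination of partial integrations, each with
  integral zero.\<close>

lemma key_identity_two_classes:
  fixes A t :: "real fps" and x y :: real
  assumes ab: "a > 0" "b > 0" and A0: "A $ 0 = 1" and t0: "t $ 0 = 0"
  defines "g \<equiv> a + b" and "e \<equiv> (b - a) / (a + b)"
  defines "N \<equiv> \<lambda>h u v. fps_npow h (pencil A t x y u v)" and "D \<equiv> fps_const (x - y) * t"
  shows "fps_const g * (A - D) * (A + D) * uv_functional.II (nu_int2 a b) (\<lambda>u v. fps_const (dih_weight e u v) * N (g + 1) u v)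
    = fps_const a * (A + D) * uv_functional.II (nu_int2 a b) (\<lambda>u v. fps_const (dih_weight e u v) * N g (- u) v)
    + fps_const b * (A - D) * uv_functional.II (nu_int2 a b) (\<lambda>u v. fps_const (dih_weight e u v) * N g u (- v))"
proof -
  interpret uv_functional "nu_int2 a b" by (rule uv_functional_nu_int2[OF ab])
  have g: "g > 0" using ab by (simp add: g_def)
  have a2: "2 * a = g * (1 - e)" and b2: "2 * b = g * (1 + e)"
    using g by (simp_all add: g_def e_def field_simps)
  have uvN: "uv_fps (N h)" for h unfolding N_def by (intro uv_fps_npow uv_fps_pencil)
  define S where "S u v = A - (fps_const v * fps_const x + fps_const u * fps_const y) * t" for u v
  have NS: "N g u v = S u v * N (g + 1) u v" for u v
    unfolding N_def S_def
    by (subst fps_npow_Suc_param) (simp_all add: pencil_nth_0 A0 t0, simp add: pencil_def)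
  \<comment> \<open>The integrand of the partial integration in \<open>u\<close> for
    \<open>C v\<close> times the power \<open>-g\<close> of \<open>S\<close>; the multiplier must
    not involve \<open>u\<close>. The choices \<open>C v = 1\<close> and \<open>C v = v\<close>, the
    latter as \<open>fps_const\<close>, generate the linear multipliers.\<close>
  define Pu where "Pu C u v = fps_const (1 - u\<^sup>2) * (C v * (fps_const g * N (g + 1) u v * (fps_const y * t)))
      - fps_const (2 * a * u) * (C v * N g u v)" for C u v
  define Pv where "Pv C u v = fps_const (1 - v\<^sup>2) * (C u * (fps_const g * N (g + 1) u v * (fps_const x * t)))
      - fps_const (2 * b * v) * (C u * N g u v)" for C u v
  have Pu0: "II (Pu C) = 0" if "uv_fps (\<lambda>u v. C v)" for C
    unfolding Pu_def[abs_def]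
  proof (rule II_by_parts_u)
    show "fps_has_deriv (\<lambda>u. C v * N g u v) (C v * (fps_const g * N (g + 1) u v * (fps_const y * t))) u" for u v
      unfolding N_def by (rule npow_pencil_deriv(1)[OF A0 t0])
  qed (intro nu_int2_by_parts_u ab uv_fps_intros uvN that | assumption)+
  have Pv0: "II (Pv C) = 0" if "uv_fps (\<lambda>u v. C u)" for C
    unfolding Pv_def[abs_def]
  proof (rule II_by_parts_v)
    show "fps_has_deriv (\<lambda>v. C u * N g u v) (C u * (fps_const g * N (g + 1) u v * (fps_const x * t))) v" for u v
      unfolding N_def by (rule npow_pencil_deriv(2)[OF A0 t0])
  qed (intro nu_int2_by_parts_v ab uv_fps_intros uvN that | assumption)+
  have uvP: "uv_fps (Pu (\<lambda>_. 1))" "uv_fps (Pu fps_const)" "uv_fps (Pv (\<lambda>_. 1))" "uv_fps (Pv fps_const)"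
    unfolding Pu_def[abs_def] Pv_def[abs_def] power2_eq_square by (intro uv_fps_intros uvN)+
  let ?E = "fps_const e" and ?G = "fps_const g"
  let ?W = "\<lambda>u v. fps_const (dih_weight e u v)"
  have uvW: "uv_fps ?W" "uv_fps (\<lambda>u v. ?W (- u) v)" "uv_fps (\<lambda>u v. ?W u (- v))"
    unfolding dih_weight_def by (intro uv_fps_scalar uv_fun_intros uv_fun_minus)+
  have ca: "fps_const (2 * a) = ?G * (1 - ?E)" and cb: "fps_const (2 * b) = ?G * (1 + ?E)"
    unfolding a2 b2 by (simp_all flip: fps_const_mult fps_const_add fps_const_sub)
  have pointwise: "(2 * ?G * (A - D) * (A + D)) * (?W u v * N (g + 1) u v)
      - (fps_const (2 * a) * (A + D)) * (?W (- u) v * N g u v)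
      - (fps_const (2 * b) * (A - D)) * (?W u (- v) * N g u v)
    = (2 * (D - A * ?E)) * Pu (\<lambda>_. 1) u v + (2 * (A - D * ?E)) * Pu fps_const u v
      + (2 * (A * ?E - D)) * Pv (\<lambda>_. 1) u v + (2 * (A - D * ?E)) * Pv fps_const u v" for u v
  proof -
    let ?U = "fps_const u" and ?V = "fps_const v" and ?X = "fps_const x" and ?Y = "fps_const y"
    let ?H = "N (g + 1) u v"
    have W: "?W u v = 1 - ?U * ?V + ?E * (?U - ?V)" "?W (- u) v = 1 + ?U * ?V - ?E * (?U + ?V)"
      "?W u (- v) = 1 + ?U * ?V + ?E * (?U + ?V)"
      by (simp_all add: dih_weight_def algebra_simps flip: fps_const_mult fps_const_add fps_const_sub fps_const_neg)
    have D': "D = (?X - ?Y) * t" by (simp add: D_def)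
    have sq: "fps_const (1 - u\<^sup>2) = 1 - ?U\<^sup>2" "fps_const (1 - v\<^sup>2) = 1 - ?V\<^sup>2"
      by (simp_all add: power2_eq_square flip: fps_const_mult fps_const_sub)
    have ca': "fps_const (2 * a * u) = ?G * (1 - ?E) * ?U" "fps_const (2 * b * v) = ?G * (1 + ?E) * ?V"
      by (simp_all only: ca[symmetric] cb[symmetric] fps_const_mult)
    note div = divergence_identity[of ?G A "?X" "?Y" t ?U ?V ?E, folded D' S_def]
    have "Pu (\<lambda>_. 1) u v = ((1 - ?U\<^sup>2) * (?G * (?Y * t)) - ?G * (1 - ?E) * ?U * S u v) * ?H"
      "Pu fps_const u v = ((1 - ?U\<^sup>2) * (?V * (?G * (?Y * t))) - ?G * (1 - ?E) * ?U * (?V * S u v)) * ?H"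
      "Pv (\<lambda>_. 1) u v = ((1 - ?V\<^sup>2) * (?G * (?X * t)) - ?G * (1 + ?E) * ?V * S u v) * ?H"
      "Pv fps_const u v = ((1 - ?V\<^sup>2) * (?U * (?G * (?X * t))) - ?G * (1 + ?E) * ?V * (?U * S u v)) * ?H"
      unfolding Pu_def Pv_def NS ca' sq left_diff_distrib by (simp_all only: mult_1_left mult_ac)
    then have "(2 * (D - A * ?E)) * Pu (\<lambda>_. 1) u v + (2 * (A - D * ?E)) * Pu fps_const u v
      + (2 * (A * ?E - D)) * Pv (\<lambda>_. 1) u v + (2 * (A - D * ?E)) * Pv fps_const u v
      = (2 * (D - A * ?E) * ((1 - ?U\<^sup>2) * (?G * (?Y * t)) - ?G * (1 - ?E) * ?U * S u v)
      + 2 * (A - D * ?E) * ((1 - ?U\<^sup>2) * (?V * (?G * (?Y * t))) - ?G * (1 - ?E) * ?U * (?V * S u v))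
      + 2 * (A * ?E - D) * ((1 - ?V\<^sup>2) * (?G * (?X * t)) - ?G * (1 + ?E) * ?V * S u v)
      + 2 * (A - D * ?E) * ((1 - ?V\<^sup>2) * (?U * (?G * (?X * t))) - ?G * (1 + ?E) * ?V * (?U * S u v))) * ?H"
      by (simp only: distrib_right mult.assoc)
    also have "\<dots> = (2 * ?G * (A - D) * (A + D) * (1 - ?U * ?V + ?E * (?U - ?V))
        - ?G * (1 - ?E) * (A + D) * (1 + ?U * ?V - ?E * (?U + ?V)) * S u v
        - ?G * (1 + ?E) * (A - D) * (1 + ?U * ?V + ?E * (?U + ?V)) * S u v) * ?H"
      by (simp only: div)
    also have "\<dots> = (2 * ?G * (A - D) * (A + D)) * (?W u v * N (g + 1) u v)
      - (fps_const (2 * a) * (A + D)) * (?W (- u) v * N g u v)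
      - (fps_const (2 * b) * (A - D)) * (?W u (- v) * N g u v)"
    proof -
      have "(p * w - q * w' * s - r * w'' * s) * h = p * (w * h) - q * (w' * (s * h)) - r * (w'' * (s * h))"
        for p q r w w' w'' s h :: "real fps" by (simp add: algebra_simps)
      then show ?thesis unfolding W ca cb NS .
    qed
    finally show ?thesis ..
  qed
  define T0 T1 T2 where "T0 = II (\<lambda>u v. ?W u v * N (g + 1) u v)"
    and "T1 = II (\<lambda>u v. ?W (- u) v * N g u v)" and "T2 = II (\<lambda>u v. ?W u (- v) * N g u v)"
  have "(2 * ?G * (A - D) * (A + D)) * T0 - (fps_const (2 * a) * (A + D)) * T1 - (fps_const (2 * b) * (A - D)) * T2
    = II (\<lambda>u v. (2 * ?G * (A - D) * (A + D)) * (?W u v * N (g + 1) u v)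
      - (fps_const (2 * a) * (A + D)) * (?W (- u) v * N g u v)
      - (fps_const (2 * b) * (A - D)) * (?W u (- v) * N g u v))"
    unfolding T0_def T1_def T2_def
    by (simp only: II_diff II_cmult uv_fps_diff uv_fps_mult uv_fps_const uvW uvN)
  also have "\<dots> = II (\<lambda>u v. (2 * (D - A * ?E)) * Pu (\<lambda>_. 1) u v + (2 * (A - D * ?E)) * Pu fps_const u v
      + (2 * (A * ?E - D)) * Pv (\<lambda>_. 1) u v + (2 * (A - D * ?E)) * Pv fps_const u v)"
    unfolding pointwise ..
  also have "\<dots> = 0"
    using Pu0[of "\<lambda>_. 1"] Pu0[of fps_const] Pv0[of "\<lambda>_. 1"] Pv0[of fps_const]
    by (simp only: II_add II_cmult uv_fps_add uv_fps_mult uv_fps_const uvP uv_fps_scalar uv_fun_u uv_fun_v)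
       simp
  finally have "2 * (?G * (A - D) * (A + D) * T0) = 2 * (fps_const a * (A + D) * T1 + fps_const b * (A - D) * T2)"
    by (simp add: algebra_simps fps_numeral_fps_const flip: fps_const_mult)
  then have main: "?G * (A - D) * (A + D) * T0 = fps_const a * (A + D) * T1 + fps_const b * (A - D) * T2"
    by (simp only: mult_cancel_left) simp
  have "uv_fps (\<lambda>u v. N g (- u) v)" "uv_fps (\<lambda>u v. N g u (- v))"
    unfolding N_def pencil_def by (intro uv_fps_intros uv_fun_minus)+
  then have uvr: "uv_fps (\<lambda>u v. ?W u v * N g (- u) v)" "uv_fps (\<lambda>u v. ?W u v * N g u (- v))"
    using uv_fps_mult[OF uvW(1)] by blast+
  \<comment> \<open>Substituting \<open>-u\<close>, respectively \<open>-v\<close>, moves the sign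
    from the weight to the power.\<close>
  have "T1 = II (\<lambda>u v. ?W u v * N g (- u) v)" "T2 = II (\<lambda>u v. ?W u v * N g u (- v))"
    unfolding T1_def T2_def
    using nu_int2_reflect(1)[OF ab uvr(1)[unfolded uv_fps_def, rule_format]]
      nu_int2_reflect(2)[OF ab uvr(2)[unfolded uv_fps_def, rule_format]]
    by (simp_all add: fps_eq_iff)
  then show ?thesis using main T0_def by simp
qed

lemma uv_functional_nu_int: "a > 0 \<Longrightarrow> uv_functional (\<lambda>f. nu_int a (\<lambda>u. f u 1))"
  by unfold_locales (simp_all add: nu_int_add nu_int_cmult uv_fun_continuous)

text \<open>At \<open>v = 1\<close> one partial integration in \<open>u\<close> with multiplier 1
  suffices: \<open>(A - D) (1 - u) - (1 + u) S = (1 - u^2) y t - 2 u S\<close>.\<close>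

lemma key_identity_one_class:
  fixes A t :: "real fps" and x y :: real
  assumes a: "a > 0" and A0: "A $ 0 = 1" and t0: "t $ 0 = 0"
  defines "N \<equiv> \<lambda>h u v. fps_npow h (pencil A t x y u v)" and "D \<equiv> fps_const (x - y) * t"
    and "II \<equiv> uv_functional.II (\<lambda>f. nu_int a (\<lambda>u. f u 1))"
  shows "fps_const a * (A - D) * II (\<lambda>u v. fps_const (1 - u) * N (a + 1) u v)
    = fps_const a * II (\<lambda>u v. fps_const (1 - u) * N a (- u) v)"
proof -
  interpret uv_functional "\<lambda>f. nu_int a (\<lambda>u. f u 1)"
    rewrites "uv_functional.II (\<lambda>f. nu_int a (\<lambda>u. f u 1)) = II"
    unfolding II_def by (rule uv_functional_nu_int[OF a]) simp
  have uvN: "uv_fps (N h)" for h unfolding N_def by (intro uv_fps_npow uv_fps_pencil)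
  have NS: "N a u 1 = (A - (fps_const x + fps_const u * fps_const y) * t) * N (a + 1) u 1" for u
    unfolding N_def
    by (subst fps_npow_Suc_param) (simp_all add: pencil_nth_0 A0 t0, simp add: pencil_def)
  define P where "P u v = fps_const (1 - u\<^sup>2) * (fps_const a * N (a + 1) u v * (fps_const y * t))
      - fps_const (2 * a * u) * N a u v" for u v
  have P0: "II P = 0"
    unfolding P_def[abs_def]
  proof (rule II_by_parts_u)
    show "fps_has_deriv (\<lambda>u. N a u v) (fps_const a * N (a + 1) u v * (fps_const y * t)) u" for u v
      using npow_pencil_deriv(1)[OF A0 t0, of 1] unfolding N_def by simp
  qed (intro nu_int_by_parts a uv_fps_intros uvN uv_fun_continuous | assumption)+
  have pointwise: "(fps_const a * (A - D)) * (fps_const (1 - u) * N (a + 1) u 1)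
      - fps_const a * (fps_const (1 + u) * N a u 1) = P u 1" for u
    unfolding P_def NS D_def
    by (simp add: algebra_simps power2_eq_square fps_numeral_fps_const flip: fps_const_mult fps_const_add fps_const_sub)
  have uvW: "uv_fps (\<lambda>u v. fps_const (1 - u))" "uv_fps (\<lambda>u v. fps_const (1 + u))"
    by (intro uv_fps_intros)+
  have "(fps_const a * (A - D)) * II (\<lambda>u v. fps_const (1 - u) * N (a + 1) u v)
      - fps_const a * II (\<lambda>u v. fps_const (1 + u) * N a u v)
      = II (\<lambda>u v. (fps_const a * (A - D)) * (fps_const (1 - u) * N (a + 1) u v)
      - fps_const a * (fps_const (1 + u) * N a u v))"
    by (simp only: II_diff II_cmult uv_fps_diff uv_fps_mult uv_fps_const uvW uvN)
  also have "\<dots> = II P" by (simp only: fps_eq_iff II_nth pointwise) simp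
  finally have main: "fps_const a * (A - D) * II (\<lambda>u v. fps_const (1 - u) * N (a + 1) u v)
      = fps_const a * II (\<lambda>u v. fps_const (1 + u) * N a u v)" using P0 by simp
  have "uv_fps (\<lambda>u v. N a (- u) v)"
    unfolding N_def pencil_def by (intro uv_fps_intros uv_fun_minus)
  then have uvr: "uv_fps (\<lambda>u v. fps_const (1 - u) * N a (- u) v)" by (intro uv_fps_mult uvW)
  have "nu_int a (\<lambda>u. (fps_const (1 - (- u)) * N a (- (- u)) 1) $ n) = nu_int a (\<lambda>u. (fps_const (1 - u) * N a (- u) 1) $ n)" for n
    using nu_int_reflect[OF a uv_fun_continuous(1)[OF uvr[unfolded uv_fps_def, rule_format, of n], of 1]] .
  then have "II (\<lambda>u v. fps_const (1 + u) * N a u v) = II (\<lambda>u v. fps_const (1 - u) * N a (- u) v)"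
    by (simp add: fps_eq_iff)
  with main show ?thesis by simp
qed

section \<open>The recursion under the reflections\<close>

lemma dih_fps_pencil:
  "dih_fps k z w u v = pencil (cheb_fps k (cmod (z * w))) (fps_const (2 / 2 ^ k) * fps_X ^ k)
     (Re (z ^ k) * Re (w ^ k)) (Im (z ^ k) * Im (w ^ k)) u v"
  unfolding dih_fps_def pencil_def by (simp add: mult_ac)

lemma fps_X_times_deriv_power: "fps_X * fps_deriv (fps_X ^ k) = fps_const (real k) * (fps_X ^ k :: real fps)"
  by (rule fps_ext) (auto simp: fps_X_power_nth)

text \<open>\<open>X^k\<close> is an eigenvector of \<open>X d/dX\<close> with eigenvalue
  \<open>k\<close>, so the term in \<open>X^k\<close>, the only place where \<open>u, v\<close>
  enter \<open>S\<close>, cancels.\<close>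

lemma cheb_numerator:
  fixes T :: "real fps"
  shows "fps_const (real k) * (T - fps_const c * fps_X ^ k) - fps_X * fps_deriv (T - fps_const c * fps_X ^ k)
    = fps_const (real k) * T - fps_X * fps_deriv T"
proof -
  have "fps_X * fps_deriv (T - fps_const c * fps_X ^ k)
      = fps_X * fps_deriv T - fps_const c * (fps_X * fps_deriv (fps_X ^ k))"
    by (simp add: right_diff_distrib mult_ac)
  then show ?thesis unfolding fps_X_times_deriv_power by (simp add: right_diff_distrib mult_ac)
qed

context uv_functional
begin

text \<open>With \<open>M\<close> the integral of \<open>W\<close> times the power \<open>-g\<close>
  of \<open>S\<close>, \<open>K m\<close> is the \<open>m\<close>-th coefficient of
  \<open>M / (1 - <z, w> X)\<close> divided by \<open>q m\<close>. Multiplying the coefficient of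
  \<open>M\<close> by \<open>k g + m\<close> yields the sum over the reflections by
  \<open>key\<close>; undoing the geometric factor brings in \<open>K (m - 1)\<close>.\<close>

lemma hom_part_recursion:
  fixes W :: "real \<Rightarrow> real \<Rightarrow> real" and k n m :: nat and g :: real and kap :: "nat \<Rightarrow> real"
  assumes k: "k \<ge> 1" and g: "g > 0" and W: "uv_fun W" and m: "m \<ge> 1"
    and key: "(fps_const (real k) * cheb_fps k (cmod (z * w)) - fps_X * fps_deriv (cheb_fps k (cmod (z * w))))
        * (fps_const g * II (\<lambda>u v. fps_const (W u v) * fps_npow (g + 1) (dih_fps k z w u v)))
      = (\<Sum>l<n. fps_const (kap l) * II (\<lambda>u v. fps_const (W u v) * fps_npow g (dih_fps k (refl n l z) w u v))
          * geom_fps (inner2 (refl n l z) w))"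
  defines "K \<equiv> \<lambda>m z w. I (\<lambda>u v. W u v * hom_part k g m z w u v)"
  shows "(real k * g + real m) * K m z w - (\<Sum>l<n. kap l * K m (refl n l z) w) = inner2 z w * K (m - 1) z w"
proof -
  define M where "M z w = II (\<lambda>u v. fps_const (W u v) * fps_npow g (dih_fps k z w u v))" for z w
  define q where "q m = pochhammer (real k * g + 1) m" for m
  have q: "q m > 0" for m using g unfolding q_def by (intro pochhammer_pos) (simp add: add_nonneg_pos)
  let ?T = "cheb_fps k (cmod (z * w))"
  let ?B = "fps_const (real k) * ?T - fps_X * fps_deriv ?T"
  have d0: "dih_fps k z w u v $ 0 = 0" for z w u v using k by simp
  have uvF: "uv_fps (\<lambda>u v. fps_const (W u v) * fps_npow h (dih_fps k z w u v))" for h z w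
    by (intro uv_fps_intros W)
  have K: "K m z w = (M z w * geom_fps (inner2 z w)) $ m / q m" for m z w
  proof -
    have "K m z w = I (\<lambda>u v. 1 / q m * (geom_fps (inner2 z w) * (fps_const (W u v) * fps_npow g (dih_fps k z w u v))) $ m)"
      unfolding K_def hom_part_def q_def
      by (rule arg_cong[where f = I], intro ext) (simp add: mult_ac)
    also have "\<dots> = 1 / q m * II (\<lambda>u v. geom_fps (inner2 z w) * (fps_const (W u v) * fps_npow g (dih_fps k z w u v))) $ m"
      using uv_fps_mult[OF uv_fps_const uvF] unfolding II_nth uv_fps_def by (intro I_cmult) blast
    finally show ?thesis by (simp add: II_cmult[OF uvF] M_def mult.commute)
  qed
  \<comment> \<open>The factor \<open>k g + m\<close> acts as \<open>k g + X d/dX\<close>, which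
    maps the power \<open>-g\<close> of \<open>S\<close> to \<open>g (k S - X S')\<close> times its
    power \<open>-g-1\<close>. The bracket is \<open>?B\<close> and is free of
    \<open>u, v\<close>.\<close>
  have euler: "(real k * g + real m) * M z w $ m = (?B * (fps_const g * II (\<lambda>u v. fps_const (W u v) * fps_npow (g + 1) (dih_fps k z w u v)))) $ m"
  proof -
    have pointwise: "(real k * g + real m) * (fps_const (W u v) * fps_npow g (dih_fps k z w u v)) $ m
        = ((?B * fps_const g) * (fps_const (W u v) * fps_npow (g + 1) (dih_fps k z w u v))) $ m" for u v
    proof -
      let ?d = "dih_fps k z w u v" and ?H = "fps_npow (g + 1) (dih_fps k z w u v)"
      obtain c where c: "1 - ?d = ?T - fps_const c * fps_X ^ k"
        by (rule that[of "2 / 2 ^ k * (v * (Re (z ^ k) * Re (w ^ k)) + u * (Im (z ^ k) * Im (w ^ k)))"])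
           (simp add: dih_fps_def)
      have "fps_const (real k) * (1 - ?d) + fps_X * fps_deriv ?d
          = fps_const (real k) * (1 - ?d) - fps_X * fps_deriv (1 - ?d)" by simp
      also have "\<dots> = ?B" unfolding c by (rule cheb_numerator)
      finally have B: "fps_const (real k) * (1 - ?d) + fps_X * fps_deriv ?d = ?B" .
      have "fps_const (real k * g) * fps_npow g ?d + fps_X * fps_deriv (fps_npow g ?d)
          = ?B * fps_const g * ?H"
        unfolding B[symmetric] fps_deriv_npow[OF d0]
        unfolding fps_npow_Suc_param[OF d0, of g] fps_const_mult[symmetric]
        by (simp only: distrib_left distrib_right mult_ac)
      moreover have "(real k * g + real m) * fps_npow g ?d $ m
          = (fps_const (real k * g) * fps_npow g ?d + fps_X * fps_deriv (fps_npow g ?d)) $ m"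
        using m by (simp add: algebra_simps)
      ultimately have "(real k * g + real m) * fps_npow g ?d $ m = (?B * fps_const g * ?H) $ m" by simp
      then have "W u v * ((real k * g + real m) * fps_npow g ?d $ m) = (fps_const (W u v) * (?B * fps_const g * ?H)) $ m"
        by simp
      then show ?thesis by (simp add: mult_ac)
    qed
    have "(real k * g + real m) * M z w $ m
        = I (\<lambda>u v. (real k * g + real m) * (fps_const (W u v) * fps_npow g (dih_fps k z w u v)) $ m)"
      using uvF unfolding M_def II_nth uv_fps_def by (intro I_cmult[symmetric]) blast
    also have "\<dots> = II (\<lambda>u v. (?B * fps_const g) * (fps_const (W u v) * fps_npow (g + 1) (dih_fps k z w u v))) $ m"
      unfolding pointwise II_nth ..
    also have "\<dots> = (?B * (fps_const g * II (\<lambda>u v. fps_const (W u v) * fps_npow (g + 1) (dih_fps k z w u v)))) $ m"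
      unfolding II_cmult[OF uvF] by (simp only: mult.assoc)
    finally show ?thesis .
  qed
  have "(\<Sum>l<n. fps_const (kap l) * M (refl n l z) w * geom_fps (inner2 (refl n l z) w)) $ m
      = (\<Sum>l<n. kap l * (M (refl n l z) w * geom_fps (inner2 (refl n l z) w)) $ m)"
    by (simp add: fps_sum_nth mult.assoc)
  also have "\<dots> = q m * (\<Sum>l<n. kap l * K m (refl n l z) w)"
    using q[of m] by (simp add: K sum_distrib_left mult_ac)
  finally have "(real k * g + real m) * M z w $ m = q m * (\<Sum>l<n. kap l * K m (refl n l z) w)"
    unfolding euler key M_def[symmetric] .
  moreover have "M z w $ m = q m * K m z w - inner2 z w * (q (m - 1) * K (m - 1) z w)"
  proof -
    have "M z w = (1 - fps_const (inner2 z w) * fps_X) * (M z w * geom_fps (inner2 z w))"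
      using geom_fps_inverse[of "inner2 z w"] by (simp add: mult.left_commute)
    then have "M z w $ m = ((1 - fps_const (inner2 z w) * fps_X) * (M z w * geom_fps (inner2 z w))) $ m"
      by (rule arg_cong[where f = "\<lambda>F. F $ m"])
    also have "\<dots> = (M z w * geom_fps (inner2 z w)) $ m - inner2 z w * (M z w * geom_fps (inner2 z w)) $ (m - 1)"
      using m by (simp add: left_diff_distrib mult.assoc)
    finally show ?thesis using q[of m] q[of "m - 1"] by (simp add: K)
  qed
  moreover have "q m = q (m - 1) * (real k * g + real m)"
    using m pochhammer_Suc[of "real k * g + 1" "m - 1"] by (simp add: q_def of_nat_diff)
  ultimately have "q m * ((real k * g + real m) * K m z w - inner2 z w * K (m - 1) z w)
      = q m * (\<Sum>l<n. kap l * K m (refl n l z) w)"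
    by (simp add: algebra_simps)
  then show ?thesis using q[of m] by simp
qed

end

section \<open>Reflections in polar coordinates and sums over reflection classes\<close>

lemma refl_polar: "refl n l z = rcis (cmod z) (2 * pi * real l / real n - Arg z)"
proof -
  have "refl n l z = cnj (rcis (cmod z) (Arg z)) * cis (2 * pi * real l / real n)"
    unfolding refl_def rcis_cmod_Arg cis_conv_exp ..
  then show ?thesis by (simp add: rcis_def cis_cnj cis_mult add.commute mult.assoc)
qed

lemma cmod_refl [simp]: "cmod (refl n l z) = cmod z"
  by (simp add: refl_polar)

lemma refl_power: "refl n l z ^ k = cnj (z ^ k) * cis (2 * pi * real l * real k / real n)"
proof -
  have "refl n l z = cnj z * cis (2 * pi * real l / real n)"
    by (simp add: refl_def cis_conv_exp)
  then show ?thesis by (simp add: power_mult_distrib Complex.DeMoivre mult_ac)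
qed

lemma inner2_refl: "inner2 (refl n l z) w = cmod (z * w) * cos (2 * pi * real l / real n - (Arg z + Arg w))"
proof -
  have "refl n l z * cnj w = rcis (cmod z) (2 * pi * real l / real n - Arg z) * cnj (rcis (cmod w) (Arg w))"
    by (simp only: refl_polar rcis_cmod_Arg)
  also have "cnj (rcis (cmod w) (Arg w)) = rcis (cmod w) (- Arg w)"
    by (simp add: rcis_def cis_cnj)
  finally show ?thesis by (simp add: inner2_def rcis_mult norm_mult diff_diff_eq)
qed

lemma polar_power_cos:
  "cmod (z * w) ^ k * cos (real k * (Arg z + Arg w)) = Re (z ^ k) * Re (w ^ k) - Im (z ^ k) * Im (w ^ k)"
  unfolding power_polar by (simp add: norm_mult power_mult_distrib distrib_left cos_add algebra_simps)

text \<open>For a class of reflections the numbers \<open>inner2 (refl n l z) w\<close> have the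
  form of the \<open>b i\<close>, so the Chebyshev product formula and its logarithmic derivative
  apply; the numerator is the same for all \<open>q\<close>.\<close>

lemma sum_geom_class:
  assumes k: "k \<ge> 1" and b: "\<And>i. i < k \<Longrightarrow> b i = r * cos ((q + 2 * pi * real i) / real k)"
    and c: "r ^ k * cos q = c"
  shows "(\<Sum>i<k. geom_fps (b i)) * (cheb_fps k r - fps_const c * (fps_const (2 / 2 ^ k) * fps_X ^ k))
    = fps_const (real k) * cheb_fps k r - fps_X * fps_deriv (cheb_fps k r)"
proof -
  have "(\<Prod>i<k. 1 - fps_const (b i) * fps_X) = cheb_fps k r - fps_const (2 / 2 ^ k * c) * fps_X ^ k"
    using prod_linear_fps_eq_cheb[OF k, of r q] b by (simp add: c)
  then have "(\<Sum>i<k. geom_fps (b i)) * (cheb_fps k r - fps_const (2 / 2 ^ k * c) * fps_X ^ k)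
      = fps_const (real k) * cheb_fps k r - fps_X * fps_deriv (cheb_fps k r)"
    using sum_geom_fps_times_prod[of "{..<k}" b] by (simp only: cheb_numerator finite_lessThan card_lessThan)
  moreover have "fps_const (2 / 2 ^ k * c) * fps_X ^ k = fps_const c * (fps_const (2 / 2 ^ k) * fps_X ^ k :: real fps)"
    by (simp add: mult_ac)
  ultimately show ?thesis by (simp only:)
qed

text \<open>Real and imaginary part of \<open>z^k\<close> occur only multiplied by \<open>v\<close>
  and \<open>u\<close>, so their signs can be moved onto \<open>v\<close> and
  \<open>u\<close>.\<close>

lemma dih_fps_reflect:
  assumes "Re (z' ^ k) = s * Re (z ^ k)" "Im (z' ^ k) = s' * Im (z ^ k)" "cmod z' = cmod z"
  shows "dih_fps k z' w u v = dih_fps k z w (s' * u) (s * v)"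
  using assms by (simp add: dih_fps_def norm_mult mult_ac)

lemma sum_lessThan_even_odd:
  fixes f :: "nat \<Rightarrow> 'a :: comm_monoid_add"
  shows "(\<Sum>l<2 * k. f l) = (\<Sum>i<k. f (2 * i)) + (\<Sum>i<k. f (2 * i + 1))"
  by (induction k) (simp_all add: add_ac)

text \<open>The class sums \<open>G0\<close> and \<open>G1\<close> are \<open>?B\<close> divided by
  \<open>?T - D\<close> and \<open>?T + D\<close>, so this is
  \<open>key_identity_two_classes\<close> multiplied by \<open>?B\<close>, after clearing both
  denominators.\<close>

lemma key_two_classes:
  assumes k: "k \<ge> 1" and ab: "a > 0" "b > 0"
  defines "II \<equiv> uv_functional.II (nu_int2 a b)" and "W \<equiv> dih_weight ((b - a) / (a + b))"
  shows "(fps_const (real k) * cheb_fps k (cmod (z * w)) - fps_X * fps_deriv (cheb_fps k (cmod (z * w))))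
        * (fps_const (a + b) * II (\<lambda>u v. fps_const (W u v) * fps_npow (a + b + 1) (dih_fps k z w u v)))
      = (\<Sum>l<2 * k. fps_const (if even l then a else b)
          * II (\<lambda>u v. fps_const (W u v) * fps_npow (a + b) (dih_fps k (refl (2 * k) l z) w u v))
          * geom_fps (inner2 (refl (2 * k) l z) w))"
proof -
  let ?T = "cheb_fps k (cmod (z * w))" and ?t = "fps_const (2 / 2 ^ k) * fps_X ^ k :: real fps"
  let ?x = "Re (z ^ k) * Re (w ^ k)" and ?y = "Im (z ^ k) * Im (w ^ k)"
  let ?B = "fps_const (real k) * ?T - fps_X * fps_deriv ?T"
  define D where "D = fps_const (?x - ?y) * ?t"
  define H where "H = II (\<lambda>u v. fps_const (W u v) * fps_npow (a + b + 1) (dih_fps k z w u v))"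
  define M0 where "M0 = II (\<lambda>u v. fps_const (W u v) * fps_npow (a + b) (dih_fps k z w (- u) v))"
  define M1 where "M1 = II (\<lambda>u v. fps_const (W u v) * fps_npow (a + b) (dih_fps k z w u (- v)))"
  define G0 where "G0 = (\<Sum>i<k. geom_fps (inner2 (refl (2 * k) (2 * i) z) w))"
  define G1 where "G1 = (\<Sum>i<k. geom_fps (inner2 (refl (2 * k) (2 * i + 1) z) w))"
  have t0: "?t $ 0 = 0" using k by simp
  have key: "fps_const (a + b) * (?T - D) * (?T + D) * H = fps_const a * (?T + D) * M0 + fps_const b * (?T - D) * M1"
    using key_identity_two_classes[OF ab cheb_fps_nth_0 t0, of k "cmod (z * w)" ?x ?y]
    unfolding H_def M0_def M1_def D_def II_def W_def dih_fps_pencil .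
  have G0: "G0 * (?T - D) = ?B"
    unfolding G0_def D_def
  proof (rule sum_geom_class[OF k])
    fix i assume "i < k"
    show "inner2 (refl (2 * k) (2 * i) z) w = cmod (z * w) * cos ((- (real k * (Arg z + Arg w)) + 2 * pi * real i) / real k)"
      unfolding inner2_refl using k
      by (intro arg_cong2[where f = "(*)"] arg_cong[where f = cos] refl) (simp add: field_simps)
  qed (simp add: polar_power_cos)
  \<comment> \<open>Odd reflections shift the angle by \<open>pi / k\<close>, hence \<open>q\<close>
    by \<open>pi\<close>, which reverses the sign of \<open>D\<close>.\<close>
  have G1: "G1 * (?T + D) = ?B"
  proof -
    have "G1 * (?T - fps_const (- (?x - ?y)) * ?t) = ?B"
      unfolding G1_def
    proof (rule sum_geom_class[OF k])
      fix i assume "i < k"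
      show "inner2 (refl (2 * k) (2 * i + 1) z) w
          = cmod (z * w) * cos ((pi - real k * (Arg z + Arg w) + 2 * pi * real i) / real k)"
        unfolding inner2_refl using k
        by (intro arg_cong2[where f = "(*)"] arg_cong[where f = cos] refl) (simp add: field_simps)
    next
      show "cmod (z * w) ^ k * cos (pi - real k * (Arg z + Arg w)) = - (?x - ?y)"
        by (simp add: polar_power_cos cos_diff[of pi])
    qed
    then show ?thesis unfolding D_def fps_const_neg[symmetric] by (simp only: mult_minus_left diff_minus_eq_add)
  qed
  \<comment> \<open>On \<open>z^k\<close> the even class acts as conjugation and the odd class as
    its negative. Hence the former changes \<open>u\<close> to \<open>-u\<close> and the latter
    \<open>v\<close> to \<open>-v\<close>.\<close>
  have pow: "refl (2 * k) l z ^ k = cnj (z ^ k) * (if even l then 1 else - 1)" for l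
  proof -
    have "2 * pi * real l * real k / real (2 * k) = real l * pi" using k by simp
    then have "refl (2 * k) l z ^ k = cnj (z ^ k) * cis (real l * pi)" by (simp only: refl_power)
    also have "cis (real l * pi) = (if even l then 1 else - 1)"
      by (simp add: complex_eq_iff mult.commute[of _ pi] cos_npi sin_npi2)
    finally show ?thesis .
  qed
  have dih: "dih_fps k (refl (2 * k) l z) w u v = (if even l then dih_fps k z w (- u) v else dih_fps k z w u (- v))" for l u v
    using dih_fps_reflect[of "refl (2 * k) l z" k 1 z "-1"] dih_fps_reflect[of "refl (2 * k) l z" k "-1" z 1]
    by (simp add: pow del: complex_cnj_power)
  have "(\<Sum>l<2 * k. fps_const (if even l then a else b)
          * II (\<lambda>u v. fps_const (W u v) * fps_npow (a + b) (dih_fps k (refl (2 * k) l z) w u v))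
          * geom_fps (inner2 (refl (2 * k) l z) w))
      = (\<Sum>l<2 * k. if even l then fps_const a * M0 * geom_fps (inner2 (refl (2 * k) l z) w)
          else fps_const b * M1 * geom_fps (inner2 (refl (2 * k) l z) w))"
    by (intro sum.cong refl) (simp add: dih M0_def M1_def)
  also have "\<dots> = fps_const a * M0 * G0 + fps_const b * M1 * G1"
    unfolding sum_lessThan_even_odd G0_def G1_def by (simp add: sum_distrib_left)
  finally have rhs: "(\<Sum>l<2 * k. fps_const (if even l then a else b)
          * II (\<lambda>u v. fps_const (W u v) * fps_npow (a + b) (dih_fps k (refl (2 * k) l z) w u v))
          * geom_fps (inner2 (refl (2 * k) l z) w)) = fps_const a * M0 * G0 + fps_const b * M1 * G1" .
  have "(?T - D) * (?T + D) * (?B * (fps_const (a + b) * H)) = ?B * (fps_const (a + b) * (?T - D) * (?T + D) * H)"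
    by (simp only: mult_ac)
  also have "\<dots> = fps_const a * M0 * (?T + D) * ?B + fps_const b * M1 * (?T - D) * ?B"
    unfolding key by (simp only: distrib_left mult_ac)
  also have "\<dots> = fps_const a * M0 * (?T + D) * (G0 * (?T - D)) + fps_const b * M1 * (?T - D) * (G1 * (?T + D))"
    by (simp only: G0 G1)
  also have "\<dots> = (?T - D) * (?T + D) * (fps_const a * M0 * G0 + fps_const b * M1 * G1)"
    by (simp only: distrib_left mult_ac add_ac)
  finally have "(?T - D) * (?T + D) * (?B * (fps_const (a + b) * H))
      = (?T - D) * (?T + D) * (fps_const a * M0 * G0 + fps_const b * M1 * G1)" .
  \<comment> \<open>Constant term 1 makes both factors nonzero, so they can be cancelled.\<close>
  moreover have "(?T - D) $ 0 = 1" "(?T + D) $ 0 = 1" using k by (simp_all add: D_def)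
  then have "?T - D \<noteq> 0" "?T + D \<noteq> 0" by fastforce+
  ultimately have "?B * (fps_const (a + b) * H) = fps_const a * M0 * G0 + fps_const b * M1 * G1"
    by (simp only: mult_cancel_left) simp
  then show ?thesis unfolding rhs H_def .
qed

text \<open>Here every reflection acts on \<open>z^k\<close> as conjugation, so there is one class
  sum and only \<open>u\<close> changes sign.\<close>

lemma key_one_class:
  assumes k: "k \<ge> 1" and a: "a > 0"
  defines "II \<equiv> uv_functional.II (\<lambda>f. nu_int a (\<lambda>u. f u 1))"
  shows "(fps_const (real k) * cheb_fps k (cmod (z * w)) - fps_X * fps_deriv (cheb_fps k (cmod (z * w))))
        * (fps_const a * II (\<lambda>u v. fps_const (1 - u) * fps_npow (a + 1) (dih_fps k z w u v)))
      = (\<Sum>l<k. fps_const a * II (\<lambda>u v. fps_const (1 - u) * fps_npow a (dih_fps k (refl k l z) w u v))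
          * geom_fps (inner2 (refl k l z) w))"
proof -
  let ?T = "cheb_fps k (cmod (z * w))" and ?t = "fps_const (2 / 2 ^ k) * fps_X ^ k :: real fps"
  let ?x = "Re (z ^ k) * Re (w ^ k)" and ?y = "Im (z ^ k) * Im (w ^ k)"
  let ?B = "fps_const (real k) * ?T - fps_X * fps_deriv ?T"
  define D where "D = fps_const (?x - ?y) * ?t"
  define H where "H = II (\<lambda>u v. fps_const (1 - u) * fps_npow (a + 1) (dih_fps k z w u v))"
  define M where "M = II (\<lambda>u v. fps_const (1 - u) * fps_npow a (dih_fps k z w (- u) v))"
  define G where "G = (\<Sum>i<k. geom_fps (inner2 (refl k i z) w))"
  have t0: "?t $ 0 = 0" using k by simp
  have key: "fps_const a * (?T - D) * H = fps_const a * M"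
    using key_identity_one_class[OF a cheb_fps_nth_0 t0, of k "cmod (z * w)" ?x ?y]
    unfolding H_def M_def D_def II_def dih_fps_pencil .
  have G: "G * (?T - D) = ?B"
    unfolding G_def D_def
  proof (rule sum_geom_class[OF k])
    fix i assume "i < k"
    show "inner2 (refl k i z) w = cmod (z * w) * cos ((- (real k * (Arg z + Arg w)) + 2 * pi * real i) / real k)"
      unfolding inner2_refl using k
      by (intro arg_cong2[where f = "(*)"] arg_cong[where f = cos] refl) (simp add: field_simps)
  qed (simp add: polar_power_cos)
  have "refl k l z ^ k = cnj (z ^ k)" for l
  proof -
    have "2 * pi * real l * real k / real k = 2 * pi * real l" using k by simp
    then have "refl k l z ^ k = cnj (z ^ k) * cis (2 * pi * real l)" by (simp only: refl_power)
    then show ?thesis by (simp add: cis_multiple_2pi)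
  qed
  then have dih: "dih_fps k (refl k l z) w u v = dih_fps k z w (- u) v" for l u v
    using dih_fps_reflect[of "refl k l z" k 1 z "-1"] by (simp del: complex_cnj_power)
  have "(\<Sum>l<k. fps_const a * II (\<lambda>u v. fps_const (1 - u) * fps_npow a (dih_fps k (refl k l z) w u v))
          * geom_fps (inner2 (refl k l z) w)) = fps_const a * M * G"
    by (simp add: dih G_def sum_distrib_left M_def)
  moreover have "(?T - D) * (?B * (fps_const a * H)) = (?T - D) * (fps_const a * M * G)"
  proof -
    have "(?T - D) * (?B * (fps_const a * H)) = ?B * (fps_const a * (?T - D) * H)"
      by (simp only: mult_ac)
    also have "\<dots> = fps_const a * M * (G * (?T - D))" unfolding key G by (simp only: mult_ac)
    finally show ?thesis by (simp only: mult_ac)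
  qed
  moreover have "(?T - D) $ 0 = 1" using k by (simp add: D_def)
  then have "?T - D \<noteq> 0" by fastforce
  ultimately show ?thesis unfolding H_def by (simp only: mult_cancel_left) simp
qed

section \<open>Polynomials, Dunkl operators and regular points\<close>

lemma poly2_extend:
  assumes "\<And>z. p z = (\<Sum>i\<le>N. \<Sum>j\<le>N. c i j * Re z ^ i * Im z ^ j)" and "N \<le> N'"
  shows "p z = (\<Sum>i\<le>N'. \<Sum>j\<le>N'. (if i \<le> N \<and> j \<le> N then c i j else 0) * Re z ^ i * Im z ^ j)"
proof -
  let ?f = "\<lambda>i j. (if i \<le> N \<and> j \<le> N then c i j else 0) * Re z ^ i * Im z ^ j"
  have "p z = (\<Sum>i\<le>N. \<Sum>j\<le>N. ?f i j)" unfolding assms(1) by (intro sum.cong refl) auto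
  also have "\<dots> = (\<Sum>i\<le>N. \<Sum>j\<le>N'. ?f i j)"
    using assms(2) by (intro sum.cong refl sum.mono_neutral_left) auto
  also have "\<dots> = (\<Sum>i\<le>N'. \<Sum>j\<le>N'. ?f i j)"
    using assms(2) by (intro sum.mono_neutral_left) auto
  finally show ?thesis .
qed

lemma poly2_lin:
  assumes "poly2 p" "poly2 q"
  shows "poly2 (\<lambda>z. a * p z + b * q z)"
proof -
  from assms(1) obtain c N where c: "\<And>z. p z = (\<Sum>i\<le>N. \<Sum>j\<le>N. c i j * Re z ^ i * Im z ^ j)"
    unfolding poly2_def by blast
  from assms(2) obtain d N' where d: "\<And>z. q z = (\<Sum>i\<le>N'. \<Sum>j\<le>N'. d i j * Re z ^ i * Im z ^ j)"
    unfolding poly2_def by blast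
  let ?M = "max N N'"
  let ?e = "\<lambda>i j. a * (if i \<le> N \<and> j \<le> N then c i j else 0) + b * (if i \<le> N' \<and> j \<le> N' then d i j else 0)"
  have "a * p z + b * q z = (\<Sum>i\<le>?M. \<Sum>j\<le>?M. ?e i j * Re z ^ i * Im z ^ j)" for z
    unfolding poly2_extend[OF c, of ?M, simplified] poly2_extend[OF d, of ?M, simplified]
    by (simp only: sum_distrib_left sum.distrib distrib_right mult.assoc)
  then show ?thesis unfolding poly2_def by (intro exI[of _ ?e] exI[of _ ?M] allI)
qed

lemma poly2_monomial: "poly2 (\<lambda>z. Re z ^ i * Im z ^ j)"
proof -
  let ?N = "max i j"
  let ?c = "\<lambda>i' j'. if i' = i \<and> j' = j then 1 else (0::real)"
  have "Re z ^ i * Im z ^ j = (\<Sum>i'\<le>?N. \<Sum>j'\<le>?N. ?c i' j' * Re z ^ i' * Im z ^ j')" for z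
  proof -
    have "(\<Sum>j'\<le>?N. ?c i' j' * Re z ^ i' * Im z ^ j') = (if i' = i then Re z ^ i * Im z ^ j else 0)" for i'
      by (cases "i' = i") (simp_all add: if_distrib[of "\<lambda>x. x * _"] cong: if_cong)
    then show ?thesis by simp
  qed
  then show ?thesis unfolding poly2_def by (intro exI[of _ ?c] exI[of _ ?N] allI)
qed

lemma hom_poly2_monomial: "hom_poly2 (i + j) (\<lambda>z. Re z ^ i * Im z ^ j)"
  unfolding hom_poly2_def
  by (intro exI[of _ "\<lambda>i'. if i' = i then 1 else 0"])
     (simp add: if_distrib[of "\<lambda>x. x * _"] cong: if_cong)

lemma hom_poly2_continuous: "hom_poly2 m f \<Longrightarrow> continuous_on UNIV f"
  unfolding hom_poly2_def
proof (elim exE)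
  fix c assume "\<forall>z. f z = (\<Sum>i\<le>m. c i * Re z ^ i * Im z ^ (m - i))"
  then have "f = (\<lambda>z. \<Sum>i\<le>m. c i * Re z ^ i * Im z ^ (m - i))" by blast
  moreover have "continuous_on UNIV (\<lambda>z. \<Sum>i\<le>m. c i * Re z ^ i * Im z ^ (m - i))"
    by (intro continuous_intros)
  ultimately show ?thesis by simp
qed

lemma hom_poly2_euler:
  assumes "hom_poly2 m f"
  shows "Re z * pd 1 f z + Im z * pd \<i> f z = real m * f z"
proof -
  from assms obtain c where c: "\<And>z. f z = (\<Sum>i\<le>m. c i * Re z ^ i * Im z ^ (m - i))"
    unfolding hom_poly2_def by blast
  have "((\<lambda>t. f (z + complex_of_real t * 1)) has_real_derivative
      (\<Sum>i\<le>m. c i * (real i * Re z ^ (i - 1)) * Im z ^ (m - i))) (at 0)"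
    unfolding c by (auto intro!: derivative_eq_intros sum.cong)
  then have 1: "pd 1 f z = (\<Sum>i\<le>m. c i * (real i * Re z ^ (i - 1)) * Im z ^ (m - i))"
    unfolding pd_def by (rule DERIV_imp_deriv)
  have "((\<lambda>t. f (z + complex_of_real t * \<i>)) has_real_derivative
      (\<Sum>i\<le>m. c i * Re z ^ i * (real (m - i) * Im z ^ (m - i - 1)))) (at 0)"
    unfolding c by (auto intro!: derivative_eq_intros sum.cong)
  then have 2: "pd \<i> f z = (\<Sum>i\<le>m. c i * Re z ^ i * (real (m - i) * Im z ^ (m - i - 1)))"
    unfolding pd_def by (rule DERIV_imp_deriv)
  have pow: "x * (real n * x ^ (n - 1)) = real n * x ^ n" for x :: real and n by (cases n) auto
  have "Re z * pd 1 f z + Im z * pd \<i> f z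
      = (\<Sum>i\<le>m. c i * (Re z * (real i * Re z ^ (i - 1))) * Im z ^ (m - i)
          + c i * Re z ^ i * (Im z * (real (m - i) * Im z ^ (m - i - 1))))"
    unfolding 1 2 by (simp add: sum_distrib_left sum.distrib mult_ac)
  also have "\<dots> = (\<Sum>i\<le>m. real m * (c i * Re z ^ i * Im z ^ (m - i)))"
    unfolding pow by (intro sum.cong refl) (simp add: of_nat_diff algebra_simps)
  finally show ?thesis by (simp add: c sum_distrib_left)
qed

lemma pd_monomial:
  "pd 1 (\<lambda>z. Re z ^ i * Im z ^ j) = (\<lambda>z. real i * (Re z ^ (i - 1) * Im z ^ j))"
  "pd \<i> (\<lambda>z. Re z ^ i * Im z ^ j) = (\<lambda>z. real j * (Re z ^ i * Im z ^ (j - 1)))"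
  unfolding pd_def
  by (auto intro!: ext DERIV_imp_deriv derivative_eq_intros)

text \<open>In this combination the root coordinates add up to \<open>inner2 (root n l) z\<close>,
  which cancels the denominator and leaves plain differences.\<close>

lemma dunkl_euler:
  assumes "hom_poly2 m f" and reg: "\<forall>l<n. inner2 (root n l) z \<noteq> 0"
  shows "Re z * dunkl n kap 1 f z + Im z * dunkl n kap \<i> f z
    = real m * f z + (\<Sum>l<n. kap l * (f z - f (refl n l z)))"
proof -
  have "Re z * dunkl n kap 1 f z + Im z * dunkl n kap \<i> f z
      = (Re z * pd 1 f z + Im z * pd \<i> f z)
        + (\<Sum>l<n. kap l * (inner2 (root n l) 1 * Re z + inner2 (root n l) \<i> * Im z)
            * (f z - f (refl n l z)) / inner2 (root n l) z)"
    unfolding dunkl_def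
    by (simp add: distrib_left distrib_right sum_distrib_left sum.distrib add_divide_distrib mult_ac)
  also have "(\<Sum>l<n. kap l * (inner2 (root n l) 1 * Re z + inner2 (root n l) \<i> * Im z)
            * (f z - f (refl n l z)) / inner2 (root n l) z) = (\<Sum>l<n. kap l * (f z - f (refl n l z)))"
  proof (intro sum.cong refl)
    fix l assume "l \<in> {..<n}"
    moreover have "inner2 r 1 * Re z + inner2 r \<i> * Im z = inner2 r z" for r
      by (simp add: inner2_def)
    ultimately show "kap l * (inner2 (root n l) 1 * Re z + inner2 (root n l) \<i> * Im z)
        * (f z - f (refl n l z)) / inner2 (root n l) z = kap l * (f z - f (refl n l z))"
      using reg by simp
  qed
  finally show ?thesis using hom_poly2_euler[OF assms(1)] by simp
qed

text \<open>The mirrors have the directions \<open>pi l / n\<close>; the angle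
  \<open>-pi / (2 n)\<close> lies midway between two neighbouring ones.\<close>

lemma exists_regular_direction:
  assumes "n > 0"
  shows "\<exists>h. \<forall>l<n. inner2 (root n l) h \<noteq> 0"
proof (intro exI allI impI)
  fix l assume l: "l < n"
  let ?s = "pi * real l / real n + pi / (2 * real n)"
  have "inner2 (root n l) (cis (- (pi / (2 * real n)))) = Re (\<i> * cis ?s)"
    unfolding inner2_def root_def cis_conv_exp[symmetric] by (simp add: cis_cnj cis_mult mult.assoc)
  also have "\<dots> = - sin ?s" by simp
  also have "\<dots> \<noteq> 0"
  proof -
    have "?s = pi * ((2 * real l + 1) / (2 * real n))" using assms by (simp add: field_simps)
    also have "\<dots> < pi * 1"
      using l by (intro mult_strict_left_mono) (auto simp: field_simps)
    finally have "?s < pi" by simp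
    moreover have "?s > 0" using assms by (intro add_nonneg_pos) auto
    ultimately have "sin ?s > 0" by (rule sin_gt_zero[rotated])
    then show ?thesis by simp
  qed
  finally show "inner2 (root n l) (cis (- (pi / (2 * real n)))) \<noteq> 0" .
qed

text \<open>Regular points are dense: a small nonzero step from any \<open>z\<close> along a regular
  direction leaves every mirror.\<close>

lemma continuous_zero_on_regular:
  fixes E :: "complex \<Rightarrow> real"
  assumes n: "n > 0" and cont: "continuous_on UNIV E"
    and zero: "\<And>z. \<forall>l<n. inner2 (root n l) z \<noteq> 0 \<Longrightarrow> E z = 0"
  shows "E z = 0"
proof -
  obtain h where h: "\<forall>l<n. inner2 (root n l) h \<noteq> 0" using exists_regular_direction[OF n] by blast
  have "\<forall>\<^sub>F t in at (0::real). \<forall>l\<in>{..<n}. inner2 (root n l) (z + of_real t * h) \<noteq> 0"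
  proof (rule eventually_ball_finite, simp, intro ballI)
    fix l assume l: "l \<in> {..<n}"
    have lin: "inner2 (root n l) (z + of_real t * h) = inner2 (root n l) z + t * inner2 (root n l) h" for t
      by (simp add: inner2_def algebra_simps)
    show "\<forall>\<^sub>F t in at (0::real). inner2 (root n l) (z + of_real t * h) \<noteq> 0"
    proof (cases "inner2 (root n l) z = 0")
      case True
      then show ?thesis unfolding lin using h l by (auto simp: eventually_at_filter)
    next
      case False
      have "((\<lambda>t. inner2 (root n l) z + t * inner2 (root n l) h) \<longlongrightarrow> inner2 (root n l) z + 0 * inner2 (root n l) h) (at 0)"
        by (intro tendsto_intros)
      then show ?thesis unfolding lin using False by (intro tendsto_imp_eventually_ne) auto
    qed
  qed
  then have ev: "\<forall>\<^sub>F t in at (0::real). E (z + of_real t * h) = 0"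
    by (rule eventually_mono) (use zero in auto)
  have "((\<lambda>t::real. z + of_real t * h) \<longlongrightarrow> z + of_real 0 * h) (at 0)"
    by (intro tendsto_intros)
  then have "((\<lambda>t::real. E (z + of_real t * h)) \<longlongrightarrow> E (z + of_real 0 * h)) (at 0)"
    using cont by (intro continuous_on_tendsto_compose[OF cont]) auto
  then have "((\<lambda>t::real. 0) \<longlongrightarrow> E z) (at (0::real))"
    using ev by (subst (asm) tendsto_cong[OF ev]) simp
  then show ?thesis by (metis tendsto_const tendsto_unique trivial_limit_at)
qed

text \<open>The maximum of \<open>\<bar>g\<bar>\<close> on a circle around \<open>0\<close> is attained, and the reflections preserve
  the circle.\<close>
lemma reflection_maximum_principle:
  fixes g :: "complex \<Rightarrow> real"
  assumes cont: "continuous_on UNIV g" and kap: "\<And>l. l < n \<Longrightarrow> kap l \<ge> 0" and m: "m > 0"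
    and eq: "\<And>z. ((\<Sum>l<n. kap l) + m) * g z = (\<Sum>l<n. kap l * g (refl n l z))"
  shows "g z = 0"
proof -
  have "\<exists>x\<in>sphere 0 (cmod z). \<forall>y\<in>sphere 0 (cmod z). \<bar>g y\<bar> \<le> \<bar>g x\<bar>"
    by (intro continuous_attains_sup continuous_on_rabs continuous_on_subset[OF cont]) auto
  then obtain x where x: "cmod x = cmod z" "\<And>y. cmod y = cmod z \<Longrightarrow> \<bar>g y\<bar> \<le> \<bar>g x\<bar>" by auto
  have norm_refl: "cmod (refl n l x) = cmod z" for l
    using x(1) by simp
  have "((\<Sum>l<n. kap l) + m) * \<bar>g x\<bar> = \<bar>\<Sum>l<n. kap l * g (refl n l x)\<bar>"
  proof -
    have "(\<Sum>l<n. kap l) + m \<ge> 0" using kap m by (intro add_nonneg_nonneg sum_nonneg) auto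
    then show ?thesis unfolding eq[symmetric] by (simp add: abs_mult)
  qed
  also have "\<dots> \<le> (\<Sum>l<n. \<bar>kap l * g (refl n l x)\<bar>)" by (rule sum_abs)
  also have "\<dots> \<le> (\<Sum>l<n. kap l * \<bar>g x\<bar>)"
    using kap x(2)[OF norm_refl] by (intro sum_mono) (auto simp: abs_mult intro!: mult_left_mono)
  also have "\<dots> = (\<Sum>l<n. kap l) * \<bar>g x\<bar>" by (simp add: sum_distrib_right)
  finally have "m * \<bar>g x\<bar> \<le> 0" by (simp add: distrib_right)
  then have "\<bar>g x\<bar> = 0" using m by (simp add: mult_le_0_iff)
  then show ?thesis using x(2)[of z] by simp
qed

section \<open>Uniqueness of the intertwiner\<close>

lemma homogeneous_coeffs_eq:
  assumes "\<And>s::real. (\<Sum>i\<le>m. a i * s ^ i) = (\<Sum>i\<le>m. b i * s ^ i)" "i \<le> m"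
  shows "a i = (b i :: real)"
  using polyfun_eq_coeffs[of a m b] assms by auto

lemma continuous_on_refl: "continuous_on UNIV (refl n l)"
  unfolding refl_def[abs_def] by (intro continuous_intros)

lemma
  assumes "is_intertwiner n kap V"
  shows intertwiner_lin: "poly2 p \<Longrightarrow> poly2 q \<Longrightarrow> V (\<lambda>z. a * p z + b * q z) = (\<lambda>z. a * V p z + b * V q z)"
    and intertwiner_hom: "hom_poly2 m p \<Longrightarrow> hom_poly2 m (V p)"
    and intertwiner_one: "V (\<lambda>_. 1) = (\<lambda>_. 1)"
    and intertwiner_dunkl: "poly2 p \<Longrightarrow> xi \<in> {1, \<i>} \<Longrightarrow> \<forall>l<n. inner2 (root n l) z \<noteq> 0 \<Longrightarrow>
      dunkl n kap xi (V p) z = V (pd xi p) z"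
  using assms unfolding is_intertwiner_def by (elim conjE; simp only:)+

text \<open>Comparison of coefficients in \<open>w\<close>. On the line \<open>Im w = 1\<close> both
  homogeneous sides become polynomials in \<open>s = Re w\<close> with the same
  coefficients.\<close>

lemma recursion_coefficients:
  fixes B :: "nat \<Rightarrow> nat \<Rightarrow> complex \<Rightarrow> real"
  defines "K \<equiv> \<lambda>m z w. \<Sum>i\<le>m. B i (m - i) z * (Re w ^ i * Im w ^ (m - i))"
  assumes rec: "\<And>m z w. m \<ge> 1 \<Longrightarrow>
      (s0 + real m) * K m z w - (\<Sum>l<n. kap l * K m (refl n l z) w) = inner2 z w * K (m - 1) z w"
    and ij: "i + j \<ge> 1"
  shows "(s0 + real (i + j)) * B i j z - (\<Sum>l<n. kap l * B i j (refl n l z))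
      = (if i = 0 then 0 else Re z * B (i - 1) j z) + (if j = 0 then 0 else Im z * B i (j - 1) z)"
proof -
  obtain m where m: "i + j = Suc m" using ij by (metis not0_implies_Suc not_one_le_zero)
  define L where "L i' = (s0 + real (Suc m)) * B i' (Suc m - i') z - (\<Sum>l<n. kap l * B i' (Suc m - i') (refl n l z))" for i'
  define R where "R i' = (if i' = 0 then 0 else Re z * B (i' - 1) (Suc m - i') z)
      + (if Suc m - i' = 0 then 0 else Im z * B i' (m - i') z)" for i'
  have "(\<Sum>i'\<le>Suc m. L i' * s ^ i') = (\<Sum>i'\<le>Suc m. R i' * s ^ i')" for s
  proof -
    have "(\<Sum>i'\<le>Suc m. L i' * s ^ i')
        = (s0 + real (Suc m)) * K (Suc m) z (Complex s 1) - (\<Sum>l<n. kap l * K (Suc m) (refl n l z) (Complex s 1))"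
    proof -
      have "(\<Sum>l<n. kap l * K (Suc m) (refl n l z) (Complex s 1))
          = (\<Sum>l<n. \<Sum>i'\<le>Suc m. kap l * B i' (Suc m - i') (refl n l z) * s ^ i')"
        unfolding K_def by (simp add: sum_distrib_left mult.assoc del: sum.atMost_Suc)
      also have "\<dots> = (\<Sum>i'\<le>Suc m. \<Sum>l<n. kap l * B i' (Suc m - i') (refl n l z) * s ^ i')"
        by (rule sum.swap)
      also have "\<dots> = (\<Sum>i'\<le>Suc m. (\<Sum>l<n. kap l * B i' (Suc m - i') (refl n l z)) * s ^ i')"
        by (simp only: sum_distrib_right)
      finally have "(\<Sum>l<n. kap l * K (Suc m) (refl n l z) (Complex s 1))
          = (\<Sum>i'\<le>Suc m. (\<Sum>l<n. kap l * B i' (Suc m - i') (refl n l z)) * s ^ i')" .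
      moreover have "(s0 + real (Suc m)) * K (Suc m) z (Complex s 1)
          = (\<Sum>i'\<le>Suc m. (s0 + real (Suc m)) * B i' (Suc m - i') z * s ^ i')"
        unfolding K_def sum_distrib_left by (simp add: mult.assoc del: sum.atMost_Suc)
      ultimately show ?thesis
        unfolding L_def left_diff_distrib sum_subtractf by (simp only:)
    qed
    also have "\<dots> = inner2 z (Complex s 1) * K m z (Complex s 1)"
      using rec[of "Suc m" z "Complex s 1"] unfolding diff_Suc_1 by (simp only: le_add1 Suc_eq_plus1_left)
    also have "\<dots> = (\<Sum>i'\<le>m. (Re z * B i' (m - i') z) * s ^ Suc i') + (\<Sum>i'\<le>m. (Im z * B i' (m - i') z) * s ^ i')"
      unfolding K_def inner2_def by (simp add: distrib_left distrib_right sum_distrib_left sum.distrib mult_ac)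
    \<comment> \<open>Multiplication by \<open>Re w\<close> shifts the index and that by
      \<open>Im w = 1\<close> does not. Both sums are extended to \<open>Suc m\<close>; the added
      terms are the zero cases of \<open>R\<close>.\<close>
    also have "(\<Sum>i'\<le>m. (Re z * B i' (m - i') z) * s ^ Suc i')
        = (\<Sum>i'\<le>Suc m. (if i' = 0 then 0 else Re z * B (i' - 1) (Suc m - i') z) * s ^ i')"
      unfolding sum.atMost_Suc_shift by simp
    also have "(\<Sum>i'\<le>m. (Im z * B i' (m - i') z) * s ^ i')
        = (\<Sum>i'\<le>Suc m. (if Suc m - i' = 0 then 0 else Im z * B i' (m - i') z) * s ^ i')"
      by simp
    finally show ?thesis unfolding R_def distrib_right sum.distrib .
  qed
  then have "L i = R i"
    by (rule homogeneous_coeffs_eq[where m = "Suc m"]) (use m in linarith)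
  moreover have "Suc m - i = j" "m - i = j - 1" using m by linarith+
  ultimately show ?thesis unfolding L_def R_def m by (simp only:)
qed

text \<open>The factorials come from expanding \<open><z, w>^m / m!\<close> into
  \<open>z_1^i z_2^j w_1^i w_2^j / (i! j!)\<close>. By induction on the degree, the difference of
  the two sides solves the homogeneous recursion, so the maximum principle makes it vanish.\<close>

theorem intertwiner_monomial:
  fixes B :: "nat \<Rightarrow> nat \<Rightarrow> complex \<Rightarrow> real"
  assumes V: "is_intertwiner n kap V" and n: "n > 0" and kap: "\<And>l. l < n \<Longrightarrow> kap l \<ge> 0"
    and cont: "\<And>i j. continuous_on UNIV (B i j)" and B0: "\<And>z. B 0 0 z = 1"
  defines "K \<equiv> \<lambda>m z w. \<Sum>i\<le>m. B i (m - i) z * (Re w ^ i * Im w ^ (m - i))"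
  assumes rec: "\<And>m z w. m \<ge> 1 \<Longrightarrow>
      ((\<Sum>l<n. kap l) + real m) * K m z w - (\<Sum>l<n. kap l * K m (refl n l z) w) = inner2 z w * K (m - 1) z w"
  shows "V (\<lambda>z. Re z ^ i * Im z ^ j) z = fact i * fact j * B i j z"
proof -
  let ?k = "\<Sum>l<n. kap l"
  have rec': "(?k + real (i + j)) * B i j z - (\<Sum>l<n. kap l * B i j (refl n l z))
      = (if i = 0 then 0 else Re z * B (i - 1) j z) + (if j = 0 then 0 else Im z * B i (j - 1) z)"
    if "i + j \<ge> 1" for i j z
    using recursion_coefficients[OF rec[unfolded K_def] that] .
  have lin: "V (\<lambda>z. c * p z) = (\<lambda>z. c * V p z)" if "poly2 p" for c p
  proof -
    have "V (\<lambda>z. c * p z + 0 * p z) = (\<lambda>z. c * V p z + 0 * V p z)"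
      by (rule intertwiner_lin[OF V that that])
    then show ?thesis by simp
  qed
  have "\<forall>i j. i + j = m \<longrightarrow> (\<forall>z. V (\<lambda>z. Re z ^ i * Im z ^ j) z = fact i * fact j * B i j z)" for m
  proof (induction m)
    case 0
    show ?case using intertwiner_one[OF V] B0 by simp
  next
    case (Suc m)
    show ?case
    proof (intro allI impI)
      fix i j :: nat and z assume ij: "i + j = Suc m"
      define f where "f = V (\<lambda>z. Re z ^ i * Im z ^ j)"
      define g where "g z = f z - fact i * fact j * B i j z" for z
      have hom: "hom_poly2 (i + j) f"
        unfolding f_def by (intro intertwiner_hom[OF V] hom_poly2_monomial)
      have g_cont: "continuous_on UNIV g"
        unfolding g_def by (intro continuous_intros cont hom_poly2_continuous[OF hom])
      have pd1: "V (pd 1 (\<lambda>z. Re z ^ i * Im z ^ j)) z = fact i * fact j * (if i = 0 then 0 else B (i - 1) j z)" for z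
      proof -
        have "V (pd 1 (\<lambda>z. Re z ^ i * Im z ^ j)) z = real i * V (\<lambda>z. Re z ^ (i - 1) * Im z ^ j) z"
          by (simp only: pd_monomial lin[OF poly2_monomial])
        then show ?thesis using Suc.IH ij by (cases i) (simp_all del: of_nat_Suc)
      qed
      have pd2: "V (pd \<i> (\<lambda>z. Re z ^ i * Im z ^ j)) z = fact i * fact j * (if j = 0 then 0 else B i (j - 1) z)" for z
      proof -
        have "V (pd \<i> (\<lambda>z. Re z ^ i * Im z ^ j)) z = real j * V (\<lambda>z. Re z ^ i * Im z ^ (j - 1)) z"
          by (simp only: pd_monomial lin[OF poly2_monomial])
        then show ?thesis using Suc.IH ij by (cases j) (simp_all del: of_nat_Suc)
      qed
      \<comment> \<open>Off the mirrors the intertwining relation, contracted by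
        \<open>dunkl_euler\<close>, is a recursion for \<open>f\<close>; by the induction hypothesis
        its right side agrees with that of \<open>rec'\<close>.\<close>
      have reg: "(?k + real (i + j)) * g z - (\<Sum>l<n. kap l * g (refl n l z)) = 0"
        if z: "\<forall>l<n. inner2 (root n l) z \<noteq> 0" for z
      proof -
        have T: "dunkl n kap xi f z = V (pd xi (\<lambda>z. Re z ^ i * Im z ^ j)) z" if "xi \<in> {1, \<i>}" for xi
          unfolding f_def by (rule intertwiner_dunkl[OF V poly2_monomial that z])
        have "real (i + j) * f z + (\<Sum>l<n. kap l * (f z - f (refl n l z)))
            = Re z * V (pd 1 (\<lambda>z. Re z ^ i * Im z ^ j)) z + Im z * V (pd \<i> (\<lambda>z. Re z ^ i * Im z ^ j)) z"
          using dunkl_euler[OF hom z, of kap] T[of 1] T[of \<i>] by simp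
        also have "\<dots> = fact i * fact j * ((?k + real (i + j)) * B i j z - (\<Sum>l<n. kap l * B i j (refl n l z)))"
          unfolding pd1 pd2 using rec'[of i j z] ij by (simp add: algebra_simps)
        finally show ?thesis
          unfolding g_def
          by (simp add: algebra_simps sum_subtractf sum.distrib sum_distrib_left sum_distrib_right)
      qed
      \<comment> \<open>Continuity extends the equation to the mirrors.\<close>
      have "(?k + real (i + j)) * g z - (\<Sum>l<n. kap l * g (refl n l z)) = 0" for z
        by (rule continuous_zero_on_regular[OF n _ reg])
           (auto intro!: continuous_on_diff continuous_on_sum continuous_on_mult continuous_on_const g_cont
              continuous_on_compose2[OF g_cont] continuous_on_refl)
      then have eq: "(?k + real (i + j)) * g z = (\<Sum>l<n. kap l * g (refl n l z))" for z
        by (simp only: right_minus_eq)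
      have "g z = 0"
        by (rule reflection_maximum_principle[OF g_cont kap _ eq]) (use ij in simp_all)
      then show "V (\<lambda>z. Re z ^ i * Im z ^ j) z = fact i * fact j * B i j z"
        by (simp add: g_def f_def)
    qed
  qed
  then show ?thesis by blast
qed

lemma intertwiner_sum:
  assumes V: "is_intertwiner n kap V" and "finite S"
  shows "poly2 (\<lambda>z. \<Sum>s\<in>S. c s * (Re z ^ fst s * Im z ^ snd s)) \<and>
    V (\<lambda>z. \<Sum>s\<in>S. c s * (Re z ^ fst s * Im z ^ snd s))
      = (\<lambda>z. \<Sum>s\<in>S. c s * V (\<lambda>z. Re z ^ fst s * Im z ^ snd s) z)"
  using assms(2)
proof (induction S rule: finite_induct)
  case empty
  have lin: "V (\<lambda>z. 0 * p z + 0 * p z) = (\<lambda>z. 0 * V p z + 0 * V p z)" if "poly2 p" for p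
    by (rule intertwiner_lin[OF V that that])
  show ?case
    using lin[OF poly2_monomial] poly2_lin[OF poly2_monomial poly2_monomial, of 0 _ _ 0] by simp
next
  case (insert x F)
  let ?m = "\<lambda>z. Re z ^ fst x * Im z ^ snd x" and ?r = "\<lambda>z. \<Sum>s\<in>F. c s * (Re z ^ fst s * Im z ^ snd s)"
  have r: "poly2 ?r" using insert.IH by blast
  have "V (\<lambda>z. c x * ?m z + 1 * ?r z) = (\<lambda>z. c x * V ?m z + 1 * V ?r z)"
    by (rule intertwiner_lin[OF V poly2_monomial r])
  moreover have "poly2 (\<lambda>z. c x * ?m z + 1 * ?r z)"
    by (intro poly2_lin poly2_monomial r)
  ultimately show ?case using insert by simp
qed

lemma intertwiner_poly:
  assumes V: "is_intertwiner n kap V" and p: "\<forall>w. p w = (\<Sum>i\<le>N. \<Sum>j\<le>N. c i j * Re w ^ i * Im w ^ j)"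
  shows "V p z = (\<Sum>i\<le>N. \<Sum>j\<le>N. c i j * V (\<lambda>z. Re z ^ i * Im z ^ j) z)"
proof -
  have "p = (\<lambda>z. \<Sum>s\<in>{..N} \<times> {..N}. c (fst s) (snd s) * (Re z ^ fst s * Im z ^ snd s))"
    by (rule ext) (simp add: p sum.cartesian_product case_prod_unfold mult.assoc)
  then show ?thesis
    using intertwiner_sum[OF V, of "{..N} \<times> {..N}" "\<lambda>s. c (fst s) (snd s)"]
    by (simp add: sum.cartesian_product case_prod_unfold)
qed

section \<open>Identification of the intertwiner with the integral\<close>

lemma (in uv_functional) I_continuous: "uv_poly e \<Longrightarrow> continuous_on UNIV (\<lambda>z. I (e z))"
proof (induction rule: uv_poly.induct)
  case (mono c p q)
  have "uv_fun (\<lambda>u v. u ^ p * v ^ q)" using uv_poly.mono[of "\<lambda>_. 1" p q] by simp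
  then have "I (\<lambda>u v. c z * (u ^ p * v ^ q)) = c z * I (\<lambda>u v. u ^ p * v ^ q)" for z by (rule I_cmult)
  then have "(\<lambda>z. I (\<lambda>u v. c z * u ^ p * v ^ q)) = (\<lambda>z. c z * I (\<lambda>u v. u ^ p * v ^ q))"
    by (simp add: mult.assoc)
  then show ?case using mono by (simp only:) (intro continuous_on_mult continuous_on_const)
next
  case (add e f)
  have "(\<lambda>z. I (\<lambda>u v. e z u v + f z u v)) = (\<lambda>z. I (e z) + I (f z))"
    by (intro ext I_add uv_poly_freeze add.hyps)
  then show ?case using add.IH by (simp only:) (rule continuous_on_add)
qed

text \<open>\<open>W1\<close> starts the recursion at degree 0, \<open>kap_sum\<close> matches its
  leading factor with that of \<open>hom_part_recursion\<close>, and \<open>I_cong\<close> restricts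
  attention to the square, where the power series of \<open>h_g\<close> is available.\<close>

theorem (in uv_functional) intertwiner_integral:
  fixes W :: "real \<Rightarrow> real \<Rightarrow> real" and kap :: "nat \<Rightarrow> real"
  assumes k: "k \<ge> 1" and g: "g > 0" and W: "uv_fun W" and W1: "I W = 1"
    and n: "n > 0" and kap: "\<And>l. l < n \<Longrightarrow> kap l \<ge> 0" and kap_sum: "(\<Sum>l<n. kap l) = real k * g"
    and I_cong: "\<And>f f'. uv_fun f \<Longrightarrow> (\<And>u v. \<bar>u\<bar> \<le> 1 \<Longrightarrow> \<bar>v\<bar> \<le> 1 \<Longrightarrow> f' u v = f u v) \<Longrightarrow> I f' = I f"
    and key: "\<And>z w. (fps_const (real k) * cheb_fps k (cmod (z * w)) - fps_X * fps_deriv (cheb_fps k (cmod (z * w))))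
        * (fps_const g * II (\<lambda>u v. fps_const (W u v) * fps_npow (g + 1) (dih_fps k z w u v)))
      = (\<Sum>l<n. fps_const (kap l) * II (\<lambda>u v. fps_const (W u v) * fps_npow g (dih_fps k (refl n l z) w u v))
          * geom_fps (inner2 (refl n l z) w))"
    and V: "is_intertwiner n kap V" and p: "\<forall>w. p w = (\<Sum>i\<le>N. \<Sum>j\<le>N. c i j * Re w ^ i * Im w ^ j)"
  shows "V p z = I (\<lambda>u v. W u v * Pfun c N k g z u v)"
proof (rule hfun_power_series[OF k g])
  fix e
  assume e: "\<And>i j. uv_poly (e i j)"
    "\<And>n z w u v. hom_part k g n z w u v = (\<Sum>i\<le>n. e i (n - i) z u v * (Re w ^ i * Im w ^ (n - i)))"
    "\<And>z u v. \<bar>u\<bar> \<le> 1 \<Longrightarrow> \<bar>v\<bar> \<le> 1 \<Longrightarrow> power_series2 (\<lambda>i j. e i j z u v) (\<lambda>w. hfun k g z w u v)"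
  define B where "B i j z = I (\<lambda>u v. W u v * e i j z u v)" for i j z
  have We: "uv_poly (\<lambda>z u v. W u v * e i j z u v)" for i j by (intro uv_poly_mult W e)
  have We': "uv_fun (\<lambda>u v. W u v * e i j z u v)" for i j z using uv_poly_freeze[OF We] .
  have K: "I (\<lambda>u v. W u v * hom_part k g m z w u v) = (\<Sum>i\<le>m. B i (m - i) z * (Re w ^ i * Im w ^ (m - i)))" for m z w
  proof -
    have "I (\<lambda>u v. W u v * hom_part k g m z w u v)
        = I (\<lambda>u v. \<Sum>i\<le>m. (Re w ^ i * Im w ^ (m - i)) * (W u v * e i (m - i) z u v))"
      by (rule arg_cong[where f = I], intro ext) (simp add: e(2) sum_distrib_left mult_ac)
    also have "\<dots> = (\<Sum>i\<le>m. I (\<lambda>u v. (Re w ^ i * Im w ^ (m - i)) * (W u v * e i (m - i) z u v)))"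
      by (intro I_sum uv_poly_mult uv_fun_const We'[unfolded B_def]) simp
    also have "\<dots> = (\<Sum>i\<le>m. B i (m - i) z * (Re w ^ i * Im w ^ (m - i)))"
      by (simp add: I_cmult[OF We'] B_def mult.commute)
    finally show ?thesis .
  qed
  have mono: "V (\<lambda>z. Re z ^ i * Im z ^ j) z = fact i * fact j * B i j z" for i j z
  proof (rule intertwiner_monomial[OF V n kap])
    show "continuous_on UNIV (B i j)" for i j unfolding B_def[abs_def] by (intro I_continuous We)
    show "B 0 0 z = 1" for z
    proof -
      \<comment> \<open>The part of degree 0 is the constant 1, so \<open>w = 0\<close> is an
        arbitrary choice.\<close>
      have "B 0 0 z = I (\<lambda>u v. W u v * hom_part k g 0 z 0 u v)" by (simp add: K)
      also have "\<dots> = 1" using W1 by (simp add: hom_part_def)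
      finally show ?thesis .
    qed
    show "((\<Sum>l<n. kap l) + real m) * (\<Sum>i\<le>m. B i (m - i) z * (Re w ^ i * Im w ^ (m - i)))
        - (\<Sum>l<n. kap l * (\<Sum>i\<le>m. B i (m - i) (refl n l z) * (Re w ^ i * Im w ^ (m - i))))
        = inner2 z w * (\<Sum>i\<le>m - 1. B i (m - 1 - i) z * (Re w ^ i * Im w ^ (m - 1 - i)))" if "m \<ge> 1" for m z w
      using hom_part_recursion[OF k g W that key] unfolding K kap_sum .
  qed
  have sum1: "I (\<lambda>u v. \<Sum>s\<in>{..N} \<times> {..N}. (c (fst s) (snd s) * (fact (fst s) * fact (snd s))) * (W u v * e (fst s) (snd s) z u v))
      = (\<Sum>s\<in>{..N} \<times> {..N}. (c (fst s) (snd s) * (fact (fst s) * fact (snd s))) * B (fst s) (snd s) z)"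
    unfolding B_def by (subst I_sum) (auto intro!: uv_poly_mult uv_fun_const We' simp: I_cmult[OF We'])
  \<comment> \<open>On the square the derivatives in \<open>Pfun\<close> are factorials times the
    coefficients \<open>e i j\<close>, so the integrand agrees there with a polynomial in
    \<open>u, v\<close>.\<close>
  have "I (\<lambda>u v. W u v * Pfun c N k g z u v)
      = I (\<lambda>u v. \<Sum>s\<in>{..N} \<times> {..N}. (c (fst s) (snd s) * (fact (fst s) * fact (snd s))) * (W u v * e (fst s) (snd s) z u v))"
  proof (rule I_cong)
    show "uv_fun (\<lambda>u v. \<Sum>s\<in>{..N} \<times> {..N}. (c (fst s) (snd s) * (fact (fst s) * fact (snd s))) * (W u v * e (fst s) (snd s) z u v))"
      by (intro uv_poly_sum uv_poly_mult uv_fun_const We') simp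
    fix u v :: real assume "\<bar>u\<bar> \<le> 1" "\<bar>v\<bar> \<le> 1"
    from Pfun_eq[OF e(3)[OF this]]
    show "W u v * Pfun c N k g z u v
        = (\<Sum>s\<in>{..N} \<times> {..N}. (c (fst s) (snd s) * (fact (fst s) * fact (snd s))) * (W u v * e (fst s) (snd s) z u v))"
      by (simp add: sum.cartesian_product case_prod_unfold sum_distrib_left mult_ac)
  qed
  also note sum1
  also have "(\<Sum>s\<in>{..N} \<times> {..N}. (c (fst s) (snd s) * (fact (fst s) * fact (snd s))) * B (fst s) (snd s) z) = V p z"
    unfolding intertwiner_poly[OF V p] mono by (simp add: sum.cartesian_product case_prod_unfold mult_ac)
  finally show ?thesis ..
qed

lemma nu_int_cong:
  assumes "\<And>u. \<bar>u\<bar> \<le> 1 \<Longrightarrow> f u = g u"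
  shows "nu_int a f = nu_int a g"
  unfolding nu_int_def using assms by (intro set_lebesgue_integral_cong) (auto simp: abs_le_iff)

lemma nu_int_id: "a > 0 \<Longrightarrow> nu_int a (\<lambda>u. u) = 0"
  using nu_int_reflect[of a "\<lambda>u. u"] nu_int_cmult[of a "-1" "\<lambda>u. u"] by (simp add: continuous_on_id)

text \<open>All terms but the constant 1 are odd in \<open>u\<close> or in \<open>v\<close> and
  integrate to zero.\<close>

lemma nu_int2_dih_weight:
  assumes ab: "a > 0" "b > 0"
  shows "nu_int2 a b (dih_weight e) = 1"
proof -
  interpret uv_functional "nu_int2 a b" by (rule uv_functional_nu_int2[OF ab])
  have u: "nu_int2 a b (\<lambda>u v. u * f v) = 0" for f
  proof -
    have "nu_int2 a b (\<lambda>u v. u * f v) = nu_int b (\<lambda>v. 0)"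
    proof -
      have "nu_int a (\<lambda>u. u * f v) = 0" for v
        using nu_int_cmult[of a "f v" "\<lambda>u. u"] by (simp add: mult.commute[of _ "f v"] nu_int_id ab)
      then show ?thesis by (simp add: nu_int2_def)
    qed
    then show ?thesis using nu_int_cmult[of b 0 "\<lambda>_. 0"] by simp
  qed
  have v: "nu_int2 a b (\<lambda>u v. v) = 0"
    using nu_int_cmult[of a _ "\<lambda>_. 1"] by (simp add: nu_int2_def nu_int_one nu_int_id ab)
  have "dih_weight e = (\<lambda>u v. 1 + (u * (e - v) - e * v))"
    by (intro ext) (simp add: dih_weight_def algebra_simps)
  then have "nu_int2 a b (dih_weight e) = nu_int2 a b (\<lambda>u v. 1) + (nu_int2 a b (\<lambda>u v. u * (e - v)) - nu_int2 a b (\<lambda>u v. e * v))"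
    by (simp only: I_add I_diff uv_fun_intros)
  then show ?thesis by (simp add: u v nu_int2_one ab nu_int2_cmult)
qed

lemma weight_eq_dih_weight:
  assumes "a > 0" "b > (0::real)"
  shows "(1 + u) * (1 + v) - 2 / (a + b) * (a * u * (1 + v) + b * v * (1 + u)) = dih_weight ((b - a) / (a + b)) u v"
proof -
  have "a + b \<noteq> 0" using assms by simp
  then show ?thesis unfolding dih_weight_def by (simp add: field_simps)
qed

theorem mainTheorem17:
  shows
  "(\<forall>k gam z u v. k \<ge> 1 \<longrightarrow> gam > 0 \<longrightarrow> u \<in> {-1..1} \<longrightarrow> v \<in> {-1..1} \<longrightarrow>
      (\<exists>b::nat \<Rightarrow> nat \<Rightarrow> real. \<forall>w.
         ((\<lambda>(i, j). b i j * Re w ^ i * Im w ^ j) has_sum hfun k gam z w u v) UNIV))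
 \<and> (\<forall>(k::nat) (a::real) (b::real) V (c::nat \<Rightarrow> nat \<Rightarrow> real) N p z.
      k \<ge> 1 \<longrightarrow> a > 0 \<longrightarrow> b > 0 \<longrightarrow>
      is_intertwiner (2 * k) (\<lambda>j. if even j then a else b) V \<longrightarrow>
      (\<forall>w. p w = (\<Sum>i\<le>N. \<Sum>j\<le>N. c i j * Re w ^ i * Im w ^ j)) \<longrightarrow>
      V p z = (LBINT v:{-1..1}. (LBINT u:{-1..1}.
         ((1 + u) * (1 + v) - 2 / (a + b) * (a * u * (1 + v) + b * v * (1 + u)))
           * Pfun c N k (a + b) z u v * nu_dens a u) * nu_dens b v))
 \<and> (\<forall>(k::nat) (a::real) V (c::nat \<Rightarrow> nat \<Rightarrow> real) N p z.
      k \<ge> 3 \<longrightarrow> odd k \<longrightarrow> a > 0 \<longrightarrow>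
      is_intertwiner k (\<lambda>j. a) V \<longrightarrow>
      (\<forall>w. p w = (\<Sum>i\<le>N. \<Sum>j\<le>N. c i j * Re w ^ i * Im w ^ j)) \<longrightarrow>
      V p z = (LBINT u:{-1..1}. Pfun c N k a z u 1 * (1 - u) * nu_dens a u))"
proof (intro conjI allI impI)
  fix k :: nat and gam u v :: real and z :: complex
  assume k: "k \<ge> 1" and gam: "gam > 0" and "u \<in> {-1..1}" "v \<in> {-1..1}"
  then have uv: "\<bar>u\<bar> \<le> 1" "\<bar>v\<bar> \<le> 1" by auto
  have "\<exists>b. power_series2 b (\<lambda>w. hfun k gam z w u v)"
    by (rule hfun_power_series[OF k gam]) (use uv in blast)
  then show "\<exists>b::nat \<Rightarrow> nat \<Rightarrow> real. \<forall>w.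
         ((\<lambda>(i, j). b i j * Re w ^ i * Im w ^ j) has_sum hfun k gam z w u v) UNIV"
    unfolding power_series2_def .
next
  fix k :: nat and a b :: real and V c N p z
  assume k: "k \<ge> 1" and ab: "a > 0" "b > 0"
    and V: "is_intertwiner (2 * k) (\<lambda>j. if even j then a else b) V"
    and p: "\<forall>w. p w = (\<Sum>i\<le>N. \<Sum>j\<le>N. c i j * Re w ^ i * Im w ^ j)"
  interpret uv_functional "nu_int2 a b" by (rule uv_functional_nu_int2[OF ab])
  let ?W = "dih_weight ((b - a) / (a + b))"
  have "V p z = nu_int2 a b (\<lambda>u v. ?W u v * Pfun c N k (a + b) z u v)"
  proof (rule intertwiner_integral[OF k _ _ _ _ _ _ _ key_two_classes[OF k ab] V p])
    show "uv_fun ?W" unfolding dih_weight_def by (intro uv_fun_intros)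
    show "nu_int2 a b f' = nu_int2 a b f" if "\<And>u v. \<bar>u\<bar> \<le> 1 \<Longrightarrow> \<bar>v\<bar> \<le> 1 \<Longrightarrow> f' u v = f u v" for f f'
      unfolding nu_int2_def by (intro nu_int_cong that)
    \<comment> \<open>Each of the two classes contains \<open>k\<close> reflections.\<close>
    show "(\<Sum>l<2 * k. if even l then a else b) = real k * (a + b)"
      unfolding sum_lessThan_even_odd by (simp add: distrib_left)
  qed (use k ab in \<open>simp_all add: nu_int2_dih_weight\<close>)
  then show "V p z = (LBINT v:{-1..1}. (LBINT u:{-1..1}.
         ((1 + u) * (1 + v) - 2 / (a + b) * (a * u * (1 + v) + b * v * (1 + u)))
           * Pfun c N k (a + b) z u v * nu_dens a u) * nu_dens b v)"
    unfolding nu_int2_def nu_int_def weight_eq_dih_weight[OF ab] .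
next
  fix k :: nat and a :: real and V c N p z
  assume k3: "k \<ge> 3" and a: "a > 0" and V: "is_intertwiner k (\<lambda>j. a) V"
    and p: "\<forall>w. p w = (\<Sum>i\<le>N. \<Sum>j\<le>N. c i j * Re w ^ i * Im w ^ j)"
  have k: "k \<ge> 1" using k3 by simp
  interpret uv_functional "\<lambda>f. nu_int a (\<lambda>u. f u 1)" by (rule uv_functional_nu_int[OF a])
  have "V p z = nu_int a (\<lambda>u. (1 - u) * Pfun c N k a z u 1)"
  proof (rule intertwiner_integral[OF k a _ _ _ _ _ _ key_one_class[OF k a] V p])
    show "uv_fun (\<lambda>u v. 1 - u)" by (intro uv_fun_intros)
    show "nu_int a (\<lambda>u. 1 - u) = 1"
      using nu_int_add[OF a, of "\<lambda>_. 1" "\<lambda>u. (-1) * u"] nu_int_cmult[of a "-1" "\<lambda>u. u"]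
      by (simp add: nu_int_one nu_int_id a continuous_on_minus continuous_on_id)
    show "nu_int a (\<lambda>u. f' u 1) = nu_int a (\<lambda>u. f u 1)"
      if "\<And>u v. \<bar>u\<bar> \<le> 1 \<Longrightarrow> \<bar>v\<bar> \<le> 1 \<Longrightarrow> f' u v = f u v" for f f' :: "real \<Rightarrow> real \<Rightarrow> real"
      by (intro nu_int_cong that) simp_all
  qed (use k a in simp_all)
  then show "V p z = (LBINT u:{-1..1}. Pfun c N k a z u 1 * (1 - u) * nu_dens a u)"
    unfolding nu_int_def by (simp only: mult.commute[of "1 - _"])
qed

end
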